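(* Let $t$ and $k$ be natural numbers with $t\ge k\ge2$, and suppose that the real number $\mu$ satisfies $2t-\frac12k(k+1)<\mu\le 2t$ and $J_{t,k}(P)\ll_{t,k}P^{\mu}$ for all real $P\ge1$. For $s=t+l(k-1)$ with $l\in\mathbb N\cup\{0\}$, define $\lambda_s,\Delta_s,\theta_s$ and $\phi(j,s,J)$ recursively as follows. Put $\Delta_t=\mu+\frac12k(k+1)-2t$. For $s=t+l(k-1)$ with $l\ge1$: for each $j=1,\dots,k$, put $\phi(j,s,j)=1/k$, and for $J=j,j-1,\dots,2$ successively put $$\phi^*(j,s,J-1)=\frac1{2k}+\left(\frac12+\frac{\frac12(J-1)(J-2)-\Delta_{s-k+1}}{2k(k-J+1)}\right)\phi(j,s,J),\qquad \phi(j,s,J-1)=\min\{1/k,\phi^*(j,s,J-1)\}.$$ Then set $\theta_s=\min_{1\le j\le k}\phi(j,s,1)$, $\Delta_s=\Delta_{s-k+1}(1-\theta_s)+(k-1)(k\theta_s-1)$, and $\lambda_s=2s-\frac12k(k+1)+\Delta_s$. Then for each natural number $s=t+l(k-1)$ ($l\in\mathbb N$) one has $J_{s,k}(P)\ll P^{\lambda_s}$ for all real $P\ge1$, with implicit constant depending at most on $s,k,t,\mu$.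
   Context: $J_{s,k}(P)=\int_{[0,1)^k}\big|\sum_{1\le x\le P}e(\alpha_1x+\alpha_2x^2+\dots+\alpha_kx^k)\big|^{2s}d\boldsymbol\alpha$, where $e(z)=e^{2\pi iz}$; equivalently, the number of integral solutions of $\sum_{m=1}^s(x_m^i-y_m^i)=0$ $(1\le i\le k)$ with $1\le x_m,y_m\le P$. *)

theory Defs
  imports "HOL-Analysis.Analysis"
begin

definition e :: "real \<Rightarrow> complex" where
  "e z = exp (2 * complex_of_real pi * \<i> * complex_of_real z)"

text \<open>Points of \<open>[0,1)^k\<close> are extensional functions on \<open>{1..k}\<close>, with \<open>k\<close>-dimensional
  Lebesgue measure given by the finite product measure; \<open>P\<close> is real.\<close>

definition vinogradov_J :: "nat \<Rightarrow> nat \<Rightarrow> real \<Rightarrow> real" where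
  "vinogradov_J s k P =
     (LINT \<alpha>:(\<Pi>\<^sub>E i\<in>{1..k}. {0..<1})|(\<Pi>\<^sub>M i\<in>{1..k}. (lborel :: real measure)).
        cmod (\<Sum>x\<in>{x::nat. 1 \<le> x \<and> real x \<le> P}. e (\<Sum>i=1..k. \<alpha> i * real x ^ i)) ^ (2 * s))"

text \<open>The quantities attached to \<open>s = t + l(k-1)\<close> are indexed by \<open>l\<close>. The dependence of
  \<open>\<phi>(j,s,J)\<close> and \<open>\<theta>\<^sub>s\<close> on \<open>s\<close> is only through \<open>D = \<Delta>\<^bsub>s-k+1\<^esub>\<close>, the value at \<open>l - 1\<close>.

  \<open>phi_step k D J x\<close> is \<open>\<phi>*(j,s,J-1)\<close> for \<open>x = \<phi>(j,s,J)\<close>.\<close>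

definition phi_step :: "nat \<Rightarrow> real \<Rightarrow> nat \<Rightarrow> real \<Rightarrow> real" where
  "phi_step k D J x =
     1 / (2 * real k)
     + (1 / 2 + ((real J - 1) * (real J - 2) / 2 - D) / (2 * real k * (real k - real J + 1))) * x"

text \<open>Descending recursion in \<open>J\<close>, starting from \<open>J = j\<close>; only \<open>1 \<le> J \<le> j\<close> is meaningful.\<close>

function phi :: "nat \<Rightarrow> real \<Rightarrow> nat \<Rightarrow> nat \<Rightarrow> real" where
  "phi k D j J =
     (if j \<le> J then 1 / real k
      else min (1 / real k) (phi_step k D (J + 1) (phi k D j (J + 1))))"
  by pat_completeness auto
termination
  by (relation "Wellfounded.measure (\<lambda>(k, D, j, J). j - J)") auto

declare phi.simps [simp del]

definition theta :: "nat \<Rightarrow> real \<Rightarrow> real" where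
  "theta k D = Min ((\<lambda>j. phi k D j 1) ` {1..k})"

primrec Delta :: "nat \<Rightarrow> nat \<Rightarrow> real \<Rightarrow> nat \<Rightarrow> real" where
  "Delta t k \<mu> 0 = \<mu> + real k * (real k + 1) / 2 - 2 * real t"
| "Delta t k \<mu> (Suc l) =
     Delta t k \<mu> l * (1 - theta k (Delta t k \<mu> l))
     + (real k - 1) * (real k * theta k (Delta t k \<mu> l) - 1)"

definition lam :: "nat \<Rightarrow> nat \<Rightarrow> real \<Rightarrow> nat \<Rightarrow> real" where
  "lam t k \<mu> l = 2 * real (t + l * (k - 1)) - real k * (real k + 1) / 2 + Delta t k \<mu> l"

end

theory Submission
  imports Defs "HOL-Library.Real_Mod" "HOL-Computational_Algebra.Computational_Algebra"
    "HOL-Real_Asymp.Real_Asymp" "HOL-Number_Theory.Cong"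
begin

text \<open>
  The proof is Wooley's repeated efficient differencing. Write \<open>u = s - k + 1\<close> and let \<open>p\<close> be a prime of
  size \<open>P\<^sup>\<theta>\<close> modulo which the variables on either side are distinct. The \<open>k\<close> equations, read modulo
  \<open>p\<close>, leave \<open>O(p\<^bsup>2s-k\<^esup>)\<close> possibilities for the residues of all \<open>2s\<close> variables, and Hoelder's
  inequality makes \<open>2u\<close> of the variables congruent to a single \<open>c\<close>. After a translation by \<open>c\<close> the
  other \<open>k - 1\<close> variables on each side satisfy congruences modulo \<open>p\<^sup>j\<close> for \<open>2 \<le> j \<le> k\<close>, and at the
  cost of a factor \<open>p\<^bsup>(k-1)(k-2)/2\<^esup>\<close> Hensel lifting gives \<open>x\<^sub>i \<equiv> y\<^sub>i\<close> modulo \<open>p\<^sup>k\<close>. Counting the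
  residues of all the variables together, rather than of the \<open>2u\<close> variables alone, saves a factor \<open>p\<close>;
  this is why \<open>k - 1\<close> differenced variables suffice.

  Writing \<open>x\<^sub>i = y\<^sub>i + h p\<^sup>k\<close>, the terms with \<open>h = 0\<close> contribute \<open>P\<^bsup>k-1\<^esup> J\<^sub>u(P/p)\<close>. The others lead to a
  system of polynomials whose degrees have dropped by one, to which the argument is applied again with
  a new prime. At stage \<open>d\<close> the equations of index at most \<open>d\<close> involve only the \<open>2u\<close> variables, which
  saves a factor \<open>p\<^sup>d\<close>. The recursion for \<open>\<phi>(j,s,J)\<close> says that the terms with \<open>h = 0\<close> dominate at
  every stage; with \<open>\<phi> = 1/k\<close> there are no others.
\<close>

section \<open>Solution counts and exponential sums\<close>

text \<open>Differencing puts \<open>h\<close> and powers of \<open>q\<close> into the polynomials,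
  so a stage cannot be proved for one system alone: \<open>stage_bound\<close> is uniform over all
  integer polynomials of the right degrees whose leading coefficients are nonzero and at most a
  power of P. A good prime must divide neither these coefficients nor the relevant differences of
  variables on either side of a solution. The product of all those integers is nonzero and at most a
  power of P, while each prime exceeds P^\<phi>; hence one of a bounded number of primes is good,
  and summing over them costs only a constant. This needs \<phi> > 0, which rests on \<Delta> \<le>
  k(k+1)/2, a consequence of \<mu> \<le> 2t that persists under the recursion. Solutions with equal
  variables admit no good prime; they are traded for solutions in fewer variables. As exponents of q
  may be negative, these too have to be compared with quantities reduced at a prime. Second moments
  are averages over a finite grid of frequencies, so integrals enter only when J is identified with
  a count.\<close>

definition chi :: "nat \<Rightarrow> nat \<Rightarrow> (nat \<Rightarrow> nat) \<Rightarrow> (nat \<Rightarrow> int) \<Rightarrow> complex" where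
  "chi k M a v = (\<Prod>j\<in>{1..k}. cis (2 * pi * real (a j) * of_int (v j) / real M))"

text \<open>The average over the grid of points a/M stands in for the integral over the torus. Once
  M exceeds every value involved, orthogonality is exact. Each such requirement holds eventually in
  M, so one M can serve finitely many identities at once.\<close>

definition fmean :: "nat \<Rightarrow> nat \<Rightarrow> ((nat \<Rightarrow> nat) \<Rightarrow> 'a) \<Rightarrow> 'a::field" where
  "fmean k M g = (\<Sum>a\<in>{1..k} \<rightarrow>\<^sub>E {..<M}. g a) / of_nat (M ^ k)"

definition expsum :: "nat \<Rightarrow> nat \<Rightarrow> 'i set \<Rightarrow> ('i \<Rightarrow> nat \<Rightarrow> int) \<Rightarrow> (nat \<Rightarrow> nat) \<Rightarrow> complex" where
  "expsum k M A V a = (\<Sum>x\<in>A. chi k M a (V x))"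

text \<open>The second moment of \<open>expsum\<close>. Index set and vector-valued map are
  arbitrary, so that one notion covers J itself, mixed systems, and classes of solutions cut out by
  residues.\<close>

definition energy :: "nat \<Rightarrow> 'i set \<Rightarrow> ('i \<Rightarrow> nat \<Rightarrow> int) \<Rightarrow> nat" where
  "energy k A V = card {(x, y) \<in> A \<times> A. \<forall>j\<in>{1..k}. V x j = V y j}"

lemma chi_add: "chi k M a (\<lambda>j. v j + w j) = chi k M a v * chi k M a w"
  by (simp add: chi_def prod.distrib[symmetric] cis_mult distrib_left add_divide_distrib)

lemma chi_zero [simp]: "chi k M a (\<lambda>j. 0) = 1"
  by (simp add: chi_def)

lemma chi_uminus: "chi k M a (\<lambda>j. - v j) = cnj (chi k M a v)"
  by (simp add: chi_def cis_cnj)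

lemma norm_chi [simp]: "cmod (chi k M a v) = 1"
  by (simp add: chi_def prod_norm[symmetric])

lemma chi_sum: "chi k M a (\<lambda>j. \<Sum>i\<in>I. v i j) = (\<Prod>i\<in>I. chi k M a (v i))"
  by (induction I rule: infinite_finite_induct) (simp_all add: chi_add)

lemma sum_cis_roots:
  fixes n :: int
  assumes "M > 0" "\<bar>n\<bar> < int M"
  shows "(\<Sum>b<M. cis (2 * pi * real b * of_int n / real M)) = (if n = 0 then of_nat M else 0)"
proof (cases "n = 0")
  case False
  define w where "w = cis (2 * pi * of_int n / real M)"
  have "w \<noteq> 1"
  proof
    assume "w = 1"
    then obtain m :: int where "2 * pi * of_int n / real M = of_int m * (2 * pi)"
      unfolding w_def cis_eq_1_iff by blast
    hence "real_of_int n = of_int (m * int M)"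
      using assms(1) by (simp add: field_simps)
    hence "n = m * int M" by linarith
    hence "int M dvd n" by simp
    with False assms(2) show False
      using zdvd_imp_le[of "int M" "\<bar>n\<bar>"] by auto
  qed
  moreover have "w ^ M = 1"
  proof -
    have "w ^ M = cis (real M * (2 * pi * of_int n / real M))"
      unfolding w_def by (rule Complex.DeMoivre)
    also have "real M * (2 * pi * of_int n / real M) = 2 * pi * of_int n"
      using assms(1) by simp
    also have "cis \<dots> = 1"
      by (rule cis_multiple_2pi) simp
    finally show ?thesis .
  qed
  ultimately have "(\<Sum>b<M. w ^ b) = 0"
    using sum_gp_strict[of w M] by auto
  moreover have "w ^ b = cis (2 * pi * real b * of_int n / real M)" for b
    by (simp add: w_def Complex.DeMoivre mult_ac)
  ultimately show ?thesis using False by simp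
qed simp

lemma fmean_chi:
  assumes "M > 0" "\<And>j. j \<in> {1..k} \<Longrightarrow> \<bar>v j\<bar> < int M"
  shows "fmean k M (\<lambda>a. chi k M a v) = (if \<forall>j\<in>{1..k}. v j = 0 then 1 else 0)"
proof -
  have "(\<Sum>a\<in>{1..k} \<rightarrow>\<^sub>E {..<M}. chi k M a v)
      = (\<Prod>j\<in>{1..k}. \<Sum>b<M. cis (2 * pi * real b * of_int (v j) / real M))"
    unfolding chi_def by (rule prod_sum_PiE[symmetric]) auto
  also have "\<dots> = (\<Prod>j\<in>{1..k}. if v j = 0 then of_nat M else 0)"
    by (intro prod.cong refl sum_cis_roots assms) auto
  also have "\<dots> = (if \<forall>j\<in>{1..k}. v j = 0 then of_nat M ^ k else 0)"
    by auto
  finally show ?thesis using assms(1) by (auto simp: fmean_def)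
qed

lemma fmean_sum: "fmean k M (\<lambda>a. \<Sum>x\<in>A. g x a) = (\<Sum>x\<in>A. fmean k M (g x))"
  unfolding fmean_def by (subst sum.swap) (simp add: sum_divide_distrib)

lemma fmean_add: "fmean k M (\<lambda>a. g a + h a) = fmean k M g + fmean k M h"
  by (simp add: fmean_def sum.distrib add_divide_distrib)

lemma fmean_cmult: "fmean k M (\<lambda>a. c * g a) = c * fmean k M g"
  by (simp add: fmean_def sum_distrib_left[symmetric])

lemma fmean_mono:
  fixes g h :: "(nat \<Rightarrow> nat) \<Rightarrow> real"
  assumes "\<And>a. g a \<le> h a"
  shows "fmean k M g \<le> fmean k M h"
  unfolding fmean_def by (intro divide_right_mono sum_mono assms) auto

lemma norm_fmean_le: "cmod (fmean k M g) \<le> fmean k M (\<lambda>a. cmod (g a))"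
  unfolding fmean_def by (auto simp: norm_divide norm_power intro!: divide_right_mono norm_sum)

lemma fmean_of_real: "fmean k M (\<lambda>a. of_real (g a)) = (of_real (fmean k M g) :: complex)"
  by (simp add: fmean_def)

lemma finite_Collect_mem: "finite A \<Longrightarrow> finite {x \<in> A. P x}"
  by simp

lemma fmean_expsum:
  assumes "finite A"
  shows "\<forall>\<^sub>F M in sequentially. fmean k M (expsum k M A V)
            = of_nat (card {x \<in> A. \<forall>j\<in>{1..k}. V x j = 0})"
proof -
  have "\<forall>\<^sub>F M in sequentially. \<forall>x\<in>A. \<forall>j\<in>{1..k}. \<bar>V x j\<bar> < int M"
  proof (intro eventually_ball_finite ballI assms)
    fix x j
    show "\<forall>\<^sub>F M in sequentially. \<bar>V x j\<bar> < int M"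
      using eventually_gt_at_top[of "nat \<bar>V x j\<bar>"] by eventually_elim linarith
  qed auto
  thus ?thesis using eventually_gt_at_top[of 0]
  proof eventually_elim
    case (elim M)
    have "fmean k M (expsum k M A V) = (\<Sum>x\<in>A. fmean k M (\<lambda>a. chi k M a (V x)))"
      unfolding expsum_def by (rule fmean_sum)
    also have "\<dots> = (\<Sum>x\<in>A. if \<forall>j\<in>{1..k}. V x j = 0 then 1 else 0)"
      using elim by (intro sum.cong refl fmean_chi) auto
    also have "\<dots> = of_nat (card {x \<in> A. \<forall>j\<in>{1..k}. V x j = 0})"
      using assms by (simp add: sum.If_cases Int_def)
    finally show ?case .
  qed
qed

lemma expsum_times:
  "expsum k M (A \<times> B) (\<lambda>(x, y) j. V x j + W y j) a = expsum k M A V a * expsum k M B W a"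
  by (simp add: expsum_def sum_product sum.cartesian_product case_prod_unfold chi_add)

lemma cnj_expsum: "cnj (expsum k M A V a) = expsum k M A (\<lambda>x j. - V x j) a"
  by (simp add: expsum_def chi_uminus)

lemma expsum_times_cnj:
  "expsum k M (A \<times> B) (\<lambda>(x, y) j. V x j - W y j) a = expsum k M A V a * cnj (expsum k M B W a)"
  using expsum_times[of k M A B V "\<lambda>x j. - W x j" a] by (simp add: cnj_expsum)

lemma expsum_PiE:
  assumes "finite I" "\<And>i. i \<in> I \<Longrightarrow> finite (Z i)"
  shows "expsum k M (PiE I Z) (\<lambda>z j. \<Sum>i\<in>I. v i (z i) j) a = (\<Prod>i\<in>I. expsum k M (Z i) (v i) a)"
  unfolding expsum_def chi_sum using assms by (simp add: prod_sum_PiE)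

lemma fmean_energy:
  assumes "finite A"
  shows "\<forall>\<^sub>F M in sequentially. fmean k M (\<lambda>a. cmod (expsum k M A V a) ^ 2) = real (energy k A V)"
proof -
  have "\<forall>\<^sub>F M in sequentially. fmean k M (expsum k M (A \<times> A) (\<lambda>(x, y) j. V x j - V y j))
      = of_nat (card {p \<in> A \<times> A. \<forall>j\<in>{1..k}. (\<lambda>(x, y) j. V x j - V y j) p j = 0})"
    using assms by (intro fmean_expsum) auto
  thus ?thesis
  proof eventually_elim
    case (elim M)
    have "{p \<in> A \<times> A. \<forall>j\<in>{1..k}. (\<lambda>(x, y) j. V x j - V y j) p j = 0}
        = {(x, y) \<in> A \<times> A. \<forall>j\<in>{1..k}. V x j = V y j}"
      by auto
    moreover have "expsum k M (A \<times> A) (\<lambda>(x, y) j. V x j - V y j)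
        = (\<lambda>a. of_real (cmod (expsum k M A V a) ^ 2))"
      by (intro ext) (simp only: expsum_times_cnj complex_norm_square)
    ultimately have "fmean k M (\<lambda>a. of_real (cmod (expsum k M A V a) ^ 2))
        = (of_nat (energy k A V) :: complex)"
      using elim by (simp only: energy_def)
    hence "of_real (fmean k M (\<lambda>a. cmod (expsum k M A V a) ^ 2))
        = (of_real (real (energy k A V)) :: complex)"
      by (simp only: fmean_of_real of_real_of_nat_eq)
    thus ?case by (simp only: of_real_eq_iff)
  qed
qed

text \<open>Pointwise the product of the u sums is at most the u-th power of the largest one, and
  the square of that is among the terms on the right. This gives what Hoelder's inequality is wanted
  for: afterwards all u variables range over one and the same set.\<close>

lemma energy_Holder:
  fixes Z :: "nat \<Rightarrow> 'b set"
  assumes "finite A" "\<And>m. m < u \<Longrightarrow> finite (Z m)" "u > 0"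
  shows "energy k (A \<times> PiE {..<u} Z) (\<lambda>(x, z) j. V x j + (\<Sum>m<u. v (z m) j))
       \<le> (\<Sum>m<u. energy k (A \<times> PiE {..<u} (\<lambda>_. Z m)) (\<lambda>(x, z) j. V x j + (\<Sum>m<u. v (z m) j)))"
    (is "energy k ?A ?V \<le> (\<Sum>m<u. energy k (?B m) ?V)")
proof -
  have fin: "finite ?A" using assms by (auto intro!: finite_PiE)
  have finB: "finite (?B m)" if "m < u" for m
    using assms that by (auto intro!: finite_PiE)
  have "\<forall>\<^sub>F M in sequentially. \<forall>m\<in>{..<u}.
      fmean k M (\<lambda>a. cmod (expsum k M (?B m) ?V a) ^ 2) = real (energy k (?B m) ?V)"
    by (rule eventually_ball_finite) (auto intro!: fmean_energy finB)
  from eventually_conj[OF this fmean_energy[OF fin, of k ?V]]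
  obtain M where M: "\<And>m. m < u \<Longrightarrow> fmean k M (\<lambda>a. cmod (expsum k M (?B m) ?V a) ^ 2) = real (energy k (?B m) ?V)"
     "fmean k M (\<lambda>a. cmod (expsum k M ?A ?V a) ^ 2) = real (energy k ?A ?V)"
    by (auto dest!: eventually_happens)
  have A: "expsum k M ?A ?V a = expsum k M A V a * (\<Prod>m<u. expsum k M (Z m) v a)" for a
    using expsum_PiE[of "{..<u}" Z k M "\<lambda>_. v" a] assms(2) by (subst expsum_times) auto
  have B: "expsum k M (?B m) ?V a = expsum k M A V a * expsum k M (Z m) v a ^ u" if "m < u" for a m
    using assms that by (subst expsum_times) (simp add: expsum_PiE[where v = "\<lambda>_. v"])
  have "real (energy k ?A ?V) \<le> fmean k M (\<lambda>a. \<Sum>m<u. cmod (expsum k M (?B m) ?V a) ^ 2)"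
    unfolding M(2)[symmetric]
  proof (rule fmean_mono)
    fix a
    define t where "t = (\<lambda>m. cmod (expsum k M (Z m) v a))"
    obtain m0 where m0: "m0 < u" "\<And>m. m < u \<Longrightarrow> t m \<le> t m0"
    proof -
      have "Max (t ` {..<u}) \<in> t ` {..<u}" using assms(3) by (intro Max_in) auto
      then obtain m0 where "m0 < u" "t m0 = Max (t ` {..<u})" by auto
      thus ?thesis using that[of m0] by auto
    qed
    have "(\<Prod>m<u. t m) \<le> (\<Prod>m<u. t m0)" using m0 by (intro prod_mono) (auto simp: t_def)
    hence "(\<Prod>m<u. t m) \<le> t m0 ^ u" by simp
    hence "cmod (expsum k M ?A ?V a) \<le> cmod (expsum k M (?B m0) ?V a)"
      unfolding A B[OF m0(1)] norm_mult norm_power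
      by (intro mult_left_mono) (auto simp: t_def prod_norm[symmetric])
    hence "cmod (expsum k M ?A ?V a) ^ 2 \<le> cmod (expsum k M (?B m0) ?V a) ^ 2"
      by (intro power_mono) auto
    also have "\<dots> \<le> (\<Sum>m<u. cmod (expsum k M (?B m) ?V a) ^ 2)"
      using m0(1) by (intro member_le_sum) auto
    finally show "cmod (expsum k M ?A ?V a) ^ 2 \<le> \<dots>" .
  qed
  also have "\<dots> = real (\<Sum>m<u. energy k (?B m) ?V)"
    by (simp add: fmean_sum M(1))
  finally show ?thesis by linarith
qed

abbreviation tuples :: "nat \<Rightarrow> 'a set \<Rightarrow> (nat \<Rightarrow> 'a) set" where
  "tuples n X \<equiv> {..<n} \<rightarrow>\<^sub>E X"

lemma finite_tuples: "finite X \<Longrightarrow> finite (tuples n X)"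
  by (intro finite_PiE) auto

lemma energy_mono:
  assumes "finite B" "A \<subseteq> B"
  shows "energy k A V \<le> energy k B V"
  unfolding energy_def using assms by (intro card_mono) (auto intro: finite_subset[of _ "B \<times> B"])

lemma fmean_energy_times_tuples:
  assumes "finite X" "finite B"
  shows "\<forall>\<^sub>F M in sequentially.
     fmean k M (\<lambda>a. cmod (expsum k M X v a) ^ (2 * r) * cmod (expsum k M B U a) ^ 2)
     = real (energy k (tuples r X \<times> B) (\<lambda>(x, z) j. (\<Sum>i<r. v (x i) j) + U z j))"
proof -
  let ?A = "tuples r X \<times> B" and ?V = "\<lambda>(x, z) j. (\<Sum>i<r. v (x i) j) + U z j"
  have "finite ?A" using assms by (auto intro!: finite_PiE)
  from fmean_energy[OF this, of k ?V] show ?thesis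
  proof eventually_elim
    case (elim M)
    have "expsum k M ?A ?V a = expsum k M X v a ^ r * expsum k M B U a" for a
      using assms by (subst expsum_times) (simp add: expsum_PiE[where v = "\<lambda>_. v"])
    hence "cmod (expsum k M ?A ?V a) ^ 2
        = cmod (expsum k M X v a) ^ (2 * r) * cmod (expsum k M B U a) ^ 2" for a
      by (simp add: norm_mult norm_power power_mult_distrib power_mult[symmetric] mult.commute)
    thus ?case using elim by simp
  qed
qed

section \<open>Solutions with two equal variables\<close>

text \<open>The constant \<open>4 * real r ^ 2\<close> is made for
  \<open>energy_coincidence\<close>: at most r^2 pairs of indices, on each of two sides, contribute
  t^r divided by it, which is at most half of the total and can be moved to the left.\<close>

lemma coincidence_young:
  fixes n t :: real
  assumes "n \<ge> 0" "t \<ge> 0" "r > 0"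
  shows "n * t ^ (r - 1) \<le> t ^ r / (4 * real r ^ 2) + (4 * real r ^ 2) ^ r * n ^ r"
proof -
  have r: "4 * real r ^ 2 \<ge> 1" 
  proof -
    have "1 \<le> real r ^ 2" using assms(3) by (intro one_le_power) auto
    thus ?thesis by simp
  qed
  obtain r' where r': "r = Suc r'" using assms(3) by (cases r) auto
  define c where "c = 4 * real r ^ 2"
  have c: "c \<ge> 1" using r by (simp add: c_def)
  have "n * t ^ r' \<le> t ^ r / c + c ^ r * n ^ r"
  proof (cases "n * c \<le> t")
    case True
    hence "n * c * t ^ r' \<le> t * t ^ r'" using assms by (intro mult_right_mono) auto
    hence "n * t ^ r' \<le> t ^ r / c" using c by (simp add: r' field_simps)
    moreover have "0 \<le> c ^ r * n ^ r" using c assms by simp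
    ultimately show ?thesis by linarith
  next
    case False
    hence "n * t ^ r' \<le> n * (n * c) ^ r'"
      using assms by (intro mult_left_mono power_mono) auto
    also have "\<dots> = c ^ r' * n ^ r" by (simp add: r' power_mult_distrib)
    also have "\<dots> \<le> c ^ r * n ^ r"
      using c assms by (intro mult_right_mono power_increasing) (auto simp: r')
    finally show ?thesis using assms c by (smt (verit) divide_nonneg_nonneg zero_le_power)
  qed
  thus ?thesis by (simp add: r' c_def)
qed

text \<open>Fixing the common value t of two variables turns two of the r factors into numbers of
  modulus 1, so that |f|^(2r) becomes |f|^(2r-2); the choices of t give the factor
  \<open>card X\<close>.\<close>

lemma card_coincidence_le:
  fixes X :: "'a set"
  assumes "finite X" "finite B" "a < b" "b < r"
  shows "\<forall>\<^sub>F M in sequentially.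
    real (card {((x, z), (y, w)) \<in> (tuples r X \<times> B) \<times> (tuples r X \<times> B).
        x a = x b \<and> (\<forall>j\<in>{1..k}. (\<Sum>i<r. v (x i) j) + U z j = (\<Sum>i<r. v (y i) j) + U w j)})
    \<le> real (card X) * fmean k M (\<lambda>\<alpha>. (cmod (expsum k M X v \<alpha>) ^ 2) ^ (r - 1) * cmod (expsum k M B U \<alpha>) ^ 2)"
proof -
  let ?V = "\<lambda>(x, z) j. (\<Sum>i<r. v (x i) j) + U z j"
  define A where "A = (\<lambda>t. PiE {..<r} (\<lambda>i. if i = a \<or> i = b then {t} else X))"
  define T where "T = (\<lambda>t. {p \<in> (A t \<times> B) \<times> (tuples r X \<times> B). \<forall>j\<in>{1..k}. (\<lambda>(p, q) j. ?V p j - ?V q j) p j = 0})"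
  have finA: "finite (A t)" for t unfolding A_def using assms by (intro finite_PiE) auto
  have finT: "finite (T t)" for t unfolding T_def using finA assms finite_tuples[OF assms(1)] by auto
  have "\<forall>\<^sub>F M in sequentially. \<forall>t\<in>X. fmean k M (expsum k M ((A t \<times> B) \<times> (tuples r X \<times> B)) (\<lambda>(p, q) j. ?V p j - ?V q j))
            = of_nat (card (T t))"
    unfolding T_def using finA assms finite_tuples[OF assms(1)]
    by (intro eventually_ball_finite ballI fmean_expsum) auto
  thus ?thesis
  proof eventually_elim
    case (elim M)
    have "{((x, z), (y, w)) \<in> (tuples r X \<times> B) \<times> (tuples r X \<times> B).
        x a = x b \<and> (\<forall>j\<in>{1..k}. (\<Sum>i<r. v (x i) j) + U z j = (\<Sum>i<r. v (y i) j) + U w j)} \<subseteq> (\<Union>t\<in>X. T t)"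
    proof (clarify, goal_cases)
      case (1 x z y w)
      have "x a \<in> X" using 1 assms by auto
      moreover have "x \<in> A (x a)" using 1 assms by (auto simp: A_def PiE_iff)
      ultimately show ?case using 1 by (auto simp: T_def intro!: bexI[of _ "x a"])
    qed
    hence "card {((x, z), (y, w)) \<in> (tuples r X \<times> B) \<times> (tuples r X \<times> B).
        x a = x b \<and> (\<forall>j\<in>{1..k}. (\<Sum>i<r. v (x i) j) + U z j = (\<Sum>i<r. v (y i) j) + U w j)} \<le> card (\<Union>t\<in>X. T t)"
      using assms finT by (intro card_mono) auto
    also have "\<dots> \<le> (\<Sum>t\<in>X. card (T t))" using assms by (intro card_UN_le)
    finally have "real (card {((x, z), (y, w)) \<in> (tuples r X \<times> B) \<times> (tuples r X \<times> B).
        x a = x b \<and> (\<forall>j\<in>{1..k}. (\<Sum>i<r. v (x i) j) + U z j = (\<Sum>i<r. v (y i) j) + U w j)}) \<le> (\<Sum>t\<in>X. real (card (T t)))"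
      by (simp only: of_nat_sum[symmetric] of_nat_le_iff)
    also have "\<dots> \<le> (\<Sum>t\<in>X. fmean k M (\<lambda>\<alpha>. (cmod (expsum k M X v \<alpha>) ^ 2) ^ (r - 1) * cmod (expsum k M B U \<alpha>) ^ 2))"
    proof (rule sum_mono)
      fix t assume t: "t \<in> X"
      have "real (card (T t)) = cmod (of_nat (card (T t)))" by simp
      also have "\<dots> \<le> fmean k M (\<lambda>\<alpha>. cmod (expsum k M ((A t \<times> B) \<times> (tuples r X \<times> B)) (\<lambda>(p, q) j. ?V p j - ?V q j) \<alpha>))"
        unfolding elim[rule_format, OF t, symmetric] by (rule norm_fmean_le)
      also have "\<dots> = fmean k M (\<lambda>\<alpha>. (cmod (expsum k M X v \<alpha>) ^ 2) ^ (r - 1) * cmod (expsum k M B U \<alpha>) ^ 2)"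
      proof (rule arg_cong[of _ _ "fmean k M"], rule ext)
        fix \<alpha>
        have "expsum k M (A t \<times> B) ?V \<alpha> = (\<Prod>i<r. expsum k M (if i = a \<or> i = b then {t} else X) v \<alpha>) * expsum k M B U \<alpha>"
          unfolding A_def using assms by (subst expsum_times) (simp add: expsum_PiE[where v = "\<lambda>_. v"])
        moreover have "(\<Prod>i<r. cmod (expsum k M (if i = a \<or> i = b then {t} else X) v \<alpha>)) = cmod (expsum k M X v \<alpha>) ^ (r - 2)"
        proof -
          have "(\<Prod>i<r. cmod (expsum k M (if i = a \<or> i = b then {t} else X) v \<alpha>))
              = (\<Prod>i<r. if i \<in> {a, b} then 1 else cmod (expsum k M X v \<alpha>))"
            by (intro prod.cong) (auto simp: expsum_def)
          also have "\<dots> = (\<Prod>i\<in>{..<r} - {a, b}. cmod (expsum k M X v \<alpha>))"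
            by (rule prod.mono_neutral_cong_right) auto
          also have "\<dots> = cmod (expsum k M X v \<alpha>) ^ card ({..<r} - {a, b})"
            by (rule prod_constant)
          also have "card ({..<r} - {a, b}) = r - 2"
            using assms by (subst card_Diff_subset) auto
          finally show ?thesis .
        qed
        moreover have "expsum k M (tuples r X \<times> B) ?V \<alpha> = expsum k M X v \<alpha> ^ r * expsum k M B U \<alpha>"
          using assms by (subst expsum_times) (simp add: expsum_PiE[where v = "\<lambda>_. v"])
        moreover have "expsum k M ((A t \<times> B) \<times> (tuples r X \<times> B)) (\<lambda>(p, q) j. ?V p j - ?V q j) \<alpha>
            = expsum k M (A t \<times> B) ?V \<alpha> * cnj (expsum k M (tuples r X \<times> B) ?V \<alpha>)"
          by (rule expsum_times_cnj)
        ultimately have "cmod (expsum k M ((A t \<times> B) \<times> (tuples r X \<times> B)) (\<lambda>(p, q) j. ?V p j - ?V q j) \<alpha>)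
            = cmod (expsum k M X v \<alpha>) ^ (r - 2) * cmod (expsum k M B U \<alpha>) * (cmod (expsum k M X v \<alpha>) ^ r * cmod (expsum k M B U \<alpha>))"
          by (simp add: norm_mult norm_power prod_norm[symmetric])
        also have "\<dots> = cmod (expsum k M X v \<alpha>) ^ (r - 2 + r) * cmod (expsum k M B U \<alpha>) ^ 2"
          by (simp add: power_add power2_eq_square)
        also have "r - 2 + r = 2 * (r - 1)" using assms by simp
        finally show "cmod (expsum k M ((A t \<times> B) \<times> (tuples r X \<times> B)) (\<lambda>(p, q) j. ?V p j - ?V q j) \<alpha>)
            = (cmod (expsum k M X v \<alpha>) ^ 2) ^ (r - 1) * cmod (expsum k M B U \<alpha>) ^ 2"
          by (simp add: power_mult)
      qed
      finally show "real (card (T t)) \<le> \<dots>" .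
    qed
    finally show ?case by simp
  qed
qed

text \<open>A solution either has distinct variables on both sides or a coincidence on one of them.
  Young's inequality splits the coincidences into a part of the total, which is absorbed, and the
  number of solutions in the B-variables alone, which is left to be bounded separately.\<close>

lemma energy_coincidence:
  fixes X :: "'a set"
    and v :: "'a \<Rightarrow> nat \<Rightarrow> int" and U :: "'b \<Rightarrow> nat \<Rightarrow> int" and r :: nat
  assumes "finite X" "finite B"
  defines "V \<equiv> (\<lambda>(x, z) j. (\<Sum>i<r. v (x i) j) + U z j)"
  shows "real (energy k (tuples r X \<times> B) V)
     \<le> 2 * real (energy k ({x \<in> tuples r X. inj_on x {..<r}} \<times> B) V)
       + (4 * real r ^ 2) ^ (r + 1) * real (card X) ^ r * real (energy k B U)"
proof (cases "r = 0")
  case True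
  show ?thesis by (simp add: True PiE_def Pi_def)
next
  case False
  let ?A = "tuples r X \<times> B" and ?D = "{x \<in> tuples r X. inj_on x {..<r}} \<times> B"
  let ?S = "{(p, q) \<in> ?A \<times> ?A. \<forall>j\<in>{1..k}. V p j = V q j}"
  let ?I = "{(a, b). a < b \<and> b < r}"
  define L where "L = (\<lambda>(a, b). {((x, z), (y, w)) \<in> ?A \<times> ?A.
        x a = x b \<and> (\<forall>j\<in>{1..k}. (\<Sum>i<r. v (x i) j) + U z j = (\<Sum>i<r. v (y i) j) + U w j)})"
  define R where "R = (\<lambda>p. prod.swap ` L p)"
  have finI: "finite ?I" by (rule finite_subset[of _ "{..<r} \<times> {..<r}"]) auto
  have cardI: "card ?I \<le> r ^ 2"
  proof -
    have "card ?I \<le> card ({..<r} \<times> {..<r})" by (intro card_mono) auto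
    thus ?thesis by (simp add: power2_eq_square)
  qed
  have finA: "finite ?A" using assms finite_tuples by blast
  have finL: "finite (L p)" for p
    by (rule finite_subset[of _ "?A \<times> ?A"]) (use finA in \<open>auto simp: L_def split: prod.splits\<close>)
  have cardR: "card (R p) = card (L p)" for p
    unfolding R_def by (intro card_image) (auto simp: inj_on_def)
  have sub: "?S \<subseteq> {(p, q) \<in> ?D \<times> ?D. \<forall>j\<in>{1..k}. V p j = V q j} \<union> (\<Union>p\<in>?I. L p) \<union> (\<Union>p\<in>?I. R p)"
  proof
    fix s assume "s \<in> ?S"
    then obtain x z y w where s: "s = ((x, z), (y, w))" "x \<in> tuples r X" "y \<in> tuples r X" "z \<in> B" "w \<in> B"
        "\<forall>j\<in>{1..k}. (\<Sum>i<r. v (x i) j) + U z j = (\<Sum>i<r. v (y i) j) + U w j"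
      by (auto simp: V_def)
    have noninj: "\<exists>a b. a < b \<and> b < r \<and> x a = x b" if "\<not> inj_on x {..<r}" for x :: "nat \<Rightarrow> 'a"
      using that unfolding inj_on_def by (metis lessThan_iff linorder_neqE_nat)
    consider "inj_on x {..<r}" "inj_on y {..<r}" | "\<not> inj_on x {..<r}" | "\<not> inj_on y {..<r}" by blast
    thus "s \<in> {(p, q) \<in> ?D \<times> ?D. \<forall>j\<in>{1..k}. V p j = V q j} \<union> (\<Union>p\<in>?I. L p) \<union> (\<Union>p\<in>?I. R p)"
    proof cases
      case 1
      thus ?thesis using s by (simp add: V_def)
    next
      case 2
      then obtain a b where ab: "a < b" "b < r" "x a = x b" using noninj by blast
      hence "s \<in> L (a, b)" using s by (simp add: L_def)
      thus ?thesis using ab by auto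
    next
      case 3
      then obtain a b where ab: "a < b" "b < r" "y a = y b" using noninj by blast
      have "((y, w), (x, z)) \<in> L (a, b)" using s ab by (simp add: L_def)
      hence "prod.swap ((y, w), (x, z)) \<in> R (a, b)" unfolding R_def by (rule imageI)
      hence "s \<in> R (a, b)" by (simp add: s)
      thus ?thesis using ab by auto
    qed
  qed
  let ?E = "{(p, q) \<in> ?D \<times> ?D. \<forall>j\<in>{1..k}. V p j = V q j}"
  have finE: "finite ?E" by (rule finite_subset[of _ "?A \<times> ?A"]) (use finA in auto)
  have finR: "finite (R p)" for p using finL by (simp add: R_def)
  have "card ?S \<le> card (?E \<union> (\<Union>p\<in>?I. L p) \<union> (\<Union>p\<in>?I. R p))"
    using finI finL finR finE by (intro card_mono[OF _ sub]) blast
  also have "\<dots> \<le> card ?E + card (\<Union>p\<in>?I. L p) + card (\<Union>p\<in>?I. R p)"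
    by (intro order.trans[OF card_Un_le] add_mono card_Un_le order.refl)
  also have "\<dots> \<le> card ?E + (\<Sum>p\<in>?I. card (L p)) + (\<Sum>p\<in>?I. card (R p))"
    using finI by (intro add_mono card_UN_le order.refl)
  finally have main: "energy k ?A V \<le> energy k ?D V + 2 * (\<Sum>p\<in>?I. card (L p))"
    by (simp add: energy_def cardR)
  have ev: "\<forall>\<^sub>F M in sequentially. (\<forall>p\<in>?I. real (card (L p))
    \<le> real (card X) * fmean k M (\<lambda>\<alpha>. (cmod (expsum k M X v \<alpha>) ^ 2) ^ (r - 1) * cmod (expsum k M B U \<alpha>) ^ 2))"
  proof (intro eventually_ball_finite finI ballI)
    fix p assume "p \<in> ?I"
    then obtain a b where "p = (a, b)" "a < b" "b < r" by auto
    thus "\<forall>\<^sub>F M in sequentially. real (card (L p))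
      \<le> real (card X) * fmean k M (\<lambda>\<alpha>. (cmod (expsum k M X v \<alpha>) ^ 2) ^ (r - 1) * cmod (expsum k M B U \<alpha>) ^ 2)"
      using card_coincidence_le[OF assms(1,2), of a b r k v U] by (simp add: L_def)
  qed
  from eventually_conj[OF eventually_conj[OF ev fmean_energy[OF assms(2), of k U]]
      fmean_energy_times_tuples[OF assms(1,2), of k v r U]]
  obtain M where M: "\<And>p. p \<in> ?I \<Longrightarrow> real (card (L p))
       \<le> real (card X) * fmean k M (\<lambda>\<alpha>. (cmod (expsum k M X v \<alpha>) ^ 2) ^ (r - 1) * cmod (expsum k M B U \<alpha>) ^ 2)"
     "fmean k M (\<lambda>a. cmod (expsum k M B U a) ^ 2) = real (energy k B U)"
     "fmean k M (\<lambda>a. cmod (expsum k M X v a) ^ (2 * r) * cmod (expsum k M B U a) ^ 2) = real (energy k ?A V)"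
    unfolding V_def by (auto dest!: eventually_happens)
  let ?c = "4 * real r ^ 2"
  have "real (card X) * fmean k M (\<lambda>\<alpha>. (cmod (expsum k M X v \<alpha>) ^ 2) ^ (r - 1) * cmod (expsum k M B U \<alpha>) ^ 2)
      = fmean k M (\<lambda>\<alpha>. real (card X) * ((cmod (expsum k M X v \<alpha>) ^ 2) ^ (r - 1) * cmod (expsum k M B U \<alpha>) ^ 2))"
    by (rule fmean_cmult[symmetric])
  also have "\<dots> \<le> fmean k M (\<lambda>\<alpha>. (1 / ?c) * (cmod (expsum k M X v \<alpha>) ^ (2 * r) * cmod (expsum k M B U \<alpha>) ^ 2)
       + (?c ^ r * real (card X) ^ r) * cmod (expsum k M B U \<alpha>) ^ 2)"
  proof (rule fmean_mono)
    fix \<alpha>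
    have "real (card X) * (cmod (expsum k M X v \<alpha>) ^ 2) ^ (r - 1) \<le>
        (cmod (expsum k M X v \<alpha>) ^ 2) ^ r / ?c + ?c ^ r * real (card X) ^ r"
      using False by (intro coincidence_young) auto
    from mult_right_mono[OF this, of "cmod (expsum k M B U \<alpha>) ^ 2"]
    show "real (card X) * ((cmod (expsum k M X v \<alpha>) ^ 2) ^ (r - 1) * cmod (expsum k M B U \<alpha>) ^ 2)
      \<le> (1 / ?c) * (cmod (expsum k M X v \<alpha>) ^ (2 * r) * cmod (expsum k M B U \<alpha>) ^ 2)
       + (?c ^ r * real (card X) ^ r) * cmod (expsum k M B U \<alpha>) ^ 2"
      by (simp only: power_mult) (simp add: algebra_simps)
  qed
  also have "\<dots> = (1 / ?c) * real (energy k ?A V) + (?c ^ r * real (card X) ^ r) * real (energy k B U)"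
    by (simp only: fmean_add fmean_cmult M)
  finally have b: "real (card (L p)) \<le> (1 / ?c) * real (energy k ?A V) + (?c ^ r * real (card X) ^ r) * real (energy k B U)"
    if "p \<in> ?I" for p using M(1)[OF that] by linarith
  let ?b = "(1 / ?c) * real (energy k ?A V) + (?c ^ r * real (card X) ^ r) * real (energy k B U)"
  have b0: "?b \<ge> 0" by (intro add_nonneg_nonneg mult_nonneg_nonneg) auto
  have "real (energy k ?A V) \<le> real (energy k ?D V) + 2 * (\<Sum>p\<in>?I. real (card (L p)))"
    using of_nat_mono[OF main, where 'a = real] by simp
  also have "(\<Sum>p\<in>?I. real (card (L p))) \<le> real (card ?I) * ?b"
    using sum_bounded_above[of ?I "\<lambda>p. real (card (L p))" ?b] b by simp
  also have "\<dots> \<le> real r ^ 2 * ?b"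
    using cardI b0 by (intro mult_right_mono) (simp_all only: of_nat_power[symmetric] of_nat_le_iff)
  \<comment> \<open>The factor r^2 / (4 r^2) leaves a quarter of the total energy; doubled for the
    two sides it is one half, which then moves to the left.\<close>
  also have "real r ^ 2 * ?b = real (energy k ?A V) / 4 + ?c / 4 * (?c ^ r * real (card X) ^ r * real (energy k B U))"
    using False by (simp add: field_simps)
  finally show ?thesis by (simp add: algebra_simps)
qed

section \<open>Sorting solutions into classes\<close>

lemma energy_sum_squares:
  assumes "finite A" "finite N" "(\<lambda>x. restrict (V x) {1..k}) ` A \<subseteq> N"
  shows "energy k A V = (\<Sum>n\<in>N. card {x \<in> A. restrict (V x) {1..k} = n} ^ 2)"
proof -
  define K where "K = (\<lambda>x. restrict (V x) {1..k})"
  have iff: "K x = K y \<longleftrightarrow> (\<forall>j\<in>{1..k}. V x j = V y j)" for x y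
    unfolding K_def by (metis (no_types, lifting) restrict_apply' restrict_ext)
  have "{(x, y) \<in> A \<times> A. \<forall>j\<in>{1..k}. V x j = V y j} = (\<Union>n\<in>N. {x \<in> A. K x = n} \<times> {x \<in> A. K x = n})"
    using assms(3) unfolding iff[symmetric] by (auto simp: K_def)
  also have "card \<dots> = (\<Sum>n\<in>N. card ({x \<in> A. K x = n} \<times> {x \<in> A. K x = n}))"
    using assms by (intro card_UN_disjoint) auto
  finally show ?thesis unfolding energy_def by (simp only: power2_eq_square card_cartesian_product K_def)
qed

text \<open>Cauchy's inequality along a relation of bounded degree. If c(n,a) elements of the class
  a take the value n, related classes contribute c(n,a) c(n,b), at most half the sum of the two
  squares; by symmetry of \<rho> each square is then met at most D times. In this way a congruence
  between the two sides of a solution is turned into equality of their classes, at the cost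
  D.\<close>

lemma energy_relation:
  assumes "finite A"
    and rel: "\<And>x y. x \<in> A \<Longrightarrow> y \<in> A \<Longrightarrow> \<forall>j\<in>{1..k}. V x j = V y j \<Longrightarrow> \<rho> (g x) (g y)"
    and sym: "\<And>a b. \<rho> a b \<Longrightarrow> \<rho> b a"
    and deg: "\<And>a. a \<in> g ` A \<Longrightarrow> card {b \<in> g ` A. \<rho> a b} \<le> D"
  shows "energy k A V \<le> D * (\<Sum>a\<in>g ` A. energy k {x \<in> A. g x = a} V)"
proof -
  define K where "K = (\<lambda>x. restrict (V x) {1..k})"
  define c where "c = (\<lambda>n a. card {x \<in> A. g x = a \<and> K x = n})"
  have iff: "K x = K y \<longleftrightarrow> (\<forall>j\<in>{1..k}. V x j = V y j)" for x y
    unfolding K_def by (metis (no_types, lifting) restrict_apply' restrict_ext)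
  let ?G = "g ` A" and ?N = "K ` A"
  have fin: "finite ?G" "finite ?N" using assms by auto
  let ?R = "\<lambda>n. (SIGMA a:?G. {b \<in> ?G. \<rho> a b})"
  have finR: "finite (?R n)" for n using fin by auto
  have swap: "(\<Sum>p\<in>?R n. c n (snd p) ^ 2) = (\<Sum>p\<in>?R n. c n (fst p) ^ 2)" for n
    by (rule sum.reindex_bij_witness[of _ prod.swap prod.swap]) (auto dest: sym)
  have degs: "(\<Sum>p\<in>?R n. c n (fst p) ^ 2) = (\<Sum>a\<in>?G. card {b \<in> ?G. \<rho> a b} * c n a ^ 2)" for n
  proof -
    have "(\<Sum>a\<in>?G. \<Sum>b\<in>{b \<in> ?G. \<rho> a b}. c n a ^ 2) = (\<Sum>(a, b)\<in>?R n. c n a ^ 2)"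
      using fin by (intro sum.Sigma) auto
    thus ?thesis by (simp add: case_prod_unfold)
  qed
  have "{(x, y) \<in> A \<times> A. \<forall>j\<in>{1..k}. V x j = V y j}
      \<subseteq> (\<Union>n\<in>?N. \<Union>p\<in>?R n. {x \<in> A. g x = fst p \<and> K x = n} \<times> {x \<in> A. g x = snd p \<and> K x = n})"
  proof (clarify, goal_cases)
    case (1 x y)
    hence "\<rho> (g x) (g y)" using rel by blast
    moreover have "K y = K x" using 1 iff[of y x] by auto
    ultimately show ?case using 1 by force
  qed
  hence "energy k A V \<le> card (\<Union>n\<in>?N. \<Union>p\<in>?R n. {x \<in> A. g x = fst p \<and> K x = n} \<times> {x \<in> A. g x = snd p \<and> K x = n})"
    unfolding energy_def using fin finR assms(1) by (intro card_mono) auto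
  also have "\<dots> \<le> (\<Sum>n\<in>?N. card (\<Union>p\<in>?R n. {x \<in> A. g x = fst p \<and> K x = n} \<times> {x \<in> A. g x = snd p \<and> K x = n}))"
    by (rule card_UN_le[OF fin(2)])
  also have "\<dots> \<le> (\<Sum>n\<in>?N. \<Sum>p\<in>?R n. card ({x \<in> A. g x = fst p \<and> K x = n} \<times> {x \<in> A. g x = snd p \<and> K x = n}))"
    by (intro sum_mono card_UN_le finR)
  also have "\<dots> = (\<Sum>n\<in>?N. \<Sum>p\<in>?R n. c n (fst p) * c n (snd p))"
    by (simp add: card_cartesian_product c_def)
  finally have "2 * energy k A V \<le> (\<Sum>n\<in>?N. \<Sum>p\<in>?R n. 2 * (c n (fst p) * c n (snd p)))"
    by (simp add: sum_distrib_left[symmetric])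
  also have "\<dots> \<le> (\<Sum>n\<in>?N. \<Sum>p\<in>?R n. c n (fst p) ^ 2 + c n (snd p) ^ 2)"
  proof (intro sum_mono)
    fix n p
    have "int (2 * (c n (fst p) * c n (snd p))) \<le> int (c n (fst p) ^ 2 + c n (snd p) ^ 2)"
      using zero_le_power2[of "int (c n (fst p)) - int (c n (snd p))"]
      by (simp add: power2_diff)
    thus "2 * (c n (fst p) * c n (snd p)) \<le> c n (fst p) ^ 2 + c n (snd p) ^ 2"
      by (simp only: of_nat_le_iff)
  qed
  also have "\<dots> = (\<Sum>n\<in>?N. (\<Sum>p\<in>?R n. c n (fst p) ^ 2) + (\<Sum>p\<in>?R n. c n (snd p) ^ 2))"
    by (simp add: sum.distrib)
  also have "\<dots> = 2 * (\<Sum>n\<in>?N. \<Sum>a\<in>?G. card {b \<in> ?G. \<rho> a b} * c n a ^ 2)"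
    by (simp only: swap degs sum.distrib mult_2)
  also have "(\<Sum>n\<in>?N. \<Sum>a\<in>?G. card {b \<in> ?G. \<rho> a b} * c n a ^ 2) \<le> (\<Sum>n\<in>?N. \<Sum>a\<in>?G. D * c n a ^ 2)"
    by (intro sum_mono mult_right_mono deg) auto
  also have "\<dots> = D * (\<Sum>a\<in>?G. \<Sum>n\<in>?N. c n a ^ 2)"
    by (subst sum.swap) (simp add: sum_distrib_left)
  also have "(\<Sum>a\<in>?G. \<Sum>n\<in>?N. c n a ^ 2) = (\<Sum>a\<in>?G. energy k {x \<in> A. g x = a} V)"
  proof (intro sum.cong refl)
    fix a
    have "energy k {x \<in> A. g x = a} V = (\<Sum>n\<in>?N. card {x \<in> {x \<in> A. g x = a}. restrict (V x) {1..k} = n} ^ 2)"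
      using assms(1) fin by (intro energy_sum_squares) (auto simp: K_def)
    also have "\<dots> = (\<Sum>n\<in>?N. c n a ^ 2)" by (simp add: c_def K_def)
    finally show "(\<Sum>n\<in>?N. c n a ^ 2) = energy k {x \<in> A. g x = a} V" ..
  qed
  finally show ?thesis by simp
qed

lemma sum_energy_classes:
  assumes "finite A"
  shows "(\<Sum>a\<in>g ` A. energy k {x \<in> A. g x = a} V)
       = card {(x, y) \<in> A \<times> A. g x = g y \<and> (\<forall>j\<in>{1..k}. V x j = V y j)}"
proof -
  have "{(x, y) \<in> A \<times> A. g x = g y \<and> (\<forall>j\<in>{1..k}. V x j = V y j)}
     = (\<Union>a\<in>g ` A. {(x, y) \<in> {x \<in> A. g x = a} \<times> {x \<in> A. g x = a}. \<forall>j\<in>{1..k}. V x j = V y j})"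
    by auto
  also have "card \<dots> = (\<Sum>a\<in>g ` A. card {(x, y) \<in> {x \<in> A. g x = a} \<times> {x \<in> A. g x = a}. \<forall>j\<in>{1..k}. V x j = V y j})"
    using assms by (intro card_UN_disjoint) (auto intro: finite_subset[of _ "A \<times> A"])
  finally show ?thesis by (simp add: energy_def)
qed

section \<open>Differencing over congruent pairs\<close>

lemma power_mean_nat:
  fixes t :: "'a \<Rightarrow> real"
  assumes "even n" "finite I" "n > 0"
  shows "(\<Sum>i\<in>I. t i) ^ n \<le> real (card I) ^ (n - 1) * (\<Sum>i\<in>I. t i ^ n)"
proof (cases "I = {}")
  case False
  let ?c = "real (card I)"
  have c: "?c > 0" using False assms by (simp add: card_gt_0_iff)
  have "(\<Sum>i\<in>I. (1 / ?c) *\<^sub>R t i) ^ n \<le> (\<Sum>i\<in>I. (1 / ?c) * t i ^ n)"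
    using c False assms by (intro convex_on_sum[OF _ _ convex_power_even[OF assms(1)]]) auto
  hence "(\<Sum>i\<in>I. t i) ^ n / ?c ^ n \<le> (\<Sum>i\<in>I. t i ^ n) / ?c"
    by (simp add: sum_divide_distrib[symmetric] power_divide)
  hence "(\<Sum>i\<in>I. t i) ^ n \<le> (\<Sum>i\<in>I. t i ^ n) / ?c * ?c ^ n"
    using c by (simp only: pos_divide_le_eq zero_less_power)
  also obtain m where "n = Suc m" using assms(3) by (cases n) auto
  hence "(\<Sum>i\<in>I. t i ^ n) / ?c * ?c ^ n = ?c ^ (n - 1) * (\<Sum>i\<in>I. t i ^ n)"
    using c by simp
  finally show ?thesis .
qed (use assms in \<open>auto simp: power_0_left\<close>)

text \<open>The exponent of S is raised from r to m, later an even number 2r', so that the moment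
  counts solutions with r' variables on each side. Where S \<le> N the first term suffices;
  elsewhere (S/N)^r \<le> (S/N)^m.\<close>

lemma differencing_young:
  fixes N S :: real
  assumes "N > 0" "S \<ge> 0" "r \<le> m"
  shows "(N + 2 * S) ^ r \<le> 3 ^ r * (2 * N ^ r + N ^ r / N ^ m * S ^ m)"
proof (cases "S \<le> N")
  case True
  have "(N + 2 * S) ^ r \<le> (3 * N) ^ r" using assms True by (intro power_mono) auto
  also have "\<dots> \<le> 3 ^ r * (2 * N ^ r + N ^ r / N ^ m * S ^ m)"
    using assms by (simp add: power_mult_distrib)
  finally show ?thesis .
next
  case False
  have "(N + 2 * S) ^ r \<le> (3 * S) ^ r" using assms False by (intro power_mono) auto
  also have "\<dots> = 3 ^ r * (N ^ r * (S / N) ^ r)"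
    using assms by (simp add: power_mult_distrib power_divide)
  also have "\<dots> \<le> 3 ^ r * (N ^ r * (S / N) ^ m)"
    using assms False by (intro mult_left_mono power_increasing) (auto simp: field_simps)
  also have "N ^ r * (S / N) ^ m = N ^ r / N ^ m * S ^ m" by (simp add: power_divide)
  also have "3 ^ r * \<dots> \<le> 3 ^ r * (2 * N ^ r + N ^ r / N ^ m * S ^ m)"
    using assms by (intro mult_left_mono) auto
  finally show ?thesis .
qed

text \<open>Diagonal pairs contribute 1 each. Pairs with x < y give the complex conjugate of those
  with x > y because \<delta> is antisymmetric, and the latter are sorted by the quotient h = (x -
  y)/Q.\<close>

lemma norm_congruent_pairs_sum_le:
  fixes X :: "int set" and \<delta> :: "int \<Rightarrow> int \<Rightarrow> nat \<Rightarrow> int"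
  assumes "finite X" "Q > 0"
    and "\<And>x j. \<delta> x x j = 0" and anti: "\<And>x y j. \<delta> y x j = - \<delta> x y j"
    and H: "\<And>x y. x \<in> X \<Longrightarrow> y \<in> X \<Longrightarrow> y < x \<Longrightarrow> (x - y) div Q \<le> int H"
  shows "cmod (expsum k M {(x, y) \<in> X \<times> X. Q dvd x - y} (\<lambda>(x, y). \<delta> x y) a)
       \<le> real (card X) + 2 * (\<Sum>h\<in>{1..H}. cmod (expsum k M {x \<in> X. x + int h * Q \<in> X} (\<lambda>x. \<delta> (x + int h * Q) x) a))"
proof -
  let ?c = "\<lambda>p. chi k M a (case p of (x, y) \<Rightarrow> \<delta> x y)"
  let ?D = "{(x, y) \<in> X \<times> X. x = y}" and ?L = "{(x, y) \<in> X \<times> X. Q dvd x - y \<and> y < x}"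
    and ?U = "{(x, y) \<in> X \<times> X. Q dvd x - y \<and> x < y}"
  have fin: "finite ?D" "finite ?L" "finite ?U"
    by (rule finite_subset[of _ "X \<times> X"]; use assms(1) in force)+
  have split: "{(x, y) \<in> X \<times> X. Q dvd x - y} = ?D \<union> (?L \<union> ?U)" by auto
  have total: "expsum k M {(x, y) \<in> X \<times> X. Q dvd x - y} (\<lambda>(x, y). \<delta> x y) a = sum ?c ?D + (sum ?c ?L + sum ?c ?U)"
    unfolding expsum_def split using fin by (subst sum.union_disjoint, auto)+
  have diag: "cmod (sum ?c ?D) \<le> real (card X)"
  proof -
    have "?D = (\<lambda>x. (x, x)) ` X" by auto
    hence "card ?D = card X" by (simp add: card_image inj_on_def)
    moreover have "cmod (sum ?c ?D) \<le> (\<Sum>p\<in>?D. cmod (?c p))" by (rule norm_sum)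
    ultimately show ?thesis by simp
  qed
  have L: "sum ?c ?L = (\<Sum>h\<in>{1..H}. expsum k M {x \<in> X. x + int h * Q \<in> X} (\<lambda>x. \<delta> (x + int h * Q) x) a)"
  proof -
    have "sum ?c ?L = (\<Sum>(h, x)\<in>(SIGMA h:{1..H}. {x \<in> X. x + int h * Q \<in> X}). chi k M a (\<delta> (x + int h * Q) x))"
    proof (rule sum.reindex_bij_witness[of _ "\<lambda>(h, x). (x + int h * Q, x)" "\<lambda>(x, y). (nat ((x - y) div Q), y)"], goal_cases)
      case (1 p)
      then obtain x y where p: "p = (x, y)" "x \<in> X" "y \<in> X" "Q dvd x - y" "y < x" by auto
      then obtain q where q: "x - y = Q * q" by (elim dvdE)
      hence "q > 0" using p(5) assms(2) by (metis diff_gt_0_iff_gt zero_less_mult_pos)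
      thus ?case using p q assms(2) by (auto simp: algebra_simps)
    next
      case (2 p)
      then obtain x y where p: "p = (x, y)" "x \<in> X" "y \<in> X" "Q dvd x - y" "y < x" by auto
      then obtain q where q: "x - y = Q * q" by (elim dvdE)
      hence q0: "q > 0" using p(5) assms(2) by (metis diff_gt_0_iff_gt zero_less_mult_pos)
      have "(x - y) div Q \<le> int H" using H p by auto
      moreover have "(x - y) div Q = q" using q assms(2) by simp
      moreover have "y + q * Q = x" using q by (simp add: algebra_simps)
      ultimately show ?case using p q0 by auto
    next
      case (3 s)
      thus ?case using assms(2) by auto
    next
      case (4 s)
      thus ?case using assms(2) by auto
    next
      case (5 p)
      then obtain x y where p: "p = (x, y)" "x \<in> X" "y \<in> X" "Q dvd x - y" "y < x" by auto
      then obtain q where q: "x - y = Q * q" by (elim dvdE)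
      hence q0: "q > 0" using p(5) assms(2) by (metis diff_gt_0_iff_gt zero_less_mult_pos)
      have "(x - y) div Q = q" using q assms(2) by simp
      moreover have "y + q * Q = x" using q by (simp add: algebra_simps)
      ultimately show ?case using p q0 by auto
    qed
    also have "\<dots> = (\<Sum>h\<in>{1..H}. \<Sum>x\<in>{x \<in> X. x + int h * Q \<in> X}. chi k M a (\<delta> (x + int h * Q) x))"
      using assms(1) by (subst sum.Sigma) auto
    finally show ?thesis by (simp add: expsum_def)
  qed
  have U: "sum ?c ?U = cnj (sum ?c ?L)"
  proof -
    have "sum ?c ?U = (\<Sum>p\<in>?L. cnj (?c p))"
    proof (rule sum.reindex_bij_witness[of _ prod.swap prod.swap], goal_cases)
      case (5 p)
      then obtain x y where p: "p = (x, y)" by auto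
      have "\<delta> x y = (\<lambda>j. - \<delta> y x j)" by (intro ext) (simp add: anti[of x y])
      thus ?case using chi_uminus[of k M a "\<delta> y x"] by (simp add: p)
    qed (auto simp: dvd_diff_commute)
    thus ?thesis by (simp only: cnj_sum)
  qed
  have "cmod (sum ?c ?U) = cmod (sum ?c ?L)"
    unfolding U by (rule complex_mod_cnj)
  hence "cmod (expsum k M {(x, y) \<in> X \<times> X. Q dvd x - y} (\<lambda>(x, y). \<delta> x y) a)
      \<le> real (card X) + 2 * cmod (sum ?c ?L)"
    unfolding total using diag norm_triangle_ineq[of "sum ?c ?D" "sum ?c ?L + sum ?c ?U"]
      norm_triangle_ineq[of "sum ?c ?L" "sum ?c ?U"]
    by linarith
  also have "cmod (sum ?c ?L) \<le> (\<Sum>h\<in>{1..H}. cmod (expsum k M {x \<in> X. x + int h * Q \<in> X} (\<lambda>x. \<delta> (x + int h * Q) x) a))"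
    unfolding L by (rule norm_sum)
  finally show ?thesis by simp
qed

text \<open>The first term on the right stems from x = y, the second from a power mean over h. The
  number r' of new variables on each side is free subject to r \<le> 2r', which allows the next
  stage to run with one variable fewer.\<close>

lemma energy_differencing:
  fixes X :: "int set" and \<delta> :: "int \<Rightarrow> int \<Rightarrow> nat \<Rightarrow> int" and N :: real
  assumes "finite X" "finite B" "Q > 0" "real (card X) \<le> N" "N > 0"
    and d0: "\<And>x j. \<delta> x x j = 0" and anti: "\<And>x y j. \<delta> y x j = - \<delta> x y j"
    and H: "\<And>x y. x \<in> X \<Longrightarrow> y \<in> X \<Longrightarrow> y < x \<Longrightarrow> (x - y) div Q \<le> int H"
    and r: "r' > 0" "r \<le> 2 * r'"
  shows "real (card {((x, z), (y, w)) \<in> (tuples r X \<times> B) \<times> (tuples r X \<times> B).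
           (\<forall>i<r. Q dvd x i - y i) \<and> (\<forall>j\<in>{1..k}. (\<Sum>i<r. \<delta> (x i) (y i) j) + U z j - U w j = 0)})
    \<le> 3 ^ r * (2 * N ^ r * real (energy k B U)
        + N ^ r / N ^ (2 * r') * (real H ^ (2 * r' - 1) *
           (\<Sum>h\<in>{1..H}. real (energy k (tuples r' {x \<in> X. x + int h * Q \<in> X} \<times> B)
               (\<lambda>(x, z) j. (\<Sum>i<r'. \<delta> (x i + int h * Q) (x i) j) + U z j)))))"
proof -
  let ?P = "{(x, y) \<in> X \<times> X. Q dvd x - y}"
  let ?S = "{((x, z), (y, w)) \<in> (tuples r X \<times> B) \<times> (tuples r X \<times> B).
           (\<forall>i<r. Q dvd x i - y i) \<and> (\<forall>j\<in>{1..k}. (\<Sum>i<r. \<delta> (x i) (y i) j) + U z j - U w j = 0)}"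
  let ?A = "tuples r ?P \<times> (B \<times> B)"
  let ?V = "\<lambda>(p, q) j. (\<lambda>p j. \<Sum>i<r. (\<lambda>(x, y). \<delta> x y) (p i) j) p j + (\<lambda>(z, w) j. U z j - U w j) q j"
  let ?T = "{s \<in> ?A. \<forall>j\<in>{1..k}. ?V s j = 0}"
  have finP: "finite ?P" by (rule finite_subset[of _ "X \<times> X"]) (use assms(1) in auto)
  have finA: "finite ?A" using finP assms(2) by (auto intro!: finite_tuples)
  \<comment> \<open>Each pair (x_i, y_i) becomes a single variable, so that the exponential sum is
    the r-th power of one sum over congruent pairs.\<close>
  have "card ?S \<le> card ?T"
  proof (rule card_inj_on_le)
    let ?f = "\<lambda>((x, z), (y, w)). (\<lambda>i\<in>{..<r}. (x i, y i), (z, w))"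
    show "inj_on ?f ?S"
    proof (rule inj_onI)
      fix s s' assume *: "s \<in> ?S" "s' \<in> ?S" "?f s = ?f s'"
      obtain x z y w x' z' y' w' where s: "s = ((x, z), (y, w))" "s' = ((x', z'), (y', w'))"
        by (metis surj_pair)
      have "(\<lambda>i\<in>{..<r}. (x i, y i)) = (\<lambda>i\<in>{..<r}. (x' i, y' i))" and zw: "z = z'" "w = w'"
        using *(3) by (simp_all add: s)
      hence "x i = x' i \<and> y i = y' i" if "i < r" for i
        using that by (metis (no_types, lifting) lessThan_iff prod.inject restrict_apply')
      hence "x = x'" "y = y'" using *(1,2) by (auto simp: s intro!: PiE_ext[of _ "{..<r}" "\<lambda>_. X"])
      thus "s = s'" by (simp add: s zw)
    qed
    show "?f ` ?S \<subseteq> ?T" by (auto simp: PiE_iff split: if_splits)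
    show "finite ?T" using finA by auto
  qed
  let ?G = "\<lambda>h. {x \<in> X. x + int h * Q \<in> X}" and ?v = "\<lambda>h x. \<delta> (x + int h * Q) x"
  have "\<forall>\<^sub>F M in sequentially. \<forall>h\<in>{1..H}. fmean k M (\<lambda>a. cmod (expsum k M (?G h) (?v h) a) ^ (2 * r') * cmod (expsum k M B U a) ^ 2)
     = real (energy k (tuples r' (?G h) \<times> B) (\<lambda>(x, z) j. (\<Sum>i<r'. ?v h (x i) j) + U z j))"
    using assms(1,2) by (intro eventually_ball_finite ballI fmean_energy_times_tuples) auto
  from eventually_conj[OF eventually_conj[OF this fmean_energy[OF assms(2), of k U]] fmean_expsum[OF finA, of k ?V]]
  obtain M where M: "\<And>h. h \<in> {1..H} \<Longrightarrow> fmean k M (\<lambda>a. cmod (expsum k M (?G h) (?v h) a) ^ (2 * r') * cmod (expsum k M B U a) ^ 2)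
     = real (energy k (tuples r' (?G h) \<times> B) (\<lambda>(x, z) j. (\<Sum>i<r'. ?v h (x i) j) + U z j))"
     "fmean k M (\<lambda>a. cmod (expsum k M B U a) ^ 2) = real (energy k B U)"
     "fmean k M (expsum k M ?A ?V) = of_nat (card ?T)"
    using eventually_happens'[OF sequentially_bot] by blast
  define S where "S = (\<lambda>a. \<Sum>h\<in>{1..H}. cmod (expsum k M (?G h) (?v h) a))"
  have "real (card ?S) \<le> real (card ?T)" using \<open>card ?S \<le> card ?T\<close> by simp
  also have "\<dots> = cmod (of_nat (card ?T))" by simp
  also have "\<dots> \<le> fmean k M (\<lambda>a. cmod (expsum k M ?A ?V a))"
    unfolding M(3)[symmetric] by (rule norm_fmean_le)
  also have "\<dots> \<le> fmean k M (\<lambda>a. (3 ^ r * (2 * N ^ r)) * cmod (expsum k M B U a) ^ 2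
      + (3 ^ r * (N ^ r / N ^ (2 * r') * real H ^ (2 * r' - 1)))
         * (\<Sum>h\<in>{1..H}. cmod (expsum k M (?G h) (?v h) a) ^ (2 * r') * cmod (expsum k M B U a) ^ 2))"
  proof (rule fmean_mono)
    fix a
    let ?b = "cmod (expsum k M B U a) ^ 2"
    have "expsum k M ?A ?V a = expsum k M ?P (\<lambda>(x, y). \<delta> x y) a ^ r * (expsum k M B U a * cnj (expsum k M B U a))"
      unfolding expsum_times expsum_times_cnj
      using expsum_PiE[of "{..<r}" "\<lambda>_. ?P" k M "\<lambda>_ (x, y). \<delta> x y" a] finP by simp
    hence "cmod (expsum k M ?A ?V a) = cmod (expsum k M ?P (\<lambda>(x, y). \<delta> x y) a) ^ r * ?b"
      by (simp add: norm_mult norm_power power2_eq_square)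
    also have "\<dots> \<le> (N + 2 * S a) ^ r * ?b"
    proof (intro mult_right_mono power_mono)
      show "cmod (expsum k M ?P (\<lambda>(x, y). \<delta> x y) a) \<le> N + 2 * S a"
        unfolding S_def using norm_congruent_pairs_sum_le[of X Q \<delta> H k M a] assms(1,3,4) d0 anti H
        by (smt (verit, ccfv_threshold))
    qed auto
    also have "\<dots> \<le> (3 ^ r * (2 * N ^ r + N ^ r / N ^ (2 * r') * S a ^ (2 * r'))) * ?b"
      using assms(5) r by (intro mult_right_mono differencing_young) (auto simp: S_def intro!: sum_nonneg)
    also have "\<dots> \<le> (3 ^ r * (2 * N ^ r + N ^ r / N ^ (2 * r') * (real H ^ (2 * r' - 1) *
         (\<Sum>h\<in>{1..H}. cmod (expsum k M (?G h) (?v h) a) ^ (2 * r'))))) * ?b"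
      using power_mean_nat[of "2 * r'" "{1..H}" "\<lambda>h. cmod (expsum k M (?G h) (?v h) a)"] r assms(5)
      by (intro mult_right_mono mult_left_mono add_left_mono) (auto simp: S_def)
    also have "\<dots> = (3 ^ r * (2 * N ^ r)) * ?b
      + (3 ^ r * (N ^ r / N ^ (2 * r') * real H ^ (2 * r' - 1)))
         * (\<Sum>h\<in>{1..H}. cmod (expsum k M (?G h) (?v h) a) ^ (2 * r') * ?b)"
      by (simp add: algebra_simps sum_distrib_left)
    finally show "cmod (expsum k M ?A ?V a) \<le> \<dots>" .
  qed
  also have "\<dots> = (3 ^ r * (2 * N ^ r)) * real (energy k B U)
      + (3 ^ r * (N ^ r / N ^ (2 * r') * real H ^ (2 * r' - 1)))
         * (\<Sum>h\<in>{1..H}. real (energy k (tuples r' (?G h) \<times> B) (\<lambda>(x, z) j. (\<Sum>i<r'. ?v h (x i) j) + U z j)))"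
    by (simp only: fmean_add fmean_cmult fmean_sum M cong: sum.cong)
  finally show ?thesis by (simp add: algebra_simps)
qed

section \<open>Primes up to a constant factor\<close>

lemma prod_primes_dvd:
  fixes n :: nat
  assumes "finite S" "\<And>p. p \<in> S \<Longrightarrow> prime p" "\<And>p. p \<in> S \<Longrightarrow> p dvd n"
  shows "\<Prod>S dvd n"
  using assms
proof (induction S rule: finite_induct)
  case (insert p S)
  have "coprime p (\<Prod>S)"
    using insert by (intro prod_coprime_right primes_coprime) auto
  thus ?case using insert by (auto intro!: divides_mult)
qed simp

section \<open>The upper bound for primorials\<close>

definition primorial :: "nat \<Rightarrow> nat" where
  "primorial n = \<Prod>{p. prime p \<and> p \<le> n}"

lemma finite_primes_le: "finite {p::nat. prime p \<and> p \<le> n}"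
  by (rule finite_subset[of _ "{..n}"]) auto

text \<open>A prime in (m, n] divides n! but neither m! nor (n - m)!, because n - m \<le> m; so it
  divides the binomial coefficient.\<close>

lemma primorial_le_mult_central:
  assumes "m < n" "n \<le> 2 * m"
  shows "primorial n \<le> primorial m * (n choose m)"
proof -
  let ?S = "{p. prime p \<and> m < p \<and> p \<le> n}"
  have fin: "finite ?S" by (rule finite_subset[of _ "{..n}"]) auto
  have "\<Prod>?S dvd (n choose m)"
  proof (rule prod_primes_dvd[OF fin])
    fix p assume "p \<in> ?S"
    hence p: "prime p" "m < p" "p \<le> n" by auto
    have "p dvd fact n" using p by (simp add: prime_dvd_fact_iff)
    also have "fact n = fact m * fact (n - m) * (n choose m)"
      using assms by (simp add: binomial_fact_lemma)
    finally show "p dvd (n choose m)"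
      using p assms by (auto simp: prime_dvd_mult_iff prime_dvd_fact_iff)
  qed auto
  hence "\<Prod>?S \<le> n choose m" using assms by (intro dvd_imp_le) auto
  moreover have "{p. prime p \<and> p \<le> n} = {p. prime p \<and> p \<le> m} \<union> ?S" using assms by auto
  hence "primorial n = primorial m * \<Prod>?S"
    unfolding primorial_def using fin finite_primes_le by (subst prod.union_disjoint[symmetric]) auto
  ultimately show ?thesis by simp
qed

text \<open>An odd n = 2m + 1 is split at m + 1: the two equal middle binomial coefficients share
  the row sum 2^n, so each is at most 4^m. An even n > 2 is not prime and adds nothing.\<close>

lemma primorial_le: "primorial n \<le> 4 ^ n"
proof (induction n rule: less_induct)
  case (less n)
  consider "n \<le> 2" | m where "n = 2 * m" "m \<ge> 2" | m where "n = 2 * m + 1" "m \<ge> 1"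
  proof (cases "even n")
    case True
    then obtain m where "n = 2 * m" by (elim evenE)
    thus ?thesis using that(1) that(2)[of m] by linarith
  next
    case False
    then obtain m where "n = 2 * m + 1" by (elim oddE)
    thus ?thesis using that(1) that(3)[of m] by linarith
  qed
  thus ?case
  proof cases
    case 1
    have "{p::nat. prime p \<and> p \<le> n} \<subseteq> {2}"
    proof
      fix p assume "p \<in> {p::nat. prime p \<and> p \<le> n}"
      thus "p \<in> {2}" using 1 prime_ge_2_nat[of p] by simp
    qed
    hence "{p::nat. prime p \<and> p \<le> n} = (if n = 2 then {2} else {})" using 1 by auto
    thus ?thesis by (simp add: primorial_def)
  next
    case (2 m)
    have "\<not> prime n"
    proof
      assume "prime n"
      moreover have "2 dvd n" using 2 by simp
      ultimately have "2 = n" unfolding prime_nat_iff by force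
      thus False using 2 by simp
    qed
    hence "p \<le> n \<longleftrightarrow> p \<le> n - 1" if "prime p" for p
      using that by (cases "p = n") auto
    hence "{p::nat. prime p \<and> p \<le> n} = {p. prime p \<and> p \<le> n - 1}" by auto
    hence "primorial n = primorial (n - 1)" by (simp add: primorial_def)
    also have "\<dots> \<le> 4 ^ (n - 1)" using 2 by (intro less) auto
    also have "\<dots> \<le> 4 ^ n" by (intro power_increasing) auto
    finally show ?thesis .
  next
    case (3 m)
    have "2 * (n choose m) = (n choose m) + (n choose Suc m)"
      using 3 binomial_symmetric[of m n] by simp
    also have "\<dots> = (\<Sum>i\<in>{m, Suc m}. n choose i)" by simp
    also have "\<dots> \<le> (\<Sum>i\<le>n. n choose i)" using 3 by (intro sum_mono2) auto
    also have "\<dots> = 2 ^ n" by (rule choose_row_sum)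
    also have "\<dots> = 2 * 4 ^ m" using 3 by (simp add: power_mult)
    finally have b: "n choose m \<le> 4 ^ m" by simp
    have "n choose Suc m \<le> 4 ^ m" using b 3 binomial_symmetric[of m n] by simp
    have "primorial n \<le> primorial (Suc m) * (n choose Suc m)"
      using 3 by (intro primorial_le_mult_central) auto
    also have "\<dots> \<le> 4 ^ Suc m * 4 ^ m"
      using 3 \<open>n choose Suc m \<le> 4 ^ m\<close> by (intro mult_mono less) auto
    also have "\<dots> = 4 ^ n" using 3 by (simp add: power_add[symmetric])
    finally show ?thesis .
  qed
qed

section \<open>The lower bound for least common multiples, and primes in an interval\<close>

lemma binomial_dvd_Lcm:
  fixes n j :: nat
  shows "j < n \<Longrightarrow> n * ((n - 1) choose j) dvd Lcm {1..n}"
proof (induction j arbitrary: n)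
  case 0
  thus ?case by (auto intro: dvd_Lcm)
next
  case (Suc j)
  define L where "L = Lcm {1..n}"
  have n: "n \<ge> 2" using Suc.prems by auto
  obtain n' where n': "n = Suc (Suc n')" using n by (metis Suc_le_D numeral_2_eq_2 Suc_le_mono)
  have j: "j \<le> n'" using Suc.prems n' by simp
  let ?a = "n * (Suc n' choose j)" and ?b = "Suc n' * (n' choose j)" and ?c = "n * (Suc n' choose Suc j)"
  have "?a dvd L" using Suc.IH[of n] Suc.prems by (simp add: L_def n')
  moreover have "?b dvd L"
  proof -
    have "?b dvd Lcm {1..Suc n'}" using Suc.IH[of "Suc n'"] j by simp
    also have "\<dots> dvd L" unfolding L_def n' by (intro Lcm_subset) auto
    finally show ?thesis .
  qed
  ultimately obtain x y where xy: "L = ?a * x" "L = ?b * y" by (elim dvdE)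
  \<comment> \<open>the Leibniz harmonic triangle: \<open>1 / ?c = 1 / ?b - 1 / ?a\<close>\<close>
  have pos: "?a > 0" "?b > 0" "?c > 0" using j Suc.prems by (auto simp: n')
  have e1: "real (Suc j) * real (Suc n' choose Suc j) = real (Suc n') * real (n' choose j)"
    by (simp only: of_nat_mult[symmetric] Suc_times_binomial)
  have e2: "real (Suc n' - j) * real (Suc n' choose j) = real (Suc n') * real (n' choose j)"
  proof -
    have "(Suc n' - j) * (Suc n' choose j) = Suc n' * (n' choose j)"
      using binomial_absorb_comp[of "Suc n'" j] by simp
    thus ?thesis by (simp only: of_nat_mult[symmetric])
  qed
  have "1 / real ?b - 1 / real ?a = 1 / real ?c"
  proof -
    define B where "B = real (Suc n') * real (n' choose j)"
    have B: "B > 0" using j by (simp add: B_def)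
    have c: "real (Suc n' choose Suc j) = B / real (Suc j)" 
      using e1 by (simp add: B_def field_simps)
    have a: "real (Suc n' choose j) = B / real (Suc n' - j)"
      using e2 j by (simp add: B_def field_simps)
    have b: "real (Suc n') * real (n' choose j) = B" by (simp add: B_def)
    have "1 / B - 1 / (real n * (B / real (Suc n' - j))) = 1 / (real n * (B / real (Suc j)))"
    proof -
      have "real (Suc n' - j) + real (Suc j) = real n" using j by (simp add: n')
      moreover have "1 / B = real n / (real n * B)" using n by simp
      moreover have "real n - real (Suc n' - j) = real (Suc j)" using j by (simp add: n')
      ultimately have "1 / B - real (Suc n' - j) / (real n * B) = real (Suc j) / (real n * B)"
        by (simp only: diff_divide_distrib[symmetric])
      thus ?thesis by (simp del: of_nat_Suc of_nat_diff)
    qed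
    thus ?thesis by (simp only: of_nat_mult a b c)
  qed
  hence "real L / real ?c = real L / real ?b - real L / real ?a"
    by (simp add: divide_inverse right_diff_distrib[symmetric])
  also have "real L / real ?b = real y" 
    unfolding xy(2) of_nat_mult[of ?b y] using pos(2) by (intro nonzero_mult_div_cancel_left) linarith
  also have "real L / real ?a = real x" 
    unfolding xy(1) of_nat_mult[of ?a x] using pos(1) by (intro nonzero_mult_div_cancel_left) linarith
  finally have "real L / real ?c = real y - real x" .
  moreover have "real ?c \<noteq> 0" using pos(3) by linarith
  ultimately have "real L = (real y - real x) * real ?c"
    using nonzero_divide_eq_eq[of "real ?c" "real L"] by blast
  hence "real_of_int (int L) = real_of_int (int ?c * (int y - int x))" by (simp only: of_int_mult of_int_diff of_int_of_nat_eq mult.commute)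
  hence "int L = int ?c * (int y - int x)" by (simp only: of_int_eq_iff)
  hence "int ?c dvd int L" by simp
  thus ?case by (simp only: L_def n' int_dvd_int_iff diff_Suc_1)
qed

lemma prime_power_dvd_Lcm_atLeastAtMost:
  fixes p :: nat
  assumes "prime p" "p ^ a dvd Lcm {1..n}" "n > 0"
  shows "p ^ a \<le> n"
  using assms(2,3)
proof (induction n)
  case (Suc n)
  have "Lcm {1..Suc n} = lcm (Suc n) (Lcm {1..n})"
    by (simp add: atLeastAtMostSuc_conv)
  hence "a \<le> multiplicity p (lcm (Suc n) (Lcm {1..n}))"
    using Suc.prems assms(1) by (intro multiplicity_geI) (auto simp: Lcm_0_iff)
  also have "\<dots> = max (multiplicity p (Suc n)) (multiplicity p (Lcm {1..n}))"
    using assms(1) by (intro multiplicity_lcm) (auto simp: Lcm_0_iff)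
  finally have "p ^ a dvd Suc n \<or> p ^ a dvd Lcm {1..n}"
    by (auto simp: le_max_iff_disj multiplicity_dvd')
  thus ?case
  proof
    assume "p ^ a dvd Suc n"
    thus ?thesis by (rule dvd_imp_le) simp
  next
    assume "p ^ a dvd Lcm {1..n}"
    thus ?thesis using Suc.IH by (cases "n = 0") auto
  qed
qed simp

text \<open>A prime p > s has p^2 > n and divides the least common multiple at most once, which is
  accounted for by \<open>primorial n\<close>. Each of the at most s smaller primes occurs in a
  power not exceeding n.\<close>

lemma Lcm_atLeastAtMost_le:
  fixes n :: nat
  assumes "n > 0" "n \<le> s ^ 2"
  shows "Lcm {1..n} \<le> n ^ s * primorial n"
proof -
  let ?L = "Lcm {1..n}" and ?P = "{p::nat. prime p \<and> p \<le> n}"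
  have L0: "?L \<noteq> 0" by (simp add: Lcm_0_iff)
  have pf: "prime_factors ?L \<subseteq> ?P"
  proof
    fix p assume "p \<in> prime_factors ?L"
    hence "prime p" "p ^ 1 dvd ?L" by auto
    thus "p \<in> ?P" using prime_power_dvd_Lcm_atLeastAtMost[of p 1 n] assms by auto
  qed
  have "?L = (\<Prod>p\<in>prime_factors ?L. p ^ multiplicity p ?L)"
    using prod_prime_factors[OF L0] by simp
  also have "\<dots> \<le> (\<Prod>p\<in>prime_factors ?L. (if p \<le> s then n else 1) * p)"
  proof (rule prod_mono, intro conjI)
    fix p assume p: "p \<in> prime_factors ?L"
    hence pp: "prime p" by auto
    have le: "p ^ multiplicity p ?L \<le> n"
      using pp assms by (intro prime_power_dvd_Lcm_atLeastAtMost[of p]) (auto simp: multiplicity_dvd)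
    show "p ^ multiplicity p ?L \<le> (if p \<le> s then n else 1) * p"
    proof (cases "p \<le> s")
      case True
      have "n \<le> n * p" using prime_gt_0_nat[OF pp] by simp
      thus ?thesis using le_trans[OF le] True by simp
    next
      case False
      have "multiplicity p ?L < 2"
      proof (rule ccontr)
        assume "\<not> multiplicity p ?L < 2"
        hence "p ^ 2 \<le> p ^ multiplicity p ?L" using prime_gt_0_nat[OF pp] by (intro power_increasing) auto
        also have "\<dots> \<le> s ^ 2" using le assms by simp
        finally show False using False by simp
      qed
      hence "p ^ multiplicity p ?L \<le> p ^ 1" using prime_gt_0_nat[OF pp] by (intro power_increasing) auto
      thus ?thesis using False by simp
    qed
  qed auto
  also have "\<dots> = (\<Prod>p\<in>prime_factors ?L. if p \<le> s then n else 1) * \<Prod>(prime_factors ?L)"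
    by (simp add: prod.distrib)
  also have "(\<Prod>p\<in>prime_factors ?L. if p \<le> s then n else 1) = n ^ card {p \<in> prime_factors ?L. p \<le> s}"
    by (simp add: prod.If_cases Int_def)
  also have "\<dots> \<le> n ^ s"
  proof (intro power_increasing)
    have "card {p \<in> prime_factors ?L. p \<le> s} \<le> card {1..s}"
      by (intro card_mono) (auto intro!: prime_gt_0_nat dest: in_prime_factors_imp_prime simp: Suc_le_eq)
    thus "card {p \<in> prime_factors ?L. p \<le> s} \<le> s" by simp
  qed (use assms in auto)
  also have "\<Prod>(prime_factors ?L) \<le> primorial n"
    unfolding primorial_def by (rule dvd_imp_le[OF prod_dvd_prod_subset[OF finite_primes_le pf]])
      (auto intro!: prod_pos dest: prime_gt_0_nat)
  finally show ?thesis by simp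
qed

lemma four_power_le_Lcm:
  assumes "m > 0"
  shows "4 ^ m \<le> 2 * real (Lcm {1..2 * m})"
proof -
  have "(2 * m) * ((2 * m - 1) choose (m - 1)) dvd Lcm {1..2 * m}"
    using assms by (intro binomial_dvd_Lcm) auto
  moreover have "(2 * m) * ((2 * m - 1) choose (m - 1)) = m * ((2 * m) choose m)"
    using assms times_binomial_minus1_eq[of m "2 * m"] by (simp only: mult.commute)
  moreover have "Lcm {1..2 * m} \<noteq> 0" by (simp add: Lcm_0_iff)
  ultimately have "m * ((2 * m) choose m) \<le> Lcm {1..2 * m}"
    by (metis dvd_imp_le neq0_conv)
  hence "real m * real ((2 * m) choose m) \<le> real (Lcm {1..2 * m})"
    by (simp only: of_nat_mult[symmetric] of_nat_le_iff)
  moreover have "4 ^ m / (2 * real m) \<le> real ((2 * m) choose m)"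
    using assms by (rule central_binomial_lower_bound)
  hence "4 ^ m \<le> 2 * (real m * real ((2 * m) choose m))" using assms by (simp add: field_simps)
  ultimately show ?thesis by linarith
qed

text \<open>\<open>Lcm {1..4 * n}\<close> is at least half of 4^(2n). Primes up to n account for at
  most 4^n of this and repeated prime factors for at most (4n)^(2 sqrt n + 1), so nearly 4^n must
  come from primes above n. With 2n as the upper end, the two bounds 4^n would cancel.\<close>

lemma eventually_many_primes:
  "\<forall>\<^sub>F n in sequentially. N \<le> card {p::nat. prime p \<and> n < p \<and> p \<le> 4 * n}"
proof -
  have "\<forall>\<^sub>F n in sequentially. 2 * (4 * real n) powr (2 * sqrt n + 2 + real N) < 4 ^ n"
    by real_asymp
  thus ?thesis using eventually_gt_at_top[of 0]
  proof eventually_elim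
    case (elim n)
    let ?S = "{p. prime p \<and> n < p \<and> p \<le> 4 * n}"
    have finS: "finite ?S" by (rule finite_subset[of _ "{..4 * n}"]) auto
    show ?case
    proof (rule ccontr)
      assume "\<not> N \<le> card ?S"
      define s where "s = nat \<lceil>sqrt (4 * n)\<rceil>"
      have s1: "4 * n \<le> s ^ 2"
      proof -
        have "sqrt (4 * n) \<le> real s" unfolding s_def by linarith
        hence "sqrt (4 * n) ^ 2 \<le> real s ^ 2" by (intro power_mono) auto
        hence "real (4 * n) \<le> real (s ^ 2)" by simp
        thus ?thesis by (simp only: of_nat_le_iff)
      qed
      have s2: "real s \<le> 2 * sqrt n + 1"
        unfolding s_def by (simp add: real_sqrt_mult)
      have "\<Prod>?S \<le> (\<Prod>p\<in>?S. 4 * n)" by (intro prod_mono) auto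
      also have "\<dots> = (4 * n) ^ card ?S" by (rule prod_constant)
      also have "\<dots> \<le> (4 * n) ^ N" using \<open>\<not> N \<le> card ?S\<close> elim by (intro power_increasing) auto
      finally have S: "\<Prod>?S \<le> (4 * n) ^ N" .
      have "{p. prime p \<and> p \<le> 4 * n} = {p. prime p \<and> p \<le> n} \<union> ?S" by auto
      hence "primorial (4 * n) = primorial n * \<Prod>?S"
        unfolding primorial_def using finS finite_primes_le by (subst prod.union_disjoint[symmetric]) auto
      also have "\<dots> \<le> 4 ^ n * (4 * n) ^ N" by (intro mult_mono S primorial_le) auto
      finally have "Lcm {1..4 * n} \<le> (4 * n) ^ s * (4 ^ n * (4 * n) ^ N)"
        using Lcm_atLeastAtMost_le[of "4 * n" s] s1 elim by (meson le_trans mult_le_mono2 mult_pos_pos zero_less_numeral)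
      hence "real (Lcm {1..4 * n}) \<le> real ((4 * n) ^ s * (4 ^ n * (4 * n) ^ N))"
        by (simp only: of_nat_le_iff)
      hence "4 ^ (2 * n) \<le> 2 * ((4 * real n) ^ s * (4 ^ n * (4 * real n) ^ N))"
        using four_power_le_Lcm[of "2 * n"] elim by simp
      also have "\<dots> = (2 * (4 * real n) ^ (s + N)) * 4 ^ n" by (simp only: power_add mult_ac)
      finally have "(4::real) ^ n * 4 ^ n \<le> (2 * (4 * real n) ^ (s + N)) * 4 ^ n"
        by (simp only: power_add mult_2)
      hence "(4::real) ^ n \<le> 2 * (4 * real n) ^ (s + N)" by (rule mult_right_le_imp_le) simp
      also have "(4 * real n) ^ (s + N) = (4 * real n) powr (real s + real N)"
        using elim powr_realpow[of "4 * real n" "s + N"] by simp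
      also have "\<dots> \<le> (4 * real n) powr (2 * sqrt n + 2 + real N)"
        using elim s2 by (intro powr_mono) auto
      finally show False using elim by simp
    qed
  qed
qed

text \<open>No power of \<open>log y\<close> is lost here, which is what keeps the final bounds free of \<open>P\<^sup>\<epsilon>\<close>.\<close>

lemma many_primes_in_dyadic_range:
  fixes K :: real
  assumes "K \<ge> 1"
  shows "\<exists>C\<ge>1. \<forall>y\<ge>1. \<exists>S::nat set. finite S \<and> card S = N \<and> (\<forall>p\<in>S. prime p \<and> K * y < real p \<and> real p \<le> C * y)"
proof -
  obtain n0 where n0: "\<And>n. n \<ge> n0 \<Longrightarrow> N \<le> card {p::nat. prime p \<and> n < p \<and> p \<le> 4 * n}"
    using eventually_many_primes[of N] unfolding eventually_sequentially by blast
  \<comment> \<open>The shift by \<open>n0\<close> secures enough primes for small y as well; since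
    y \<ge> 1, the constant pays for it.\<close>
  define C where "C = 4 * (K + 1 + real n0)"
  show ?thesis
  proof (rule exI[of _ C], intro conjI allI impI)
    show "C \<ge> 1" using assms by (simp add: C_def)
  next
    fix y :: real assume y: "y \<ge> 1"
    define n where "n = nat \<lceil>K * y\<rceil> + n0"
    have "N \<le> card {p::nat. prime p \<and> n < p \<and> p \<le> 4 * n}" by (rule n0) (simp add: n_def)
    then obtain S where S: "S \<subseteq> {p. prime p \<and> n < p \<and> p \<le> 4 * n}" "card S = N" "finite S"
      by (rule obtain_subset_with_card_n)
    have n1: "K * y \<le> real n" unfolding n_def by linarith
    have "K * y \<ge> 0" using assms y by simp
    hence "real n \<le> K * y + 1 + real n0" unfolding n_def by linarith
    also have "\<dots> \<le> K * y + 1 * y + real n0 * y"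
      using y mult_left_mono[OF y, of "real n0"] by simp
    finally have n2: "real (4 * n) \<le> C * y" by (simp add: C_def algebra_simps)
    have "prime p \<and> K * y < real p \<and> real p \<le> C * y" if "p \<in> S" for p
    proof -
      have "prime p" "n < p" "p \<le> 4 * n" using S(1) that by auto
      moreover from this have "real n < real p" "real p \<le> real (4 * n)" by (simp_all only: of_nat_less_iff of_nat_le_iff)
      ultimately show ?thesis using n1 n2 by linarith
    qed
    thus "\<exists>S::nat set. finite S \<and> card S = N \<and> (\<forall>p\<in>S. prime p \<and> K * y < real p \<and> real p \<le> C * y)"
      using S by blast
  qed
qed

section \<open>Power sums and Hensel lifting\<close>

text \<open>The reversed polynomial with roots x_i; its coefficients are the elementary symmetric
  polynomials up to sign. Constant term 1 is what makes the logarithmic derivative a power series in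
  the power sums.\<close>

definition root_fps :: "nat \<Rightarrow> (nat \<Rightarrow> int) \<Rightarrow> int fps" where
  "root_fps n x = (\<Prod>i<n. 1 - fps_const (x i) * fps_X)"

lemma root_fps_0 [simp]: "root_fps 0 x = 1"
  by (simp add: root_fps_def)

lemma root_fps_Suc: "root_fps (Suc n) x = root_fps n x * (1 - fps_const (x n) * fps_X)"
  by (simp add: root_fps_def mult.commute)

lemma nth_root_fps_Suc:
  "root_fps (Suc n) x $ m = root_fps n x $ m - (if m = 0 then 0 else x n * root_fps n x $ (m - 1))"
proof -
  have "root_fps (Suc n) x = root_fps n x - fps_const (x n) * (fps_X * root_fps n x)"
    by (simp add: root_fps_Suc algebra_simps)
  thus ?thesis by simp
qed

lemma nth_root_fps_0 [simp]: "root_fps n x $ 0 = 1"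
  by (induction n) (simp_all add: nth_root_fps_Suc)

lemma nth_root_fps_eq_0: "m > n \<Longrightarrow> root_fps n x $ m = 0"
  by (induction n arbitrary: m) (auto simp: nth_root_fps_Suc)

lemma prod_diff_eq_root_fps: "(\<Prod>i<n. T - x i) = (\<Sum>m\<le>n. root_fps n x $ m * T ^ (n - m))"
proof (induction n)
  case (Suc n)
  let ?a = "\<lambda>m. root_fps n x $ m"
  have "(\<Sum>m\<le>Suc n. root_fps (Suc n) x $ m * T ^ (Suc n - m))
      = (\<Sum>m\<le>Suc n. ?a m * T ^ (Suc n - m)) - (\<Sum>m\<le>Suc n. (if m = 0 then 0 else x n * ?a (m - 1)) * T ^ (Suc n - m))"
    by (simp only: nth_root_fps_Suc left_diff_distrib sum_subtractf)
  also have "(\<Sum>m\<le>Suc n. ?a m * T ^ (Suc n - m)) = (\<Sum>m\<le>n. T * (?a m * T ^ (n - m)))"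
    by (simp add: nth_root_fps_eq_0 Suc_diff_le mult_ac cong: sum.cong_simp)
  also have "(\<Sum>m\<le>Suc n. (if m = 0 then 0 else x n * ?a (m - 1)) * T ^ (Suc n - m)) = (\<Sum>m\<le>n. x n * (?a m * T ^ (n - m)))"
    by (subst sum.atMost_Suc_shift) (simp add: mult_ac)
  also have "(\<Sum>m\<le>n. T * (?a m * T ^ (n - m))) - \<dots> = (T - x n) * (\<Prod>i<n. T - x i)"
    by (simp only: Suc.IH sum_distrib_left[symmetric] left_diff_distrib)
  finally show ?case by (simp add: mult.commute)
qed simp

text \<open>The logarithmic derivative of the product, cleared of denominators. A new factor
  contributes the geometric series \<open>G\<close>, which is x_n / (1 - x_n X).\<close>

lemma newton_fps: "fps_deriv (root_fps n x) = - (root_fps n x * Abs_fps (\<lambda>m. \<Sum>i<n. x i ^ Suc m))"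
proof (induction n)
  case 0
  have "Abs_fps (\<lambda>m. \<Sum>i<(0::nat). x i ^ Suc m) = 0" by (rule fps_ext) simp
  thus ?case by simp
next
  case (Suc n)
  define A where "A = root_fps n x"
  define c where "c = fps_const (x n)"
  define P where "P = Abs_fps (\<lambda>m. \<Sum>i<n. x i ^ Suc m)"
  define G where "G = Abs_fps (\<lambda>m. x n ^ Suc m)"
  have "G = c + c * (fps_X * G)"
    by (rule fps_ext) (simp add: G_def c_def gr0_conv_Suc split: if_splits, metis Suc_pred gr0_conv_Suc power_Suc)
  hence G: "(1 - c * fps_X) * G = c" by (simp add: algebra_simps)
  have P: "Abs_fps (\<lambda>m. \<Sum>i<Suc n. x i ^ Suc m) = P + G"
    by (rule fps_ext) (simp add: P_def G_def)
  have dc: "fps_deriv (1 - c * fps_X) = - c" by (simp add: c_def)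
  have "fps_deriv (root_fps (Suc n) x) = A * (- c) + - (A * P) * (1 - c * fps_X)"
    unfolding root_fps_Suc A_def[symmetric] c_def[symmetric] fps_deriv_mult dc
    by (simp only: Suc.IH A_def P_def)
  also have "\<dots> = - (A * ((1 - c * fps_X) * G)) - A * P * (1 - c * fps_X)"
    unfolding G by simp
  also have "\<dots> = - (A * (1 - c * fps_X) * (P + G))"
    by (simp add: algebra_simps)
  finally show ?case unfolding P root_fps_Suc A_def c_def .
qed

lemma newton_identity:
  "int (Suc m) * root_fps n x $ Suc m = - (\<Sum>j\<le>m. root_fps n x $ j * (\<Sum>i<n. x i ^ Suc (m - j)))"
proof -
  have "fps_deriv (root_fps n x) $ m = - (root_fps n x * Abs_fps (\<lambda>m. \<Sum>i<n. x i ^ Suc m)) $ m"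
    by (simp only: newton_fps)
  thus ?thesis by (simp add: fps_mult_nth atMost_atLeast0)
qed

text \<open>In Newton's identity the m-th coefficient carries the factor m, which is invertible
  modulo q because m \<le> n < q.\<close>

lemma power_sums_cong_root_fps:
  assumes "prime q" "n < q"
    and eq: "\<And>j. j \<in> {1..n} \<Longrightarrow> [(\<Sum>i<n. x i ^ j) = (\<Sum>i<n. y i ^ j)] (mod int q)"
    and "m \<le> n"
  shows "[root_fps n x $ m = root_fps n y $ m] (mod int q)"
  using assms(4)
proof (induction m rule: less_induct)
  case (less m)
  show ?case
  proof (cases m)
    case (Suc l)
    have "[int m * root_fps n x $ m = int m * root_fps n y $ m] (mod int q)"
      unfolding Suc newton_identity
      using less Suc by (intro cong_minus_minus_iff[THEN iffD2] cong_sum cong_mult eq) auto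
    moreover have "coprime (int m) (int q)"
    proof -
      have "\<not> q dvd m" using less.prems assms(2) Suc by (auto dest: dvd_imp_le)
      hence "coprime q m" using assms(1) by (simp add: prime_imp_coprime)
      thus ?thesis by (simp add: coprime_commute)
    qed
    ultimately show ?thesis by (simp add: cong_mult_lcancel)
  qed simp
qed

text \<open>The monic polynomials with roots x and with roots y agree modulo q; evaluated at x_i the
  former vanishes, so q divides the product of the x_i - y_l.\<close>

lemma power_sums_cong_imp:
  assumes "prime q" "n < q"
    and eq: "\<And>j. j \<in> {1..n} \<Longrightarrow> [(\<Sum>i<n. x i ^ j) = (\<Sum>i<n. y i ^ j)] (mod int q)"
    and "i < n"
  shows "\<exists>l<n. [x i = y l] (mod int q)"
proof -
  have "[(\<Prod>l<n. x i - y l) = (\<Prod>l<n. x i - x l)] (mod int q)"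
    unfolding prod_diff_eq_root_fps
    by (intro cong_sum cong_mult cong_refl cong_sym[OF power_sums_cong_root_fps[OF assms(1,2) eq]]) auto
  also have "(\<Prod>l<n. x i - x l) = 0" using assms(4) by auto
  finally have "int q dvd (\<Prod>l<n. x i - y l)" by (simp add: cong_0_iff)
  then obtain l where "l < n" "int q dvd x i - y l"
    using assms(1) by (auto simp: prime_dvd_prod_iff)
  thus ?thesis by (auto simp: cong_iff_dvd_diff)
qed

lemma card_fibres_le:
  assumes "finite S" "finite T" "f ` S \<subseteq> T" "\<And>t. t \<in> T \<Longrightarrow> card {x \<in> S. f x = t} \<le> c"
  shows "card S \<le> card T * c"
proof -
  have "card S = (\<Sum>t\<in>T. card {x \<in> S. f x = t})"
    using assms by (subst card_UN_disjoint[symmetric]) (auto intro!: arg_cong[of _ _ card])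
  also have "\<dots> \<le> (\<Sum>t\<in>T. c)" by (intro sum_mono assms)
  finally show ?thesis by simp
qed

lemma cong_residues_eq:
  fixes a b :: int
  assumes "[a = b] (mod int q)" "a \<in> {0..<int q}" "b \<in> {0..<int q}"
  shows "a = b"
  using assms by (auto simp: cong_def)

text \<open>The last n - m variables are free. Once they are fixed, the first m variables of any two
  solutions have congruent power sums, so all of them take values among the first m entries of one
  fixed solution.\<close>

lemma card_power_sums_le:
  assumes "prime q" "m < q" "m \<le> n"
  shows "card {x \<in> tuples n {0..<int q}. \<forall>j\<in>{1..m}. [(\<Sum>i<n. x i ^ j) = b j] (mod int q)} \<le> q ^ (n - m) * m ^ m"
    (is "card ?S \<le> _")
proof -
  let ?T = "{m..<n} \<rightarrow>\<^sub>E {0..<int q}"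
  have finS: "finite ?S" by (rule finite_subset[of _ "tuples n {0..<int q}"]) (auto intro!: finite_PiE)
  have "card ?S \<le> card ?T * m ^ m"
  proof (rule card_fibres_le[where f = "\<lambda>x. restrict x {m..<n}"])
    show "finite ?T" by (intro finite_PiE) auto
    show "(\<lambda>x. restrict x {m..<n}) ` ?S \<subseteq> ?T" using assms by (auto simp: PiE_iff)
  next
    fix t assume "t \<in> ?T"
    let ?F = "{x \<in> ?S. restrict x {m..<n} = t}"
    show "card ?F \<le> m ^ m"
    proof (cases "?F = {}")
      case False
      then obtain y where y: "y \<in> ?F" by blast
      have tail: "x i = t i" if "x \<in> ?F" "i \<in> {m..<n}" for x i
        using that by (auto simp: restrict_def)
      have split: "(\<Sum>i<n. x i ^ j) = (\<Sum>i<m. x i ^ j) + (\<Sum>i\<in>{m..<n}. t i ^ j)" if "x \<in> ?F" for x j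
      proof -
        have "(\<Sum>i<n. x i ^ j) = (\<Sum>i<m. x i ^ j) + (\<Sum>i\<in>{m..<n}. x i ^ j)"
          using assms(3) sum.atLeastLessThan_concat[of 0 m n "\<lambda>i. x i ^ j"]
          by (simp add: lessThan_atLeast0)
        thus ?thesis using tail[OF that] by simp
      qed
      have head: "x i \<in> y ` {..<m}" if x: "x \<in> ?F" and i: "i < m" for x i
      proof -
        have "[(\<Sum>i<m. x i ^ j) = (\<Sum>i<m. y i ^ j)] (mod int q)" if "j \<in> {1..m}" for j
        proof -
          have "[(\<Sum>i<n. x i ^ j) = b j] (mod int q)" "[(\<Sum>i<n. y i ^ j) = b j] (mod int q)"
            using x y that by auto
          hence "[(\<Sum>i<n. x i ^ j) = (\<Sum>i<n. y i ^ j)] (mod int q)"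
            using cong_sym cong_trans by blast
          thus ?thesis unfolding split[OF x] split[OF y] by (simp add: cong_add_rcancel)
        qed
        from power_sums_cong_imp[OF assms(1,2) this i]
        obtain l where l: "l < m" "[x i = y l] (mod int q)" by blast
        moreover have "x i \<in> {0..<int q}" "y l \<in> {0..<int q}" using x y i l assms(3) by (auto simp: PiE_iff)
        ultimately have "x i = y l" by (intro cong_residues_eq)
        thus ?thesis using l by auto
      qed
      have "card ?F \<le> card (tuples m (y ` {..<m}))"
      proof (rule card_inj_on_le[where f = "\<lambda>x. restrict x {..<m}"])
        show "inj_on (\<lambda>x. restrict x {..<m}) ?F"
        proof (rule inj_onI)
          fix x x' assume x: "x \<in> ?F" "x' \<in> ?F" "restrict x {..<m} = restrict x' {..<m}"
          have "x i = x' i" if "i < n" for i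
          proof (cases "i < m")
            case True
            thus ?thesis using x(3) by (metis lessThan_iff restrict_apply')
          next
            case False
            thus ?thesis using tail[OF x(1), of i] tail[OF x(2), of i] that by simp
          qed
          thus "x = x'" using x by (auto intro!: PiE_ext[of _ "{..<n}" "\<lambda>_. {0..<int q}"])
        qed
        show "(\<lambda>x. restrict x {..<m}) ` ?F \<subseteq> tuples m (y ` {..<m})"
        proof (intro image_subsetI PiE_I)
          fix x i assume "x \<in> ?F" "i \<in> {..<m}"
          thus "restrict x {..<m} i \<in> y ` {..<m}"
            using head[of x i] by (simp only: restrict_apply' lessThan_iff)
        qed simp
        show "finite (tuples m (y ` {..<m}))" by (intro finite_PiE) auto
      qed
      also have "\<dots> = card (y ` {..<m}) ^ m" by (simp add: card_PiE)
      also have "\<dots> \<le> m ^ m" by (intro power_mono) (auto intro: card_image_le[of "{..<m}", simplified])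
      finally show ?thesis .
    next
      case True
      hence "card ?F = 0" by (simp only: card.empty)
      thus ?thesis by simp
    qed
  qed (rule finS)
  also have "card ?T = q ^ (n - m)" by (simp add: card_PiE)
  finally show ?thesis .
qed

section \<open>Nonsingular systems and lifting\<close>

text \<open>Modulo q the P_l form a triangular basis of the polynomials of degree less than n. The
  elimination multiplies p by the leading coefficient of P_n instead of dividing by it, so it stays
  over the integers.\<close>

lemma functional_vanishes_mod_prime:
  fixes L :: "int poly \<Rightarrow> int" and P :: "nat \<Rightarrow> int poly"
  assumes "prime q"
    and lin: "\<And>a b p p'. L (smult a p - smult b p') = a * L p - b * L p'" "L 0 = 0"
    and P: "\<And>l. l < n \<Longrightarrow> degree (P l) \<le> l" "\<And>l. l < n \<Longrightarrow> \<not> int q dvd coeff (P l) l"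
      "\<And>l. l < n \<Longrightarrow> int q dvd L (P l)"
    and "\<forall>i\<ge>n. coeff p i = 0"
  shows "int q dvd L p"
  using P assms(7)
proof (induction n arbitrary: p)
  case 0
  hence "p = 0" by (intro poly_eqI) auto
  thus ?case using lin(2) by simp
next
  case (Suc n)
  define m where "m = coeff (P n) n"
  define c where "c = coeff p n"
  have "int q dvd L (smult m p - smult c (P n))"
  proof (rule Suc.IH)
    show "\<forall>i\<ge>n. coeff (smult m p - smult c (P n)) i = 0"
    proof (intro allI impI)
      fix i assume "i \<ge> n"
      show "coeff (smult m p - smult c (P n)) i = 0"
      proof (cases "i = n")
        case False
        hence "coeff p i = 0" "coeff (P n) i = 0"
          using Suc.prems(4) \<open>i \<ge> n\<close> Suc.prems(1)[of n] by (auto intro!: coeff_eq_0)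
        thus ?thesis by simp
      qed (simp add: m_def c_def)
    qed
  qed (use Suc.prems in auto)
  hence "int q dvd m * L p - c * L (P n)" by (simp only: lin)
  moreover have "int q dvd c * L (P n)" using Suc.prems(3)[of n] by simp
  ultimately have "int q dvd m * L p" by (simp add: dvd_diff_left_iff)
  moreover have "\<not> int q dvd m" using Suc.prems(2)[of n] by (simp add: m_def)
  ultimately show ?case using assms(1) by (simp add: prime_dvd_mult_iff)
qed

text \<open>Testing with the polynomial that vanishes at all other nodes isolates z_i times a
  product of differences prime to q. This takes the place of the Vandermonde determinant.\<close>

lemma vandermonde_mod_prime:
  fixes y z :: "nat \<Rightarrow> int"
  assumes "prime q" "\<And>i l. i < r \<Longrightarrow> l < r \<Longrightarrow> i \<noteq> l \<Longrightarrow> \<not> int q dvd y i - y l"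
    and vanish: "\<And>p. \<forall>i\<ge>r. coeff p i = 0 \<Longrightarrow> int q dvd (\<Sum>i<r. z i * poly p (y i))"
    and "i < r"
  shows "int q dvd z i"
proof -
  define p where "p = (\<Prod>l\<in>{..<r} - {i}. [:- y l, 1:])"
  have "degree p \<le> (\<Sum>l\<in>{..<r} - {i}. degree [:- y l, 1:])"
    using degree_prod_sum_le[of "{..<r} - {i}" "\<lambda>l. [:- y l, 1:]"] by (simp add: p_def o_def)
  also have "\<dots> = r - 1" using assms(4) by simp
  finally have "\<forall>i\<ge>r. coeff p i = 0" using assms(4) by (auto intro!: coeff_eq_0)
  from vanish[OF this] have "int q dvd (\<Sum>l<r. z l * poly p (y l))" .
  also have "(\<Sum>l<r. z l * poly p (y l)) = (\<Sum>l\<in>{i}. z l * poly p (y l))"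
  proof (rule sum.mono_neutral_right)
    show "\<forall>l\<in>{..<r} - {i}. z l * poly p (y l) = 0"
      by (auto simp: p_def poly_prod)
  qed (use assms(4) in auto)
  finally have "int q dvd z i * (\<Prod>l\<in>{..<r} - {i}. y i - y l)" by (simp add: p_def poly_prod)
  moreover have "\<not> int q dvd (\<Prod>l\<in>{..<r} - {i}. y i - y l)"
    using assms(1,2,4) by (auto simp: prime_dvd_prod_iff)
  ultimately show ?thesis using assms(1) by (simp add: prime_dvd_mult_iff)
qed

lemma poly_taylor_order2:
  fixes p :: "int poly"
  shows "\<exists>c. poly p (x + h) = poly p x + h * poly (pderiv p) x + h ^ 2 * c"
proof (induction p)
  case (pCons a p)
  then obtain c where c: "poly p (x + h) = poly p x + h * poly (pderiv p) x + h ^ 2 * c" by blast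
  show ?case
  proof (rule exI[of _ "x * c + poly (pderiv p) x + h * c"])
    have "poly (pCons a p) (x + h) = a + (x + h) * (poly p x + h * poly (pderiv p) x + h ^ 2 * c)"
      by (simp only: poly_pCons c)
    thus "poly (pCons a p) (x + h) = poly (pCons a p) x + h * poly (pderiv (pCons a p)) x
        + h ^ 2 * (x * c + poly (pderiv p) x + h * c)"
      by (simp add: pderiv_pCons algebra_simps power2_eq_square)
  qed
qed simp

text \<open>The Jacobian of the sums over i of \<Phi>_j(x_i), j in R, has trivial kernel modulo q at
  every point congruent to \<xi>. Speaking of the kernel avoids determinants and is the form in
  which lifting uses it.\<close>

definition nonsingular_mod :: "nat \<Rightarrow> nat \<Rightarrow> nat set \<Rightarrow> (nat \<Rightarrow> int poly) \<Rightarrow> (nat \<Rightarrow> int) \<Rightarrow> bool" where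
  "nonsingular_mod q r R \<Phi> \<xi> \<longleftrightarrow> (\<forall>y z. (\<forall>i<r. [y i = \<xi> i] (mod int q)) \<longrightarrow>
      (\<forall>j\<in>R. int q dvd (\<Sum>i<r. z i * poly (pderiv (\<Phi> j)) (y i))) \<longrightarrow> (\<forall>i<r. int q dvd z i))"

text \<open>The uniqueness half of Hensel's lemma. With x = y + q^a z the second-order Taylor terms
  are divisible by q^(2a), hence by q^(a+1), so the linear terms vanish modulo q after division by
  q^a; nonsingularity then gives q | z, and a increases by one.\<close>

lemma hensel_unique:
  assumes "prime q" "nonsingular_mod q r R \<Phi> \<xi>" "k \<ge> 1"
    and x: "\<And>i. i < r \<Longrightarrow> [x i = \<xi> i] (mod int q)" and y: "\<And>i. i < r \<Longrightarrow> [y i = \<xi> i] (mod int q)"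
    and eq: "\<And>j. j \<in> R \<Longrightarrow> [(\<Sum>i<r. poly (\<Phi> j) (x i)) = (\<Sum>i<r. poly (\<Phi> j) (y i))] (mod int q ^ k)"
    and "i < r"
  shows "int q ^ k dvd x i - y i"
proof -
  have "\<forall>i<r. int q ^ a dvd x i - y i" if "a \<ge> 1" "a \<le> k" for a
    using that
  proof (induction a rule: nat_induct_at_least)
    case base
    show ?case
    proof (intro allI impI)
      fix i assume "i < r"
      have "[x i = y i] (mod int q)" using x[OF \<open>i < r\<close>] y[OF \<open>i < r\<close>] cong_sym cong_trans by blast
      thus "int q ^ 1 dvd x i - y i" by (simp add: cong_iff_dvd_diff)
    qed
  next
    case (Suc a)
    hence IH: "\<forall>i<r. int q ^ a dvd x i - y i" by simp
    define z where "z = (\<lambda>i. (x i - y i) div int q ^ a)"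
    have z: "x i = y i + int q ^ a * z i" if "i < r" for i
      using IH that by (simp add: z_def)
    have "int q dvd (\<Sum>i<r. z i * poly (pderiv (\<Phi> j)) (y i))" if "j \<in> R" for j
    proof -
      have "\<forall>i. \<exists>c. i < r \<longrightarrow> poly (\<Phi> j) (x i) - poly (\<Phi> j) (y i)
          = int q ^ a * (z i * poly (pderiv (\<Phi> j)) (y i)) + int q ^ Suc a * c"
      proof
        fix i
        obtain c where "poly (\<Phi> j) (y i + int q ^ a * z i) = poly (\<Phi> j) (y i)
             + int q ^ a * z i * poly (pderiv (\<Phi> j)) (y i) + (int q ^ a * z i) ^ 2 * c"
          using poly_taylor_order2 by blast
        moreover have "(int q ^ a * z i) ^ 2 * c = int q ^ Suc a * (int q ^ (a - 1) * z i ^ 2 * c)"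
        proof -
          have "int q ^ a * int q ^ a = int q ^ Suc a * int q ^ (a - 1)"
            using Suc.hyps by (simp only: power_add[symmetric]) simp
          thus ?thesis by (simp add: power2_eq_square mult_ac del: power_Suc)
        qed
        ultimately show "\<exists>c. i < r \<longrightarrow> poly (\<Phi> j) (x i) - poly (\<Phi> j) (y i)
          = int q ^ a * (z i * poly (pderiv (\<Phi> j)) (y i)) + int q ^ Suc a * c"
          using z[of i] by (intro exI[of _ "int q ^ (a - 1) * z i ^ 2 * c"]) (simp add: mult_ac)
      qed
      then obtain c where c: "\<And>i. i < r \<Longrightarrow> poly (\<Phi> j) (x i) - poly (\<Phi> j) (y i)
          = int q ^ a * (z i * poly (pderiv (\<Phi> j)) (y i)) + int q ^ Suc a * c i"
        by metis
      have "int q ^ Suc a dvd int q ^ k" using Suc.prems by (intro le_imp_power_dvd) auto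
      hence "int q ^ Suc a dvd (\<Sum>i<r. poly (\<Phi> j) (x i)) - (\<Sum>i<r. poly (\<Phi> j) (y i))"
        using eq[OF that] dvd_trans by (auto simp: cong_iff_dvd_diff)
      also have "\<dots> = (\<Sum>i<r. int q ^ a * (z i * poly (pderiv (\<Phi> j)) (y i)) + int q ^ Suc a * c i)"
        unfolding sum_subtractf[symmetric] using c by (intro sum.cong) auto
      also have "\<dots> = int q ^ a * (\<Sum>i<r. z i * poly (pderiv (\<Phi> j)) (y i)) + int q ^ Suc a * (\<Sum>i<r. c i)"
        by (simp only: sum.distrib sum_distrib_left)
      finally have "int q ^ Suc a dvd int q ^ a * (\<Sum>i<r. z i * poly (pderiv (\<Phi> j)) (y i))"
        by (simp add: dvd_add_left_iff)
      hence "int q ^ a * int q dvd int q ^ a * (\<Sum>i<r. z i * poly (pderiv (\<Phi> j)) (y i))"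
        by (simp only: power_Suc2)
      thus ?thesis using assms(1) by (simp add: prime_gt_0_nat)
    qed
    hence "\<forall>i<r. int q dvd z i"
      using assms(2) y unfolding nonsingular_mod_def by blast
    thus ?case using z by (auto simp: dvd_def mult_ac)
  qed
  thus ?thesis using assms(3,7) by blast
qed

section \<open>Difference quotients and translated systems\<close>

lemma poly_difference_quotient:
  fixes p :: "int poly"
  shows "\<exists>D. (\<forall>x. poly p (x + H) = poly p x + H * poly D x) \<and>
     (\<forall>n. degree p \<le> n \<longrightarrow> degree D \<le> n - 1 \<and> coeff D (n - 1) = int n * coeff p n)"
proof (induction p)
  case 0
  show ?case by (rule exI[of _ 0]) simp
next
  case (pCons a p)
  then obtain D where D: "\<And>x. poly p (x + H) = poly p x + H * poly D x"
     "\<And>n. degree p \<le> n \<Longrightarrow> degree D \<le> n - 1 \<and> coeff D (n - 1) = int n * coeff p n" by blast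
  let ?s = "pcompose p [:H, 1:]"
  have s1: "degree ?s = degree p" by (simp add: degree_pcompose)
  have "lead_coeff ?s = lead_coeff p" by (subst lead_coeff_comp) auto
  note s = s1 this
  let ?D = "pCons 0 D + ?s"
  have "degree ?D \<le> n - 1 \<and> coeff ?D (n - 1) = int n * coeff (pCons a p) n" if n: "degree (pCons a p) \<le> n" for n
  proof (cases "p = 0")
    case True
    hence "degree D \<le> 0" "coeff D 0 = 0" using D(2)[of 0] by auto
    hence "D = 0" by (metis degree_0_id le_zero_eq of_int_0 pCons_0_0)
    thus ?thesis using True by (cases n) auto
  next
    case False
    then obtain m where m: "n = Suc m" "degree p \<le> m" using n by (cases n) auto
    have "coeff ?s m = coeff p m"
      using s m(2) by (metis antisym_conv2 coeff_eq_0)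
    moreover have "coeff (pCons 0 D) m = int m * coeff p m"
      using D(2)[OF m(2)] by (cases m) auto
    moreover have "degree (pCons 0 D) \<le> m"
    proof (cases m)
      case 0
      hence "degree D \<le> 0" "coeff D 0 = 0" using D(2)[OF m(2)] by auto
      hence "D = 0" by (metis degree_0_id le_zero_eq of_int_0 pCons_0_0)
      thus ?thesis by simp
    next
      case (Suc m')
      thus ?thesis using D(2)[OF m(2)] by (simp add: degree_pCons_eq_if)
    qed
    ultimately show ?thesis using m s by (auto simp: algebra_simps intro: degree_add_le)
  qed
  moreover have "poly (pCons a p) (x + H) = poly (pCons a p) x + H * poly ?D x" for x
    using D(1)[of x] by (simp add: poly_pcompose algebra_simps)
  ultimately show ?case by blast
qed

text \<open>The combination that takes the powers z^l, 1 \<le> l \<le> j, to (z - c)^j up to a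
  constant. There is no equation of index 0, so l = 0 is left out; the missing constant (-c)^j is
  the same on both sides of an equation and cancels.\<close>

definition translate :: "int \<Rightarrow> (nat \<Rightarrow> int poly) \<Rightarrow> nat \<Rightarrow> int poly" where
  "translate c \<Psi> j = (\<Sum>l=1..j. smult (of_nat (j choose l) * (- c) ^ (j - l)) (\<Psi> l))"

lemma poly_translate: "poly (translate c \<Psi> j) x = (\<Sum>l=1..j. of_nat (j choose l) * (- c) ^ (j - l) * poly (\<Psi> l) x)"
  by (simp add: translate_def poly_sum)

lemma degree_translate:
  assumes "\<And>l. l \<in> {1..k} \<Longrightarrow> degree (\<Psi> l) \<le> l - d" "j \<in> {1..k}"
  shows "degree (translate c \<Psi> j) \<le> j - d"
  unfolding translate_def
proof (rule degree_sum_le)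
  fix l assume l: "l \<in> {1..j}"
  have "degree (smult (of_nat (j choose l) * (- c) ^ (j - l)) (\<Psi> l)) \<le> degree (\<Psi> l)" by (rule degree_smult_le)
  also have "\<dots> \<le> l - d" using l assms by auto
  also have "\<dots> \<le> j - d" using l by auto
  finally show "degree (smult (of_nat (j choose l) * (- c) ^ (j - l)) (\<Psi> l)) \<le> j - d" .
qed auto

text \<open>Only the summand l = j reaches degree j - d. So a condition on the leading coefficients
  modulo q carries over to all translations c at once.\<close>

lemma coeff_translate:
  assumes "\<And>l. l \<in> {1..k} \<Longrightarrow> degree (\<Psi> l) \<le> l - d" "j \<in> {1..k}" "d < j"
  shows "coeff (translate c \<Psi> j) (j - d) = coeff (\<Psi> j) (j - d)"
proof -
  have "coeff (translate c \<Psi> j) (j - d)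
      = (\<Sum>l\<in>{1..j}. of_nat (j choose l) * (- c) ^ (j - l) * coeff (\<Psi> l) (j - d))"
    by (simp add: translate_def coeff_sum)
  also have "\<dots> = (\<Sum>l\<in>{j}. of_nat (j choose l) * (- c) ^ (j - l) * coeff (\<Psi> l) (j - d))"
  proof (rule sum.mono_neutral_right)
    show "\<forall>l\<in>{1..j} - {j}. of_nat (j choose l) * (- c) ^ (j - l) * coeff (\<Psi> l) (j - d) = 0"
    proof
      fix l assume l: "l \<in> {1..j} - {j}"
      hence "degree (\<Psi> l) \<le> l - d" using assms by auto
      also have "l - d < j - d" using l assms by auto
      finally show "of_nat (j choose l) * (- c) ^ (j - l) * coeff (\<Psi> l) (j - d) = 0"
        by (simp add: coeff_eq_0)
    qed
  qed (use assms in auto)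
  finally show ?thesis by simp
qed

lemma binomial_shift:
  fixes c t :: int
  shows "(\<Sum>l=1..j. of_nat (j choose l) * (- c) ^ (j - l) * (c + t) ^ l) = t ^ j - (- c) ^ j"
proof -
  have "t ^ j = ((c + t) + (- c)) ^ j" by simp
  also have "\<dots> = (\<Sum>l\<le>j. of_nat (j choose l) * (c + t) ^ l * (- c) ^ (j - l))" by (rule binomial_ring)
  also have "\<dots> = (- c) ^ j + (\<Sum>l=1..j. of_nat (j choose l) * (c + t) ^ l * (- c) ^ (j - l))"
    by (subst atMost_atLeast0, subst sum.atLeast_Suc_atMost) auto
  finally show ?thesis by (simp add: mult_ac)
qed

text \<open>The binomial combination of the equations of index at most j makes the terms in c + q z
  homogeneous, leaving q^j z^j; the price is that \<Psi>_j becomes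
  \<open>translate c \<Psi> j\<close>.\<close>

lemma translate_equations:
  fixes x y z w :: "nat \<Rightarrow> int"
  assumes eq: "\<forall>j\<in>{1..k}. (\<Sum>i<r. poly (\<Psi> j) (x i)) + (\<Sum>m<u. (c + q * z m) ^ j)
      = (\<Sum>i<r. poly (\<Psi> j) (y i)) + (\<Sum>m<u. (c + q * w m) ^ j)"
    and j: "j \<in> {1..k}"
  shows "(\<Sum>i<r. poly (translate c \<Psi> j) (x i)) + q ^ j * (\<Sum>m<u. z m ^ j)
      = (\<Sum>i<r. poly (translate c \<Psi> j) (y i)) + q ^ j * (\<Sum>m<u. w m ^ j)"
proof -
  have *: "(\<Sum>l=1..j. of_nat (j choose l) * (- c) ^ (j - l) * ((\<Sum>i<r. poly (\<Psi> l) (x i)) + (\<Sum>m<u. (c + q * z m) ^ l)))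
    = (\<Sum>i<r. poly (translate c \<Psi> j) (x i)) + q ^ j * (\<Sum>m<u. z m ^ j) - int u * (- c) ^ j" for x z
  proof -
    have "(\<Sum>l=1..j. of_nat (j choose l) * (- c) ^ (j - l) * (\<Sum>i<r. poly (\<Psi> l) (x i)))
        = (\<Sum>i<r. poly (translate c \<Psi> j) (x i))"
      unfolding poly_translate sum_distrib_left by (rule sum.swap)
    moreover have "(\<Sum>l=1..j. of_nat (j choose l) * (- c) ^ (j - l) * (\<Sum>m<u. (c + q * z m) ^ l))
        = (\<Sum>m<u. (q * z m) ^ j - (- c) ^ j)"
      unfolding sum_distrib_left binomial_shift[symmetric] by (rule sum.swap)
    ultimately show ?thesis
      by (simp add: distrib_left sum.distrib sum_subtractf power_mult_distrib sum_distrib_left)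
  qed
  have "(\<Sum>l=1..j. of_nat (j choose l) * (- c) ^ (j - l) * ((\<Sum>i<r. poly (\<Psi> l) (x i)) + (\<Sum>m<u. (c + q * z m) ^ l)))
     = (\<Sum>l=1..j. of_nat (j choose l) * (- c) ^ (j - l) * ((\<Sum>i<r. poly (\<Psi> l) (y i)) + (\<Sum>m<u. (c + q * w m) ^ l)))"
    using eq j by (intro sum.cong refl) auto
  thus ?thesis unfolding * by simp
qed

section \<open>Passing to residue classes\<close>

definition sysval :: "(nat \<Rightarrow> int poly) \<Rightarrow> nat \<Rightarrow> nat \<Rightarrow> (nat \<Rightarrow> int) \<times> (nat \<Rightarrow> int) \<Rightarrow> nat \<Rightarrow> int" where
  "sysval \<Psi> r u = (\<lambda>(x, z) j. (\<Sum>i<r. poly (\<Psi> j) (x i)) + (\<Sum>m<u. z m ^ j))"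

lemma sysval_Pair: "sysval \<Psi> r u (x, z) j = (\<Sum>i<r. poly (\<Psi> j) (x i)) + (\<Sum>m<u. z m ^ j)"
  by (simp add: sysval_def)

definition residues_of :: "nat \<Rightarrow> nat \<Rightarrow> (nat \<Rightarrow> int) \<Rightarrow> nat \<Rightarrow> int" where
  "residues_of q n x = (\<lambda>i\<in>{..<n}. x i mod int q)"

lemma residues_of_in: "q > 0 \<Longrightarrow> residues_of q n x \<in> tuples n {0..<int q}"
  by (auto simp: residues_of_def)

definition fibre_interval :: "nat \<Rightarrow> int set \<Rightarrow> int \<Rightarrow> int set" where
  "fibre_interval q Z c = {z. c + int q * z \<in> Z}"

lemma finite_fibre_interval:
  assumes "finite Z" "q > 0"
  shows "finite (fibre_interval q Z c)"
proof -
  have "inj (\<lambda>z. c + int q * z)" using assms(2) by (auto simp: inj_on_def)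
  from finite_vimageI[OF assms(1) this] show ?thesis by (simp add: fibre_interval_def vimage_def)
qed

text \<open>What remains of a solution once x \<equiv> y modulo q^k is known and the equation of
  index j has been divided by q^j. The \<open>div\<close> is exact, since the polynomial values are
  congruent modulo q^k as well and j \<le> k.\<close>

definition lifted_solutions ::
  "nat \<Rightarrow> nat \<Rightarrow> nat \<Rightarrow> nat \<Rightarrow> (nat \<Rightarrow> int poly) \<Rightarrow> int set \<Rightarrow> int set \<Rightarrow>
     (((nat \<Rightarrow> int) \<times> (nat \<Rightarrow> int)) \<times> ((nat \<Rightarrow> int) \<times> (nat \<Rightarrow> int))) set" where
  "lifted_solutions k q r u \<Phi> X I = {((x, z), (y, w)) \<in> (tuples r X \<times> tuples u I) \<times> (tuples r X \<times> tuples u I).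
      (\<forall>i<r. int q ^ k dvd x i - y i) \<and>
      (\<forall>j\<in>{1..k}. (\<Sum>i<r. (poly (\<Phi> j) (x i) - poly (\<Phi> j) (y i)) div int q ^ j) + (\<Sum>m<u. z m ^ j) - (\<Sum>m<u. w m ^ j) = 0)}"

lemma finite_lifted_solutions:
  assumes "finite X" "finite I"
  shows "finite (lifted_solutions k q r u \<Phi> X I)"
  by (rule finite_subset[of _ "(tuples r X \<times> tuples u I) \<times> (tuples r X \<times> tuples u I)"])
    (use assms in \<open>auto simp: lifted_solutions_def finite_PiE intro!: finite_cartesian_product finite_PiE\<close>)

lemma card_residue_fibre_le:
  fixes v :: int
  assumes "q > 0" "j \<le> k"
  shows "card {b \<in> {0..<int q ^ k}. b mod int q ^ j = v} \<le> q ^ (k - j)"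
proof -
  have eq: "int q ^ k = int q ^ (k - j) * int q ^ j" using assms(2) by (simp add: power_add[symmetric])
  have "card {b \<in> {0..<int q ^ k}. b mod int q ^ j = v} \<le> card {0..<int q ^ (k - j)}"
  proof (rule card_inj_on_le[where f = "\<lambda>b. b div int q ^ j"])
    show "inj_on (\<lambda>b. b div int q ^ j) {b \<in> {0..<int q ^ k}. b mod int q ^ j = v}"
      by (rule inj_onI) (metis (mono_tags, lifting) div_mult_mod_eq mem_Collect_eq)
    show "(\<lambda>b. b div int q ^ j) ` {b \<in> {0..<int q ^ k}. b mod int q ^ j = v} \<subseteq> {0..<int q ^ (k - j)}"
    proof
      fix d assume "d \<in> (\<lambda>b. b div int q ^ j) ` {b \<in> {0..<int q ^ k}. b mod int q ^ j = v}"
      then obtain b where b: "d = b div int q ^ j" "0 \<le> b" "b < int q ^ (k - j) * int q ^ j"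
        by (auto simp: eq)
      have q: "int q ^ j > 0" using assms(1) by simp
      have "d * int q ^ j \<le> b"
        using div_mult_mod_eq[of b "int q ^ j"] pos_mod_sign[OF q, of b] by (simp add: b(1))
      hence "d * int q ^ j < int q ^ (k - j) * int q ^ j" using b(3) by linarith
      moreover have "d \<ge> 0" using b q by (simp add: pos_imp_zdiv_nonneg_iff)
      ultimately show "d \<in> {0..<int q ^ (k - j)}" using q by (simp add: mult_less_cancel_right)
    qed
  qed simp
  also have "\<dots> = q ^ (k - j)" by (simp flip: of_nat_power)
  finally show ?thesis .
qed

lemma energy_scaled_le:
  assumes "finite X" "finite Z" "q > 0"
  shows "energy k ({x \<in> tuples r X. P x} \<times> tuples u {z \<in> Z. z mod int q = c}) (sysval \<Psi> r u)
      \<le> energy k ({x \<in> tuples r X. P x} \<times> tuples u (fibre_interval q Z c))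
          (\<lambda>(x, z) j. (\<Sum>i<r. poly (translate c \<Psi> j) (x i)) + int q ^ j * (\<Sum>m<u. z m ^ j))"
  unfolding energy_def
proof (rule card_inj_on_le)
  let ?Z = "{z \<in> Z. z mod int q = c}"
  let ?d = "\<lambda>z. (\<lambda>m\<in>{..<u}. (z m - c) div int q)"
  let ?f = "\<lambda>((x, z), (y, w)). ((x, ?d z), (y, ?d w))"
  let ?V = "\<lambda>(x, z) j. (\<Sum>i<r. poly (translate c \<Psi> j) (x i)) + int q ^ j * (\<Sum>m<u. z m ^ j)"
  let ?A = "{x \<in> tuples r X. P x} \<times> tuples u ?Z" and ?B = "{x \<in> tuples r X. P x} \<times> tuples u (fibre_interval q Z c)"
  have undo_div: "c + int q * ?d z m = z m" if "z \<in> tuples u ?Z" "m < u" for z m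
  proof -
    have "z m mod int q = c" using that by (auto simp: PiE_iff)
    hence "int q dvd z m - c" by (metis dvd_minus_mod)
    thus ?thesis using that by simp
  qed
  have inj: "z = z'" if "z \<in> tuples u ?Z" "z' \<in> tuples u ?Z" "?d z = ?d z'" for z z'
  proof (rule PiE_ext[OF that(1,2)])
    fix m assume "m \<in> {..<u}"
    thus "z m = z' m" using undo_div[OF that(1), of m] undo_div[OF that(2), of m] that(3) by simp
  qed
  show "inj_on ?f {(p, q) \<in> ?A \<times> ?A. \<forall>j\<in>{1..k}. sysval \<Psi> r u p j = sysval \<Psi> r u q j}"
  proof (rule inj_onI)
    fix s s' assume *: "s \<in> {(p, q) \<in> ?A \<times> ?A. \<forall>j\<in>{1..k}. sysval \<Psi> r u p j = sysval \<Psi> r u q j}"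
       "s' \<in> {(p, q) \<in> ?A \<times> ?A. \<forall>j\<in>{1..k}. sysval \<Psi> r u p j = sysval \<Psi> r u q j}" "?f s = ?f s'"
    obtain x z y w where s: "s = ((x, z), (y, w))" by (metis surj_pair)
    obtain x' z' y' w' where s': "s' = ((x', z'), (y', w'))" by (metis surj_pair)
    have "z \<in> tuples u ?Z" "w \<in> tuples u ?Z" "z' \<in> tuples u ?Z" "w' \<in> tuples u ?Z"
      using *(1,2) by (simp_all add: s s')
    moreover have "x = x'" "y = y'" "?d z = ?d z'" "?d w = ?d w'"
      using *(3) by (simp_all add: s s')
    ultimately show "s = s'" using inj[of z z'] inj[of w w'] by (simp add: s s')
  qed
  show "?f ` {(p, q) \<in> ?A \<times> ?A. \<forall>j\<in>{1..k}. sysval \<Psi> r u p j = sysval \<Psi> r u q j}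
      \<subseteq> {(p, q) \<in> ?B \<times> ?B. \<forall>j\<in>{1..k}. ?V p j = ?V q j}"
  proof (rule image_subsetI)
    fix s assume *: "s \<in> {(p, q) \<in> ?A \<times> ?A. \<forall>j\<in>{1..k}. sysval \<Psi> r u p j = sysval \<Psi> r u q j}"
    obtain x z y w where s: "s = ((x, z), (y, w))" by (metis surj_pair)
    have mem: "x \<in> tuples r X" "P x" "y \<in> tuples r X" "P y" "z \<in> tuples u ?Z" "w \<in> tuples u ?Z"
      and eq: "\<forall>j\<in>{1..k}. sysval \<Psi> r u (x, z) j = sysval \<Psi> r u (y, w) j"
      using * by (simp_all add: s)
    have fib: "?d z \<in> tuples u (fibre_interval q Z c)" if "z \<in> tuples u ?Z" for z
    proof (intro PiE_I)
      fix m assume "m \<in> {..<u}"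
      thus "?d z m \<in> fibre_interval q Z c"
        using undo_div[OF that, of m] that unfolding fibre_interval_def by (auto simp: PiE_iff)
    qed simp
    have "\<forall>j\<in>{1..k}. (\<Sum>i<r. poly (\<Psi> j) (x i)) + (\<Sum>m<u. (c + int q * ?d z m) ^ j)
        = (\<Sum>i<r. poly (\<Psi> j) (y i)) + (\<Sum>m<u. (c + int q * ?d w m) ^ j)"
      using eq undo_div[OF mem(5)] undo_div[OF mem(6)] by (simp add: sysval_Pair cong: sum.cong_simp)
    from translate_equations[OF this]
    show "?f s \<in> {(p, q) \<in> ?B \<times> ?B. \<forall>j\<in>{1..k}. ?V p j = ?V q j}"
      using mem fib[OF mem(5)] fib[OF mem(6)] by (simp add: s)
  qed
  show "finite {(p, q) \<in> ?B \<times> ?B. \<forall>j\<in>{1..k}. ?V p j = ?V q j}"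
    by (rule finite_subset[of _ "?B \<times> ?B"])
      (use assms finite_fibre_interval[OF assms(2,3), of c] in \<open>auto intro!: finite_cartesian_product finite_PiE finite_Collect_mem\<close>)
qed

lemma poly_diff_dvd:
  fixes p :: "int poly"
  assumes "Q dvd x - y"
  shows "Q dvd poly p x - poly p y"
proof -
  have "x - y dvd poly p x - poly p y"
  proof (induction p)
    case (pCons a p)
    have "poly (pCons a p) x - poly (pCons a p) y = x * (poly p x - poly p y) + (x - y) * poly p y"
      by (simp add: algebra_simps)
    thus ?case using pCons by (metis dvd_add dvd_mult dvd_triv_left)
  qed simp
  thus ?thesis using assms dvd_trans by blast
qed

text \<open>Solutions are sorted by the values \<open>\<Sum>\<^sub>i \<Phi>\<^sub>j(x\<^sub>i)\<close> modulo \<open>q\<^sup>k\<close>. The equation of index \<open>j\<close> fixes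
  the difference of two such values modulo \<open>q\<^sup>j\<close>, which leaves \<open>q\<^bsup>k-j\<^esup>\<close> possibilities.\<close>

lemma energy_lifting_le:
  assumes "finite X" "finite I" "prime q" "k \<ge> 1" "r \<le> k"
    and ns: "nonsingular_mod q r {k - r + 1..k} \<Phi> \<xi>"
  shows "energy k ({x \<in> tuples r X. residues_of q r x = \<xi>} \<times> tuples u I)
          (\<lambda>(x, z) j. (\<Sum>i<r. poly (\<Phi> j) (x i)) + int q ^ j * (\<Sum>m<u. z m ^ j))
      \<le> q ^ (\<Sum>j=k-r+1..k. k - j)
        * card {((x, z), (y, w)) \<in> lifted_solutions k q r u \<Phi> X I. residues_of q r x = \<xi>}"
proof -
  \<comment> \<open>Lifting r variables takes r equations, and those of highest index are chosen
    because the loss q^(k-j) is smallest for large j.\<close>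
  let ?R = "{k - r + 1..k}"
  let ?B = "{x \<in> tuples r X. residues_of q r x = \<xi>} \<times> tuples u I"
  let ?V = "\<lambda>(x, z) j. (\<Sum>i<r. poly (\<Phi> j) (x i)) + int q ^ j * (\<Sum>m<u. z m ^ j)"
  let ?g = "\<lambda>(x :: nat \<Rightarrow> int, z :: nat \<Rightarrow> int). (\<lambda>j\<in>?R. (\<Sum>i<r. poly (\<Phi> j) (x i)) mod int q ^ k)"
  define \<rho> where "\<rho> = (\<lambda>v v'. \<forall>j\<in>?R. v j mod int q ^ j = (v' j :: int) mod int q ^ j)"
  have q0: "q > 0" using assms(3) by (rule prime_gt_0_nat)
  have finB: "finite ?B" using assms by (auto intro!: finite_cartesian_product finite_PiE finite_Collect_mem)
  have "energy k ?B ?V \<le> q ^ (\<Sum>j=k-r+1..k. k - j) * (\<Sum>a\<in>?g ` ?B. energy k {p \<in> ?B. ?g p = a} ?V)"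
  proof (rule energy_relation[OF finB, where \<rho> = \<rho>])
    fix p p' assume p: "p \<in> ?B" "p' \<in> ?B" "\<forall>j\<in>{1..k}. ?V p j = ?V p' j"
    obtain x z y w where pp: "p = (x, z)" "p' = (y, w)" by (metis surj_pair)
    show "\<rho> (?g p) (?g p')" unfolding \<rho>_def
    proof
      fix j assume j: "j \<in> ?R"
      have dv: "int q ^ j dvd int q ^ k" using j by (intro le_imp_power_dvd) auto
      have "(\<Sum>i<r. poly (\<Phi> j) (x i)) + int q ^ j * (\<Sum>m<u. z m ^ j) = (\<Sum>i<r. poly (\<Phi> j) (y i)) + int q ^ j * (\<Sum>m<u. w m ^ j)"
        using p(3) j by (simp add: pp)
      hence "((\<Sum>i<r. poly (\<Phi> j) (x i)) + int q ^ j * (\<Sum>m<u. z m ^ j)) mod int q ^ j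
           = ((\<Sum>i<r. poly (\<Phi> j) (y i)) + int q ^ j * (\<Sum>m<u. w m ^ j)) mod int q ^ j" by simp
      hence "(\<Sum>i<r. poly (\<Phi> j) (x i)) mod int q ^ j = (\<Sum>i<r. poly (\<Phi> j) (y i)) mod int q ^ j" by simp
      thus "?g p j mod int q ^ j = ?g p' j mod int q ^ j"
        using j dv by (simp add: pp mod_mod_cancel)
    qed
  next
    fix v v' assume "\<rho> v v'"
    thus "\<rho> v' v" by (simp add: \<rho>_def)
  next
    fix v assume "v \<in> ?g ` ?B"
    have "{v' \<in> ?g ` ?B. \<rho> v v'} \<subseteq> PiE ?R (\<lambda>j. {b \<in> {0..<int q ^ k}. b mod int q ^ j = v j mod int q ^ j})"
    proof
      fix v' assume "v' \<in> {v' \<in> ?g ` ?B. \<rho> v v'}"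
      then obtain p where p: "v' = ?g p" "\<rho> v v'" by blast
      obtain x z where pp: "p = (x, z)" by (metis surj_pair)
      show "v' \<in> PiE ?R (\<lambda>j. {b \<in> {0..<int q ^ k}. b mod int q ^ j = v j mod int q ^ j})"
      proof (rule PiE_I)
        fix j assume j: "j \<in> ?R"
        have "v' j = (\<Sum>i<r. poly (\<Phi> j) (x i)) mod int q ^ k" using j by (simp add: p(1) pp)
        moreover have "v' j mod int q ^ j = v j mod int q ^ j" using p(2) j by (simp add: \<rho>_def)
        ultimately show "v' j \<in> {b \<in> {0..<int q ^ k}. b mod int q ^ j = v j mod int q ^ j}"
          using q0 by simp
      qed (auto simp: p(1) pp)
    qed
    hence "card {v' \<in> ?g ` ?B. \<rho> v v'} \<le> card (PiE ?R (\<lambda>j. {b \<in> {0..<int q ^ k}. b mod int q ^ j = v j mod int q ^ j}))"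
      by (intro card_mono finite_PiE finite_Collect_mem) (simp_all only: finite_atLeastAtMost finite_atLeastLessThan_int)
    also have "\<dots> = (\<Prod>j\<in>?R. card {b \<in> {0..<int q ^ k}. b mod int q ^ j = v j mod int q ^ j})"
      by (simp add: card_PiE)
    also have "\<dots> \<le> (\<Prod>j\<in>?R. q ^ (k - j))"
      using q0 by (intro prod_mono conjI card_residue_fibre_le) auto
    also have "\<dots> = q ^ (\<Sum>j=k-r+1..k. k - j)" by (simp add: power_sum)
    finally show "card {v' \<in> ?g ` ?B. \<rho> v v'} \<le> q ^ (\<Sum>j=k-r+1..k. k - j)" .
  qed
  also have "(\<Sum>a\<in>?g ` ?B. energy k {p \<in> ?B. ?g p = a} ?V) = card {(p, p') \<in> ?B \<times> ?B. ?g p = ?g p' \<and> (\<forall>j\<in>{1..k}. ?V p j = ?V p' j)}"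
    by (rule sum_energy_classes[OF finB])
  also have "\<dots> \<le> card {((x, z), (y, w)) \<in> lifted_solutions k q r u \<Phi> X I. residues_of q r x = \<xi>}"
  proof (rule card_mono)
    show "finite {((x, z), (y, w)) \<in> lifted_solutions k q r u \<Phi> X I. residues_of q r x = \<xi>}"
      by (rule finite_subset[OF _ finite_lifted_solutions[OF assms(1,2), of k q r u \<Phi>]]) auto
    show "{(p, p') \<in> ?B \<times> ?B. ?g p = ?g p' \<and> (\<forall>j\<in>{1..k}. ?V p j = ?V p' j)}
      \<subseteq> {((x, z), (y, w)) \<in> lifted_solutions k q r u \<Phi> X I. residues_of q r x = \<xi>}"
    proof
      fix s assume *: "s \<in> {(p, p') \<in> ?B \<times> ?B. ?g p = ?g p' \<and> (\<forall>j\<in>{1..k}. ?V p j = ?V p' j)}"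
      obtain x z y w where s: "s = ((x, z), (y, w))" by (metis surj_pair)
      have mem: "x \<in> tuples r X" "residues_of q r x = \<xi>" "y \<in> tuples r X" "residues_of q r y = \<xi>" "z \<in> tuples u I" "w \<in> tuples u I"
        and g: "?g (x, z) = ?g (y, w)"
        and V: "\<And>j. j \<in> {1..k} \<Longrightarrow> (\<Sum>i<r. poly (\<Phi> j) (x i)) + int q ^ j * (\<Sum>m<u. z m ^ j)
              = (\<Sum>i<r. poly (\<Phi> j) (y i)) + int q ^ j * (\<Sum>m<u. w m ^ j)"
        using * by (simp_all add: s)
      have res: "[x i = \<xi> i] (mod int q)" "[y i = \<xi> i] (mod int q)" if "i < r" for i
      proof -
        have "\<xi> i = x i mod int q" "\<xi> i = y i mod int q"
          using fun_cong[OF mem(2), of i] fun_cong[OF mem(4), of i] that by (auto simp: residues_of_def)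
        thus "[x i = \<xi> i] (mod int q)" "[y i = \<xi> i] (mod int q)" by (metis cong_def mod_mod_trivial)+
      qed
      have "[(\<Sum>i<r. poly (\<Phi> j) (x i)) = (\<Sum>i<r. poly (\<Phi> j) (y i))] (mod int q ^ k)" if "j \<in> ?R" for j
        using fun_cong[OF g, of j] that by (simp add: cong_def)
      from hensel_unique[OF assms(3) ns assms(4) res this]
      have dv: "int q ^ k dvd x i - y i" if "i < r" for i using that by blast
      have "(\<Sum>i<r. (poly (\<Phi> j) (x i) - poly (\<Phi> j) (y i)) div int q ^ j) + (\<Sum>m<u. z m ^ j) - (\<Sum>m<u. w m ^ j) = 0"
        if j: "j \<in> {1..k}" for j
      proof -
        have "int q ^ j * (\<Sum>i<r. (poly (\<Phi> j) (x i) - poly (\<Phi> j) (y i)) div int q ^ j)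
            = (\<Sum>i<r. poly (\<Phi> j) (x i) - poly (\<Phi> j) (y i))"
          unfolding sum_distrib_left
        proof (intro sum.cong refl)
          fix i assume "i \<in> {..<r}"
          hence "int q ^ k dvd poly (\<Phi> j) (x i) - poly (\<Phi> j) (y i)" using dv by (intro poly_diff_dvd) auto
          moreover have "int q ^ j dvd int q ^ k" using j by (intro le_imp_power_dvd) auto
          ultimately show "int q ^ j * ((poly (\<Phi> j) (x i) - poly (\<Phi> j) (y i)) div int q ^ j) = poly (\<Phi> j) (x i) - poly (\<Phi> j) (y i)"
            by (meson dvd_mult_div_cancel dvd_trans)
        qed
        hence "int q ^ j * ((\<Sum>i<r. (poly (\<Phi> j) (x i) - poly (\<Phi> j) (y i)) div int q ^ j) + (\<Sum>m<u. z m ^ j) - (\<Sum>m<u. w m ^ j)) = 0"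
          using V[OF j] by (simp add: algebra_simps sum_subtractf)
        thus ?thesis using q0 by simp
      qed
      thus "s \<in> {((x, z), (y, w)) \<in> lifted_solutions k q r u \<Phi> X I. residues_of q r x = \<xi>}"
        using mem dv by (simp add: s lifted_solutions_def)
    qed
  qed
  finally show ?thesis by simp
qed

text \<open>The residues of all r + u variables are sorted together, so that the k equations modulo
  q limit D. Then the u residues \<eta> are replaced by a single one. The sum over \<eta> is
  estimated trivially by q^u, but the sum over \<xi> costs nothing: for fixed c the lifted solutions
  with different \<xi> are disjoint.\<close>

lemma energy_mixing_lifting:
  fixes \<Gamma> :: "((nat \<Rightarrow> int) \<times> (nat \<Rightarrow> int)) set"
  assumes fin: "finite X" "finite Z" and q: "prime q" and k: "k \<ge> 1" "r \<le> k" "u > 0"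
    and A: "\<And>x z. (x, z) \<in> A \<Longrightarrow> x \<in> tuples r X \<and> z \<in> tuples u Z \<and> (residues_of q r x, residues_of q u z) \<in> \<Gamma>"
    and deg: "\<And>\<gamma>. \<gamma> \<in> \<Gamma> \<Longrightarrow> card {\<gamma>' \<in> tuples r {0..<int q} \<times> tuples u {0..<int q}.
        \<gamma>' \<in> \<Gamma> \<and> (\<forall>j\<in>{1..k}. [sysval \<Psi> r u \<gamma> j = sysval \<Psi> r u \<gamma>' j] (mod int q))} \<le> D"
    and ns: "\<And>\<xi> \<eta> m. (\<xi>, \<eta>) \<in> \<Gamma> \<Longrightarrow> m < u \<Longrightarrow> nonsingular_mod q r {k - r + 1..k} (translate (\<eta> m) \<Psi>) \<xi>"
    and t: "\<And>c. c \<in> {0..<int q} \<Longrightarrow> card (lifted_solutions k q r u (translate c \<Psi>) X (fibre_interval q Z c)) \<le> t"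
  shows "energy k A (sysval \<Psi> r u) \<le> D * (q ^ u * (u * (q ^ (\<Sum>j=k-r+1..k. k - j) * t)))"
proof -
  let ?V = "sysval \<Psi> r u" and ?w = "q ^ (\<Sum>j=k-r+1..k. k - j)"
  let ?Xi = "tuples r {0..<int q}" and ?H = "tuples u {0..<int q}"
  have q0: "q > 0" using q by (rule prime_gt_0_nat)
  have fins: "finite ?Xi" "finite ?H" by (auto intro!: finite_PiE)
  have finA: "finite A"
    by (rule finite_subset[of _ "tuples r X \<times> tuples u Z"]) (use A fin in \<open>auto intro!: finite_PiE\<close>)
  define g where "g = (\<lambda>(x, z). (residues_of q r x, residues_of q u z))"
  define \<rho> where "\<rho> = (\<lambda>\<gamma> \<gamma>'. \<forall>j\<in>{1..k}. [?V \<gamma> j = ?V \<gamma>' j] (mod int q))"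
  have gA: "g p \<in> \<Gamma> \<and> g p \<in> ?Xi \<times> ?H" if "p \<in> A" for p
    using that A residues_of_in[OF q0] by (cases p) (auto simp: g_def)
  have gV: "[?V p j = ?V (g p) j] (mod int q)" for p j
  proof -
    obtain x z where p: "p = (x, z)" by (metis surj_pair)
    have "[(\<Sum>i<r. poly (\<Psi> j) (x i)) = (\<Sum>i<r. poly (\<Psi> j) (residues_of q r x i))] (mod int q)"
      by (intro cong_sum) (auto simp: residues_of_def cong_iff_dvd_diff intro!: poly_diff_dvd)
    moreover have "[(\<Sum>m<u. z m ^ j) = (\<Sum>m<u. residues_of q u z m ^ j)] (mod int q)"
      by (intro cong_sum cong_pow) (auto simp: residues_of_def cong_def)
    ultimately show ?thesis by (simp add: p g_def sysval_Pair cong_add)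
  qed
  define Tx where "Tx = (\<lambda>\<xi> c. {((x, z), (y, w)) \<in> lifted_solutions k q r u (translate c \<Psi>) X (fibre_interval q Z c). residues_of q r x = \<xi>})"
  have finT: "finite (lifted_solutions k q r u (translate c \<Psi>) X (fibre_interval q Z c))" for c
    using fin finite_fibre_interval[OF fin(2) q0] by (intro finite_lifted_solutions)
  have finTx: "finite (Tx \<xi> c)" for \<xi> c
    by (rule finite_subset[OF _ finT[of c]]) (auto simp: Tx_def)
  have "energy k A ?V \<le> D * (\<Sum>\<gamma>\<in>g ` A. energy k {p \<in> A. g p = \<gamma>} ?V)"
  proof (rule energy_relation[OF finA, where \<rho> = \<rho>])
    fix p p' assume "\<forall>j\<in>{1..k}. ?V p j = ?V p' j"
    thus "\<rho> (g p) (g p')" unfolding \<rho>_def using gV[of p] gV[of p'] by (metis cong_sym cong_trans)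
  next
    fix a b assume "\<rho> a b" thus "\<rho> b a" by (auto simp: \<rho>_def intro: cong_sym)
  next
    fix \<gamma> assume "\<gamma> \<in> g ` A"
    hence "\<gamma> \<in> \<Gamma>" using gA by auto
    have "card {b \<in> g ` A. \<rho> \<gamma> b} \<le> card {\<gamma>' \<in> ?Xi \<times> ?H. \<gamma>' \<in> \<Gamma> \<and> (\<forall>j\<in>{1..k}. [?V \<gamma> j = ?V \<gamma>' j] (mod int q))}"
    proof (rule card_mono)
      show "{b \<in> g ` A. \<rho> \<gamma> b} \<subseteq> {\<gamma>' \<in> ?Xi \<times> ?H. \<gamma>' \<in> \<Gamma> \<and> (\<forall>j\<in>{1..k}. [?V \<gamma> j = ?V \<gamma>' j] (mod int q))}"
        using gA unfolding \<rho>_def by blast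
      show "finite {\<gamma>' \<in> ?Xi \<times> ?H. \<gamma>' \<in> \<Gamma> \<and> (\<forall>j\<in>{1..k}. [?V \<gamma> j = ?V \<gamma>' j] (mod int q))}"
        using fins by (intro finite_Collect_mem finite_cartesian_product)
    qed
    also have "\<dots> \<le> D" by (rule deg[OF \<open>\<gamma> \<in> \<Gamma>\<close>])
    finally show "card {b \<in> g ` A. \<rho> \<gamma> b} \<le> D" .
  qed
  also have "(\<Sum>\<gamma>\<in>g ` A. energy k {p \<in> A. g p = \<gamma>} ?V) \<le> (\<Sum>\<gamma>\<in>g ` A. \<Sum>m<u. ?w * card (Tx (fst \<gamma>) (snd \<gamma> m)))"
  proof (rule sum_mono)
    fix \<gamma> assume "\<gamma> \<in> g ` A"
    obtain \<xi> \<eta> where \<gamma>: "\<gamma> = (\<xi>, \<eta>)" by (metis surj_pair)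
    have mem: "(\<xi>, \<eta>) \<in> \<Gamma>" using gA \<open>\<gamma> \<in> g ` A\<close> \<gamma> by auto
    let ?Ax = "{x \<in> tuples r X. residues_of q r x = \<xi>}" and ?Zc = "\<lambda>c. {z \<in> Z. z mod int q = c}"
    have "energy k {p \<in> A. g p = \<gamma>} ?V \<le> energy k (?Ax \<times> PiE {..<u} (\<lambda>m. ?Zc (\<eta> m))) ?V"
    proof (rule energy_mono)
      show "finite (?Ax \<times> PiE {..<u} (\<lambda>m. ?Zc (\<eta> m)))"
        using fin by (auto intro!: finite_cartesian_product finite_PiE finite_Collect_mem)
      show "{p \<in> A. g p = \<gamma>} \<subseteq> ?Ax \<times> PiE {..<u} (\<lambda>m. ?Zc (\<eta> m))"
      proof
        fix p assume p: "p \<in> {p \<in> A. g p = \<gamma>}"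
        obtain x z where pp: "p = (x, z)" by (metis surj_pair)
        have "x \<in> tuples r X" "z \<in> tuples u Z" using A[of x z] p by (auto simp: pp)
        moreover have "residues_of q r x = \<xi>" "residues_of q u z = \<eta>" using p by (auto simp: pp g_def \<gamma>)
        moreover from this(2) have "z m mod int q = \<eta> m" if "m < u" for m
          using that by (auto simp: residues_of_def)
        ultimately show "p \<in> ?Ax \<times> PiE {..<u} (\<lambda>m. ?Zc (\<eta> m))" by (auto simp: pp PiE_iff)
      qed
    qed
    also have "\<dots> \<le> (\<Sum>m<u. energy k (?Ax \<times> tuples u (?Zc (\<eta> m))) ?V)"
      unfolding sysval_def using fin k by (intro energy_Holder) (auto intro!: finite_PiE finite_Collect_mem)
    also have "\<dots> \<le> (\<Sum>m<u. ?w * card (Tx \<xi> (\<eta> m)))"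
    proof (rule sum_mono)
      fix m assume m: "m \<in> {..<u}"
      have "energy k (?Ax \<times> tuples u (?Zc (\<eta> m))) ?V
          \<le> energy k (?Ax \<times> tuples u (fibre_interval q Z (\<eta> m)))
          (\<lambda>(x, z) j. (\<Sum>i<r. poly (translate (\<eta> m) \<Psi> j) (x i)) + int q ^ j * (\<Sum>m<u. z m ^ j))"
        by (rule energy_scaled_le[OF fin q0])
      also have "\<dots> \<le> ?w * card (Tx \<xi> (\<eta> m))"
        unfolding Tx_def using fin finite_fibre_interval[OF fin(2) q0] q k ns[OF mem] m
        by (intro energy_lifting_le) auto
      finally show "energy k (?Ax \<times> tuples u (?Zc (\<eta> m))) ?V \<le> ?w * card (Tx \<xi> (\<eta> m))" .
    qed
    finally show "energy k {p \<in> A. g p = \<gamma>} ?V \<le> (\<Sum>m<u. ?w * card (Tx (fst \<gamma>) (snd \<gamma> m)))" by (simp add: \<gamma>)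
  qed
  also have "\<dots> \<le> (\<Sum>\<gamma>\<in>?Xi \<times> ?H. \<Sum>m<u. ?w * card (Tx (fst \<gamma>) (snd \<gamma> m)))"
  proof (rule sum_mono2)
    show "finite (?Xi \<times> ?H)" using fins by (rule finite_cartesian_product)
    show "g ` A \<subseteq> ?Xi \<times> ?H" using gA by blast
  qed simp
  also have "\<dots> = (\<Sum>\<xi>\<in>?Xi. \<Sum>\<eta>\<in>?H. \<Sum>m<u. ?w * card (Tx \<xi> (\<eta> m)))"
    by (simp only: sum.cartesian_product' fst_conv snd_conv)
  also have "\<dots> = (\<Sum>\<eta>\<in>?H. \<Sum>m<u. ?w * (\<Sum>\<xi>\<in>?Xi. card (Tx \<xi> (\<eta> m))))"
    by (subst sum.swap, intro sum.cong refl, subst sum.swap) (simp add: sum_distrib_left)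
  also have "\<dots> \<le> (\<Sum>\<eta>\<in>?H. \<Sum>m<u. ?w * t)"
  proof (intro sum_mono mult_left_mono)
    fix \<eta> m assume "\<eta> \<in> ?H" "m \<in> {..<u}"
    hence c: "\<eta> m \<in> {0..<int q}" by (auto simp: PiE_iff)
    have "(\<Sum>\<xi>\<in>?Xi. card (Tx \<xi> (\<eta> m))) = card (\<Union>\<xi>\<in>?Xi. Tx \<xi> (\<eta> m))"
      using fins finTx by (intro card_UN_disjoint[symmetric]) (auto simp: Tx_def)
    also have "\<dots> \<le> card (lifted_solutions k q r u (translate (\<eta> m) \<Psi>) X (fibre_interval q Z (\<eta> m)))"
      using finT by (intro card_mono) (auto simp: Tx_def)
    also have "\<dots> \<le> t" by (rule t[OF c])
    finally show "(\<Sum>\<xi>\<in>?Xi. card (Tx \<xi> (\<eta> m))) \<le> t" .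
  qed auto
  also have "\<dots> = q ^ u * (u * (?w * t))" by (simp add: card_PiE)
  finally show ?thesis by simp
qed

section \<open>The differenced system\<close>

text \<open>The increment h q^k provides a factor q^k, of which q^j is divided out; the rest q^(k-j)
  remains in the coefficients. The explicit leading coefficient shows that it stays nonzero for j >
  d when h, q and the old coefficient are nonzero.\<close>

lemma differenced_system:
  fixes \<Phi> :: "nat \<Rightarrow> int poly"
  assumes "\<And>j. j \<in> {1..k} \<Longrightarrow> degree (\<Phi> j) \<le> j - d" "q > 0"
  shows "\<exists>\<Psi>. \<forall>j\<in>{1..k}.
    (\<forall>x. poly (\<Psi> j) x = (poly (\<Phi> j) (x + int h * int q ^ k) - poly (\<Phi> j) x) div int q ^ j) \<and>
    degree (\<Psi> j) \<le> j - (d + 1) \<and>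
    coeff (\<Psi> j) (j - (d + 1)) = int h * int q ^ (k - j) * int (j - d) * coeff (\<Phi> j) (j - d)"
proof -
  have "\<forall>j. \<exists>D. (\<forall>x. poly (\<Phi> j) (x + int h * int q ^ k) = poly (\<Phi> j) x + int h * int q ^ k * poly D x) \<and>
     (\<forall>n. degree (\<Phi> j) \<le> n \<longrightarrow> degree D \<le> n - 1 \<and> coeff D (n - 1) = int n * coeff (\<Phi> j) n)"
    using poly_difference_quotient by blast
  then obtain D where D: "\<And>j x. poly (\<Phi> j) (x + int h * int q ^ k) = poly (\<Phi> j) x + int h * int q ^ k * poly (D j) x"
    "\<And>j n. degree (\<Phi> j) \<le> n \<Longrightarrow> degree (D j) \<le> n - 1 \<and> coeff (D j) (n - 1) = int n * coeff (\<Phi> j) n"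
    by metis
  define \<Psi> where "\<Psi> = (\<lambda>j. smult (int h * int q ^ (k - j)) (D j))"
  show ?thesis
  proof (intro exI[of _ \<Psi>] ballI conjI allI)
    fix j x assume j: "j \<in> {1..k}"
    have "int q ^ k = int q ^ j * int q ^ (k - j)" using j by (simp add: power_add[symmetric])
    hence "poly (\<Phi> j) (x + int h * int q ^ k) - poly (\<Phi> j) x = int q ^ j * poly (\<Psi> j) x"
      unfolding D(1) \<Psi>_def by (simp add: mult_ac)
    thus "poly (\<Psi> j) x = (poly (\<Phi> j) (x + int h * int q ^ k) - poly (\<Phi> j) x) div int q ^ j"
      using assms(2) by simp
  next
    fix j assume j: "j \<in> {1..k}"
    have "degree (D j) \<le> j - d - 1" using D(2)[OF assms(1)[OF j]] by simp
    thus "degree (\<Psi> j) \<le> j - (d + 1)"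
      unfolding \<Psi>_def by (intro order.trans[OF degree_smult_le]) simp
    have "coeff (D j) (j - d - 1) = int (j - d) * coeff (\<Phi> j) (j - d)" using D(2)[OF assms(1)[OF j]] by simp
    thus "coeff (\<Psi> j) (j - (d + 1)) = int h * int q ^ (k - j) * int (j - d) * coeff (\<Phi> j) (j - d)"
      by (simp add: \<Psi>_def)
  qed
qed

text \<open>The bound W is demanded for every system with the stated degrees and leading
  coefficients, since the differenced polynomials vary with h and this is all that is remembered of
  them.\<close>

lemma card_lifted_solutions_le:
  fixes N W :: real
  assumes "finite I" "real n \<le> N" "N > 0" "q > 0" "r' > 0" "r \<le> 2 * r'" "W \<ge> 0"
    and deg: "\<And>j. j \<in> {1..k} \<Longrightarrow> degree (\<Phi> j) \<le> j - d"
    and W: "\<And>h \<Psi>. h \<in> {1..n div q ^ k} \<Longrightarrow> (\<And>j. j \<in> {1..k} \<Longrightarrow> degree (\<Psi> j) \<le> j - (d + 1)) \<Longrightarrow>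
       (\<And>j. j \<in> {1..k} \<Longrightarrow> coeff (\<Psi> j) (j - (d + 1)) = int h * int q ^ (k - j) * int (j - d) * coeff (\<Phi> j) (j - d)) \<Longrightarrow>
       real (energy k (tuples r' {1..int n} \<times> tuples u I) (sysval \<Psi> r' u)) \<le> W"
  shows "real (card (lifted_solutions k q r u \<Phi> {1..int n} I))
    \<le> 3 ^ r * (2 * N ^ r * real (energy k (tuples u I) (\<lambda>z j. \<Sum>m<u. z m ^ j))
        + N ^ r / N ^ (2 * r') * (real (n div q ^ k) ^ (2 * r') * W))"
proof -
  let ?X = "{1..int n}" and ?B = "tuples u I" and ?U = "\<lambda>z j. \<Sum>m<u. (z m :: int) ^ j" and ?Q = "int q ^ k"
  let ?H = "n div q ^ k"
  \<comment> \<open>Setting \<delta> to 0 off the congruent pairs and off the range of indices makes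
    it antisymmetric everywhere, which an inexact \<open>div\<close> would not be.\<close>
  define \<delta> where "\<delta> = (\<lambda>x y j. if ?Q dvd x - y \<and> j \<in> {1..k} then (poly (\<Phi> j) x - poly (\<Phi> j) y) div int q ^ j else 0)"
  have fin: "finite ?X" "finite ?B" using assms(1) by (auto intro!: finite_PiE)
  have Q0: "?Q > 0" using assms(4) by simp
  have anti: "\<delta> y x j = - \<delta> x y j" for x y j
  proof (cases "?Q dvd x - y \<and> j \<in> {1..k}")
    case True
    hence "?Q dvd poly (\<Phi> j) x - poly (\<Phi> j) y" by (intro poly_diff_dvd) auto
    moreover have "int q ^ j dvd ?Q" using True by (intro le_imp_power_dvd) auto
    ultimately have "int q ^ j dvd poly (\<Phi> j) x - poly (\<Phi> j) y" by (rule dvd_trans[rotated])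
    hence "(- (poly (\<Phi> j) x - poly (\<Phi> j) y)) div int q ^ j = - ((poly (\<Phi> j) x - poly (\<Phi> j) y) div int q ^ j)"
      by (rule dvd_neg_div)
    moreover have "?Q dvd y - x" using True by (simp add: dvd_diff_commute)
    ultimately show ?thesis using True by (simp add: \<delta>_def)
  next
    case False
    thus ?thesis by (auto simp: \<delta>_def dvd_diff_commute)
  qed
  have d0: "\<delta> x x j = 0" for x j by (simp add: \<delta>_def)
  have H: "(x - y) div ?Q \<le> int ?H" if "x \<in> ?X" "y \<in> ?X" "y < x" for x y
  proof -
    have "(x - y) div ?Q \<le> int n div ?Q" using that Q0 by (intro zdiv_mono1) auto
    thus ?thesis by (simp add: zdiv_int)
  qed
  have eq: "lifted_solutions k q r u \<Phi> ?X I = {((x, z), (y, w)) \<in> (tuples r ?X \<times> ?B) \<times> (tuples r ?X \<times> ?B).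
           (\<forall>i<r. ?Q dvd x i - y i) \<and> (\<forall>j\<in>{1..k}. (\<Sum>i<r. \<delta> (x i) (y i) j) + ?U z j - ?U w j = 0)}"
  proof -
    have iff: "(\<forall>j\<in>{1..k}. (\<Sum>i<r. (poly (\<Phi> j) (x i) - poly (\<Phi> j) (y i)) div int q ^ j) + ?U z j - ?U w j = 0)
        \<longleftrightarrow> (\<forall>j\<in>{1..k}. (\<Sum>i<r. \<delta> (x i) (y i) j) + ?U z j - ?U w j = 0)"
      if "\<forall>i<r. ?Q dvd x i - y i" for x y z w
    proof (rule ball_cong[OF refl])
      fix j assume "j \<in> {1..k}"
      hence "(\<Sum>i<r. (poly (\<Phi> j) (x i) - poly (\<Phi> j) (y i)) div int q ^ j) = (\<Sum>i<r. \<delta> (x i) (y i) j)"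
        using that by (intro sum.cong) (auto simp: \<delta>_def)
      thus "((\<Sum>i<r. (poly (\<Phi> j) (x i) - poly (\<Phi> j) (y i)) div int q ^ j) + ?U z j - ?U w j = 0)
         = ((\<Sum>i<r. \<delta> (x i) (y i) j) + ?U z j - ?U w j = 0)" by simp
    qed
    show ?thesis
    proof (rule set_eqI)
      fix s :: "((nat \<Rightarrow> int) \<times> (nat \<Rightarrow> int)) \<times> ((nat \<Rightarrow> int) \<times> (nat \<Rightarrow> int))"
      obtain x z y w where s: "s = ((x, z), (y, w))" by (metis surj_pair)
      show "s \<in> lifted_solutions k q r u \<Phi> ?X I \<longleftrightarrow> s \<in> {((x, z), (y, w)) \<in> (tuples r ?X \<times> ?B) \<times> (tuples r ?X \<times> ?B).
           (\<forall>i<r. ?Q dvd x i - y i) \<and> (\<forall>j\<in>{1..k}. (\<Sum>i<r. \<delta> (x i) (y i) j) + ?U z j - ?U w j = 0)}"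
        unfolding s lifted_solutions_def mem_Collect_eq prod.case using iff[of x y z w]
        by (cases "\<forall>i<r. ?Q dvd x i - y i") (simp_all only: simp_thms)
    qed
  qed
  have E: "real (energy k (tuples r' {x \<in> ?X. x + int h * ?Q \<in> ?X} \<times> ?B)
        (\<lambda>(x, z) j. (\<Sum>i<r'. \<delta> (x i + int h * ?Q) (x i) j) + ?U z j)) \<le> W" if h: "h \<in> {1..?H}" for h
  proof -
    obtain \<Psi> where *: "\<forall>j\<in>{1..k}.
        (\<forall>x. poly (\<Psi> j) x = (poly (\<Phi> j) (x + int h * int q ^ k) - poly (\<Phi> j) x) div int q ^ j) \<and>
        degree (\<Psi> j) \<le> j - (d + 1) \<and>
        coeff (\<Psi> j) (j - (d + 1)) = int h * int q ^ (k - j) * int (j - d) * coeff (\<Phi> j) (j - d)"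
      using differenced_system[of k \<Phi> d q h, OF deg assms(4)] by blast
    have \<Psi>: "\<And>j x. j \<in> {1..k} \<Longrightarrow> poly (\<Psi> j) x = (poly (\<Phi> j) (x + int h * int q ^ k) - poly (\<Phi> j) x) div int q ^ j"
      "\<And>j. j \<in> {1..k} \<Longrightarrow> degree (\<Psi> j) \<le> j - (d + 1)"
      "\<And>j. j \<in> {1..k} \<Longrightarrow> coeff (\<Psi> j) (j - (d + 1)) = int h * int q ^ (k - j) * int (j - d) * coeff (\<Phi> j) (j - d)"
      using * by blast+
    have "\<delta> (x + int h * ?Q) x j = poly (\<Psi> j) x" if "j \<in> {1..k}" for x j
      using that \<Psi>(1)[OF that] by (simp add: \<delta>_def)
    hence "energy k (tuples r' {x \<in> ?X. x + int h * ?Q \<in> ?X} \<times> ?B) (\<lambda>(x, z) j. (\<Sum>i<r'. \<delta> (x i + int h * ?Q) (x i) j) + ?U z j)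
       = energy k (tuples r' {x \<in> ?X. x + int h * ?Q \<in> ?X} \<times> ?B) (sysval \<Psi> r' u)"
      unfolding energy_def sysval_def by (intro arg_cong[of _ _ card] Collect_cong) (auto simp: case_prod_unfold)
    also have "\<dots> \<le> energy k (tuples r' ?X \<times> ?B) (sysval \<Psi> r' u)"
      using fin by (intro energy_mono) (auto intro!: finite_cartesian_product finite_PiE)
    finally show ?thesis using W[OF h \<Psi>(2,3)] by simp
  qed
  have "real (card (lifted_solutions k q r u \<Phi> ?X I))
     \<le> 3 ^ r * (2 * N ^ r * real (energy k ?B ?U)
        + N ^ r / N ^ (2 * r') * (real ?H ^ (2 * r' - 1) *
           (\<Sum>h\<in>{1..?H}. real (energy k (tuples r' {x \<in> ?X. x + int h * ?Q \<in> ?X} \<times> ?B)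
               (\<lambda>(x, z) j. (\<Sum>i<r'. \<delta> (x i + int h * ?Q) (x i) j) + ?U z j)))))"
    unfolding eq by (rule energy_differencing[OF fin Q0 _ assms(3) d0 anti H assms(5,6)]) (use assms(2) in simp_all)
  also have "\<dots> \<le> 3 ^ r * (2 * N ^ r * real (energy k ?B ?U) + N ^ r / N ^ (2 * r') * (real ?H ^ (2 * r' - 1) * (real ?H * W)))"
  proof (intro mult_left_mono add_left_mono)
    show "(\<Sum>h\<in>{1..?H}. real (energy k (tuples r' {x \<in> ?X. x + int h * ?Q \<in> ?X} \<times> ?B)
               (\<lambda>(x, z) j. (\<Sum>i<r'. \<delta> (x i + int h * ?Q) (x i) j) + ?U z j))) \<le> real ?H * W"
      using sum_bounded_above[of "{1..?H}" _ W, OF E] by simp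
  qed (use assms(3) in auto)
  also have "real ?H ^ (2 * r' - 1) * (real ?H * W) = real ?H ^ (2 * r') * W"
    using assms(5) by (cases r') auto
  finally show ?thesis .
qed

section \<open>Nonsingularity and residue counts at each stage\<close>

definition incongruent :: "nat \<Rightarrow> nat \<Rightarrow> (nat \<Rightarrow> int) \<Rightarrow> bool" where
  "incongruent q n x \<longleftrightarrow> (\<forall>i<n. \<forall>l<n. i \<noteq> l \<longrightarrow> \<not> int q dvd x i - x l)"

lemma incongruent_cong:
  assumes "incongruent q n x" "\<And>i. i < n \<Longrightarrow> [y i = x i] (mod int q)"
  shows "incongruent q n y"
  unfolding incongruent_def
proof (intro allI impI notI)
  fix i l assume il: "i < n" "l < n" "i \<noteq> l" "int q dvd y i - y l"
  hence "[y i = y l] (mod int q)" by (simp add: cong_iff_dvd_diff)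
  hence "[x i = x l] (mod int q)" using assms(2)[OF il(1)] assms(2)[OF il(2)] by (meson cong_sym cong_trans)
  thus False using assms(1) il by (auto simp: incongruent_def cong_iff_dvd_diff)
qed

text \<open>The derivatives of \<Phi>_j for j = d+1, ..., k have degrees 0, ..., k-d-1, and their
  leading coefficients stay prime to q because j - d < q. A kernel vector therefore annihilates all
  polynomials of degree less than k - d, and k - d incongruent points allow the Vandermonde
  argument.\<close>

lemma nonsingular_stage:
  assumes "prime q" "k < q" "d \<le> k"
    and deg: "\<And>j. j \<in> {1..k} \<Longrightarrow> degree (\<Phi> j) \<le> j - d"
    and lead: "\<And>j. j \<in> {d + 1..k} \<Longrightarrow> \<not> int q dvd coeff (\<Phi> j) (j - d)"
    and inc: "incongruent q (k - d) \<xi>"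
  shows "nonsingular_mod q (k - d) {k - (k - d) + 1..k} \<Phi> \<xi>"
  unfolding nonsingular_mod_def
proof (intro allI impI)
  fix y z i
  assume y: "\<forall>i<k - d. [y i = \<xi> i] (mod int q)"
    and z: "\<forall>j\<in>{k - (k - d) + 1..k}. int q dvd (\<Sum>i<k - d. z i * poly (pderiv (\<Phi> j)) (y i))"
    and i: "i < k - d"
  have inc': "incongruent q (k - d) y" using y by (intro incongruent_cong[OF inc]) auto
  show "int q dvd z i"
  proof (rule vandermonde_mod_prime[OF assms(1) _ _ i])
    fix i l assume "i < k - d" "l < k - d" "i \<noteq> l"
    thus "\<not> int q dvd y i - y l" using inc' by (auto simp: incongruent_def)
  next
    fix p :: "int poly" assume p: "\<forall>i\<ge>k - d. coeff p i = 0"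
    show "int q dvd (\<Sum>i<k - d. z i * poly p (y i))"
    proof (rule functional_vanishes_mod_prime[where L = "\<lambda>p. \<Sum>i<k - d. z i * poly p (y i)"
          and P = "\<lambda>l. pderiv (\<Phi> (d + 1 + l))" and n = "k - d", OF assms(1) _ _ _ _ _ p])
      fix l assume l: "l < k - d"
      hence j: "d + 1 + l \<in> {1..k}" "d + 1 + l \<in> {d + 1..k}" by auto
      show "degree (pderiv (\<Phi> (d + 1 + l))) \<le> l" using deg[OF j(1)] by (simp add: degree_pderiv)
      have "coeff (pderiv (\<Phi> (d + 1 + l))) l = int (Suc l) * coeff (\<Phi> (d + 1 + l)) (Suc l)"
        by (simp add: coeff_pderiv)
      moreover have "\<not> int q dvd coeff (\<Phi> (d + 1 + l)) (Suc l)" using lead[OF j(2)] by simp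
      moreover have "\<not> int q dvd int (Suc l)" using l assms(2) by (auto simp del: of_nat_Suc dest: dvd_imp_le)
      ultimately show "\<not> int q dvd coeff (pderiv (\<Phi> (d + 1 + l))) l"
        using assms(1) by (simp add: prime_dvd_mult_iff del: of_nat_Suc)
      show "int q dvd (\<Sum>i<k - d. z i * poly (pderiv (\<Phi> (d + 1 + l))) (y i))"
        using z j assms(3) by auto
    next
      fix a b and p p' :: "int poly"
      show "(\<Sum>i<k - d. z i * poly (smult a p - smult b p') (y i))
          = a * (\<Sum>i<k - d. z i * poly p (y i)) - b * (\<Sum>i<k - d. z i * poly p' (y i))"
        by (simp add: sum_distrib_left sum_subtractf[symmetric] algebra_simps)
    qed simp
  qed
qed

text \<open>The derivative of (x - c)^j is j (x - c)^(j-1), and only j \<ge> 2 is used for the k - 1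
  variables, so each derivative contains the factor x - c. It is invertible because c, a residue of
  one of the other u variables, differs from those of the x_i.\<close>

lemma nonsingular_initial:
  assumes "prime q" "k < q" "k \<ge> 2" "incongruent q (k - 1) \<xi>"
    and c: "\<And>i. i < k - 1 \<Longrightarrow> \<not> int q dvd \<xi> i - c"
  shows "nonsingular_mod q (k - 1) {k - (k - 1) + 1..k} (translate c (monom 1)) \<xi>"
  unfolding nonsingular_mod_def
proof (intro allI impI)
  fix y z i
  assume y: "\<forall>i<k - 1. [y i = \<xi> i] (mod int q)"
    and z: "\<forall>j\<in>{k - (k - 1) + 1..k}. int q dvd (\<Sum>i<k - 1. z i * poly (pderiv (translate c (monom 1) j)) (y i))"
    and i: "i < k - 1"
  have tr: "translate c (monom 1) j = [:- c, 1:] ^ j - [:(- c) ^ j:]" for j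
  proof -
    have "poly (translate c (monom 1) j) x = poly ([:- c, 1:] ^ j - [:(- c) ^ j:]) x" for x
      using binomial_shift[of j c "x - c"] by (simp add: poly_translate poly_monom poly_power)
    thus ?thesis by (simp add: poly_eq_poly_eq_iff[symmetric] ext)
  qed
  have der: "poly (pderiv (translate c (monom 1) (Suc j))) x = int (Suc j) * (x - c) ^ j" for j x
    unfolding tr pderiv_diff pderiv_power_Suc by (simp add: pderiv_pCons poly_power)
  have inc': "incongruent q (k - 1) y" using y by (intro incongruent_cong[OF assms(4)]) auto
  have "int q dvd z i * (y i - c)"
  proof (rule vandermonde_mod_prime[OF assms(1) _ _ i])
    fix i l assume "i < k - 1" "l < k - 1" "i \<noteq> l"
    thus "\<not> int q dvd y i - y l" using inc' by (auto simp: incongruent_def)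
  next
    fix p :: "int poly" assume p: "\<forall>i\<ge>k - 1. coeff p i = 0"
    show "int q dvd (\<Sum>i<k - 1. z i * (y i - c) * poly p (y i))"
    proof (rule functional_vanishes_mod_prime[where L = "\<lambda>p. \<Sum>i<k - 1. z i * (y i - c) * poly p (y i)"
          and P = "\<lambda>l. smult (int (Suc (Suc l))) ([:- c, 1:] ^ l)" and n = "k - 1", OF assms(1) _ _ _ _ _ p])
      fix l assume l: "l < k - 1"
      have "degree ([:- c, 1:] ^ l) = l" by (simp add: degree_power_eq)
      thus "degree (smult (int (Suc (Suc l))) ([:- c, 1:] ^ l)) \<le> l"
        using degree_smult_le[of "int (Suc (Suc l))" "[:- c, 1:] ^ l"] by simp
      have "coeff ([:- c, 1:] ^ l) l = 1"
        using \<open>degree ([:- c, 1:] ^ l) = l\<close> lead_coeff_power[of "[:- c, 1:]" l] by simp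
      moreover have "\<not> int q dvd int (Suc (Suc l))" using l assms(2) by (auto simp del: of_nat_Suc dest: dvd_imp_le)
      ultimately show "\<not> int q dvd coeff (smult (int (Suc (Suc l))) ([:- c, 1:] ^ l)) l"
        by (simp del: of_nat_Suc)
      have "Suc (Suc l) \<in> {k - (k - 1) + 1..k}" using l by auto
      hence "int q dvd (\<Sum>i<k - 1. z i * poly (pderiv (translate c (monom 1) (Suc (Suc l)))) (y i))" using z by blast
      also have "(\<Sum>i<k - 1. z i * poly (pderiv (translate c (monom 1) (Suc (Suc l)))) (y i))
         = (\<Sum>i<k - 1. z i * (y i - c) * poly (smult (int (Suc (Suc l))) ([:- c, 1:] ^ l)) (y i))"
        unfolding der by (intro sum.cong refl) (simp add: poly_power algebra_simps)
      finally show "int q dvd \<dots>" .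
    next
      fix a b and p p' :: "int poly"
      show "(\<Sum>i<k - 1. z i * (y i - c) * poly (smult a p - smult b p') (y i))
          = a * (\<Sum>i<k - 1. z i * (y i - c) * poly p (y i)) - b * (\<Sum>i<k - 1. z i * (y i - c) * poly p' (y i))"
        by (simp add: sum_distrib_left sum_subtractf[symmetric] algebra_simps)
    qed simp
  qed
  moreover have "\<not> int q dvd y i - c"
  proof
    assume "int q dvd y i - c"
    hence "[y i = c] (mod int q)" by (simp add: cong_iff_dvd_diff)
    hence "[\<xi> i = c] (mod int q)" using y i by (meson cong_sym cong_trans)
    thus False using c[OF i] by (simp add: cong_iff_dvd_diff)
  qed
  ultimately show "int q dvd z i" using assms(1) by (simp add: prime_dvd_mult_iff)
qed

text \<open>For j \<le> d the polynomial \<Psi>_j is constant, so these d equations constrain \<eta>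
  alone and save q^d. With \<eta> fixed, the other equations together with the constant polynomial 1
  determine the power sums of \<xi> up to order k - d, which leaves boundedly many \<xi>.\<close>

lemma card_stage_residues_le:
  fixes \<Psi> :: "nat \<Rightarrow> int poly"
  assumes "prime q" "k < q" "d \<le> k" "d \<le> u"
    and deg: "\<And>j. j \<in> {1..k} \<Longrightarrow> degree (\<Psi> j) \<le> j - d"
    and lead: "\<And>j. j \<in> {d + 1..k} \<Longrightarrow> \<not> int q dvd coeff (\<Psi> j) (j - d)"
  shows "card {\<gamma>' \<in> tuples (k - d) {0..<int q} \<times> tuples u {0..<int q}.
        \<forall>j\<in>{1..k}. [sysval \<Psi> (k - d) u \<gamma> j = sysval \<Psi> (k - d) u \<gamma>' j] (mod int q)}
      \<le> q ^ (u - d) * d ^ d * (k - d) ^ (k - d)"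
    (is "card ?S \<le> _")
proof -
  let ?r = "k - d"
  obtain \<xi>0 \<eta>0 where \<gamma>: "\<gamma> = (\<xi>0, \<eta>0)" by (metis surj_pair)
  let ?T = "{\<eta> \<in> tuples u {0..<int q}. \<forall>j\<in>{1..d}. [(\<Sum>m<u. \<eta> m ^ j) = (\<Sum>m<u. \<eta>0 m ^ j)] (mod int q)}"
  have fin: "finite (tuples ?r {0..<int q})" "finite (tuples u {0..<int q})" by (auto intro!: finite_PiE)
  have finS: "finite ?S" using fin by (intro finite_Collect_mem finite_cartesian_product)
  have const: "poly (\<Psi> j) x = coeff (\<Psi> j) 0" if "j \<in> {1..d}" for j x
  proof -
    have "degree (\<Psi> j) = 0" using deg[of j] that assms(3) by auto
    then obtain a where "\<Psi> j = [:a:]" by (metis degree_eq_zeroE)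
    thus ?thesis by simp
  qed
  have "card ?S \<le> card ?T * ?r ^ ?r"
  proof (rule card_fibres_le[where f = snd])
    show "finite ?S" by (rule finS)
    show "finite ?T" using fin by (intro finite_Collect_mem)
    show "snd ` ?S \<subseteq> ?T"
    proof
      fix \<eta> assume "\<eta> \<in> snd ` ?S"
      then obtain \<xi> where s: "(\<xi>, \<eta>) \<in> ?S" by force
      have "[(\<Sum>m<u. \<eta> m ^ j) = (\<Sum>m<u. \<eta>0 m ^ j)] (mod int q)" if j: "j \<in> {1..d}" for j
      proof -
        have "[sysval \<Psi> ?r u \<gamma> j = sysval \<Psi> ?r u (\<xi>, \<eta>) j] (mod int q)" using s j assms(3) by auto
        thus ?thesis using const[OF j] by (simp add: \<gamma> sysval_Pair cong_add_lcancel cong_sym_eq)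
      qed
      thus "\<eta> \<in> ?T" using s by auto
    qed
  next
    fix \<eta> assume "\<eta> \<in> ?T"
    let ?F = "{p \<in> ?S. snd p = \<eta>}"
    show "card ?F \<le> ?r ^ ?r"
    proof (cases "?F = {}")
      case False
      then obtain p where p: "p \<in> ?F" by blast
      have sp: "snd p = \<eta>" using p by (simp only: mem_Collect_eq)
      have "(fst p, snd p) \<in> ?F" unfolding prod.collapse by (rule p)
      hence "(fst p, \<eta>) \<in> ?F" unfolding sp .
      then obtain \<xi>1 where f1: "(\<xi>1, \<eta>) \<in> ?F" by blast
      have "card ?F \<le> card {\<xi> \<in> tuples ?r {0..<int q}. \<forall>j\<in>{1..?r}. [(\<Sum>i<?r. \<xi> i ^ j) = (\<Sum>i<?r. \<xi>1 i ^ j)] (mod int q)}"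
      proof (rule card_inj_on_le[where f = fst])
        show "inj_on fst ?F" by (auto simp: inj_on_def)
        show "finite {\<xi> \<in> tuples ?r {0..<int q}. \<forall>j\<in>{1..?r}. [(\<Sum>i<?r. \<xi> i ^ j) = (\<Sum>i<?r. \<xi>1 i ^ j)] (mod int q)}"
          using fin by (intro finite_Collect_mem)
        show "fst ` ?F \<subseteq> {\<xi> \<in> tuples ?r {0..<int q}. \<forall>j\<in>{1..?r}. [(\<Sum>i<?r. \<xi> i ^ j) = (\<Sum>i<?r. \<xi>1 i ^ j)] (mod int q)}"
        proof
          fix \<xi> assume "\<xi> \<in> fst ` ?F"
          then obtain p where p: "p \<in> ?F" "\<xi> = fst p" by blast
          have sp: "snd p = \<eta>" using p(1) by (simp only: mem_Collect_eq)
          have "(fst p, snd p) \<in> ?F" unfolding prod.collapse by (rule p(1))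
          hence f: "(\<xi>, \<eta>) \<in> ?F" unfolding sp p(2) .
          have eq: "int q dvd (\<Sum>i<?r. poly (\<Psi> j) (\<xi> i)) - (\<Sum>i<?r. poly (\<Psi> j) (\<xi>1 i))" if "j \<in> {1..k}" for j
          proof -
            have "[sysval \<Psi> ?r u \<gamma> j = sysval \<Psi> ?r u (\<xi>, \<eta>) j] (mod int q)"
                 "[sysval \<Psi> ?r u \<gamma> j = sysval \<Psi> ?r u (\<xi>1, \<eta>) j] (mod int q)" using f f1 that by auto
            hence "[sysval \<Psi> ?r u (\<xi>, \<eta>) j = sysval \<Psi> ?r u (\<xi>1, \<eta>) j] (mod int q)" by (meson cong_sym cong_trans)
            thus ?thesis by (simp add: sysval_Pair cong_add_rcancel cong_iff_dvd_diff)
          qed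
          have "[(\<Sum>i<?r. \<xi> i ^ j) = (\<Sum>i<?r. \<xi>1 i ^ j)] (mod int q)" if j: "j \<in> {1..?r}" for j
          proof -
            have "int q dvd (\<Sum>i<?r. poly (monom 1 j) (\<xi> i)) - (\<Sum>i<?r. poly (monom 1 j) (\<xi>1 i))"
            proof (rule functional_vanishes_mod_prime[where L = "\<lambda>p. (\<Sum>i<?r. poly p (\<xi> i)) - (\<Sum>i<?r. poly p (\<xi>1 i))"
                  and P = "\<lambda>l. if l = 0 then 1 else \<Psi> (d + l)" and n = "?r + 1", OF assms(1)])
              fix l assume l: "l < ?r + 1"
              show "degree (if l = 0 then 1 else \<Psi> (d + l)) \<le> l" using deg[of "d + l"] l by auto
              show "\<not> int q dvd coeff (if l = 0 then 1 else \<Psi> (d + l)) l"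
                using lead[of "d + l"] l prime_gt_1_nat[OF assms(1)] by auto
              show "int q dvd (\<Sum>i<?r. poly (if l = 0 then 1 else \<Psi> (d + l)) (\<xi> i)) - (\<Sum>i<?r. poly (if l = 0 then 1 else \<Psi> (d + l)) (\<xi>1 i))"
                using eq[of "d + l"] l by auto
            next
              fix a b and p p' :: "int poly"
              show "(\<Sum>i<?r. poly (smult a p - smult b p') (\<xi> i)) - (\<Sum>i<?r. poly (smult a p - smult b p') (\<xi>1 i))
                = a * ((\<Sum>i<?r. poly p (\<xi> i)) - (\<Sum>i<?r. poly p (\<xi>1 i))) - b * ((\<Sum>i<?r. poly p' (\<xi> i)) - (\<Sum>i<?r. poly p' (\<xi>1 i)))"
                by (simp add: sum_distrib_left sum_subtractf algebra_simps)
            next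
              show "\<forall>i\<ge>?r + 1. coeff (monom (1::int) j) i = 0" using j by auto
            qed simp
            thus ?thesis by (simp add: poly_monom cong_iff_dvd_diff)
          qed
          thus "\<xi> \<in> {\<xi> \<in> tuples ?r {0..<int q}. \<forall>j\<in>{1..?r}. [(\<Sum>i<?r. \<xi> i ^ j) = (\<Sum>i<?r. \<xi>1 i ^ j)] (mod int q)}"
            using f by auto
        qed
      qed
      also have "\<dots> \<le> q ^ (?r - ?r) * ?r ^ ?r" using assms by (intro card_power_sums_le) auto
      finally show ?thesis by simp
    next
      case True
      hence "card ?F = 0" by (simp only: card.empty)
      thus ?thesis by simp
    qed
  qed
  also have "\<dots> \<le> (q ^ (u - d) * d ^ d) * ?r ^ ?r"
    using assms by (intro mult_right_mono card_power_sums_le) auto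
  finally show ?thesis .
qed

lemma fibre_interval_eq:
  assumes "q > 0"
  shows "\<exists>a' n'. fibre_interval q {a<..a + int m} c = {a'<..a' + int n'} \<and> real n' \<le> real m / real q + 1"
proof -
  define a' where "a' = (a - c) div int q"
  define b' where "b' = (a + int m - c) div int q"
  have q: "int q > 0" using assms by simp
  have le: "a' \<le> b'" unfolding a'_def b'_def using q by (intro zdiv_mono1) auto
  have lower: "int q * (A div int q) \<le> A" for A
    using mult_div_mod_eq[of "int q" A] pos_mod_sign[OF q, of A] by linarith
  have upper: "A < int q * (A div int q + 1)" for A
    using mult_div_mod_eq[of "int q" A] pos_mod_bound[OF q, of A] by (simp only: distrib_left)
  have lt: "a' < z \<longleftrightarrow> a < c + int q * z" for z
  proof
    assume "a' < z"
    hence "int q * (a' + 1) \<le> int q * z" using q by (intro mult_left_mono) auto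
    thus "a < c + int q * z" using upper[of "a - c"] by (simp add: a'_def)
  next
    assume *: "a < c + int q * z"
    show "a' < z"
    proof (rule ccontr)
      assume "\<not> a' < z"
      hence "int q * z \<le> int q * a'" using q by (intro mult_left_mono) auto
      thus False using * lower[of "a - c"] by (simp add: a'_def)
    qed
  qed
  have ge: "z \<le> b' \<longleftrightarrow> c + int q * z \<le> a + int m" for z
  proof
    assume "z \<le> b'"
    hence "int q * z \<le> int q * b'" using q by (intro mult_left_mono) auto
    thus "c + int q * z \<le> a + int m" using lower[of "a + int m - c"] by (simp add: b'_def)
  next
    assume *: "c + int q * z \<le> a + int m"
    show "z \<le> b'"
    proof (rule ccontr)
      assume "\<not> z \<le> b'"
      hence "int q * (b' + 1) \<le> int q * z" using q by (intro mult_left_mono) auto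
      thus False using * upper[of "a + int m - c"] by (simp add: b'_def)
    qed
  qed
  have "fibre_interval q {a<..a + int m} c = {a'<..a' + int (nat (b' - a'))}"
    using le by (auto simp: fibre_interval_def lt ge)
  moreover have "real (nat (b' - a')) \<le> real m / real q + 1"
  proof -
    have "real_of_int b' \<le> (real_of_int a + real m - real_of_int c) / real q"
      using real_of_int_div4[of "a + int m - c" "int q"] by (simp add: b'_def)
    moreover have "(real_of_int a - real_of_int c) / real q \<le> real_of_int a' + 1"
      using real_of_int_div2[of "a - c" "int q"] real_of_int_div3[of "a - c" "int q"] by (simp add: a'_def)
    moreover have "(real_of_int a + real m - real_of_int c) / real q = (real_of_int a - real_of_int c) / real q + real m / real q"
      by (simp add: add_divide_distrib diff_divide_distrib)
    ultimately show ?thesis using le by simp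
  qed
  ultimately show ?thesis by blast
qed

text \<open>One complete pass at a fixed prime. The initial step, the later stages and
  \<open>energy_reduce\<close> differ only in \<Gamma>, D and the system. \<open>JL\<close> bounds
  the mean value that accompanies the diagonal terms, W the terms with h \<ge> 1.\<close>

lemma energy_at_prime:
  fixes \<Gamma> :: "((nat \<Rightarrow> int) \<times> (nat \<Rightarrow> int)) set" and N W JL :: real
  assumes q: "prime q" and k: "k \<ge> 1" "r \<le> k" "u > 0"
    and N: "real n \<le> N" "N > 0" and r': "r' > 0" "r \<le> 2 * r'" and W0: "W \<ge> 0"
    and A: "\<And>x z. (x, z) \<in> A \<Longrightarrow> x \<in> tuples r {1..int n} \<and> z \<in> tuples u {a<..a + int m} \<and>
        (residues_of q r x, residues_of q u z) \<in> \<Gamma>"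
    and deg: "\<And>\<gamma>. \<gamma> \<in> \<Gamma> \<Longrightarrow> card {\<gamma>' \<in> tuples r {0..<int q} \<times> tuples u {0..<int q}.
        \<gamma>' \<in> \<Gamma> \<and> (\<forall>j\<in>{1..k}. [sysval \<Psi> r u \<gamma> j = sysval \<Psi> r u \<gamma>' j] (mod int q))} \<le> D"
    and ns: "\<And>\<xi> \<eta> m. (\<xi>, \<eta>) \<in> \<Gamma> \<Longrightarrow> m < u \<Longrightarrow> nonsingular_mod q r {k - r + 1..k} (translate (\<eta> m) \<Psi>) \<xi>"
    and degree: "\<And>j. j \<in> {1..k} \<Longrightarrow> degree (\<Psi> j) \<le> j - d"
    and JL: "\<And>a' n'. real n' \<le> real m / real q + 1 \<Longrightarrow>
        real (energy k (tuples u {a'<..a' + int n'}) (\<lambda>z j. \<Sum>m<u. z m ^ j)) \<le> JL"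
    and W: "\<And>h \<Psi>' a' n'. h \<in> {1..n div q ^ k} \<Longrightarrow> (\<And>j. j \<in> {1..k} \<Longrightarrow> degree (\<Psi>' j) \<le> j - (d + 1)) \<Longrightarrow>
       (\<And>j. j \<in> {1..k} \<Longrightarrow> coeff (\<Psi>' j) (j - (d + 1)) = int h * int q ^ (k - j) * int (j - d) * coeff (\<Psi> j) (j - d)) \<Longrightarrow>
       real n' \<le> real m / real q + 1 \<Longrightarrow>
       real (energy k (tuples r' {1..int n} \<times> tuples u {a'<..a' + int n'}) (sysval \<Psi>' r' u)) \<le> W"
  shows "real (energy k A (sysval \<Psi> r u)) \<le> real D * (real q ^ u * (real u * (real q ^ (\<Sum>j=k-r+1..k. k - j) *
     (3 ^ r * (2 * N ^ r * JL + N ^ r / N ^ (2 * r') * (real (n div q ^ k) ^ (2 * r') * W))))))"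
proof -
  let ?X = "{1..int n}" and ?Z = "{a<..a + int m}"
  let ?b = "3 ^ r * (2 * N ^ r * JL + N ^ r / N ^ (2 * r') * (real (n div q ^ k) ^ (2 * r') * W))"
  have q0: "q > 0" using q by (rule prime_gt_0_nat)
  have lift: "real (card (lifted_solutions k q r u (translate c \<Psi>) ?X (fibre_interval q ?Z c))) \<le> ?b" for c
  proof -
    obtain a' n' where I: "fibre_interval q ?Z c = {a'<..a' + int n'}" "real n' \<le> real m / real q + 1"
      using fibre_interval_eq[OF q0] by blast
    have cf: "int (j - d) * coeff (translate c \<Psi> j) (j - d) = int (j - d) * coeff (\<Psi> j) (j - d)" if "j \<in> {1..k}" for j
      using coeff_translate[of k \<Psi> d j c, OF degree that] by (cases "d < j") auto
    have "real (card (lifted_solutions k q r u (translate c \<Psi>) ?X {a'<..a' + int n'}))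
      \<le> 3 ^ r * (2 * N ^ r * real (energy k (tuples u {a'<..a' + int n'}) (\<lambda>z j. \<Sum>m<u. z m ^ j))
        + N ^ r / N ^ (2 * r') * (real (n div q ^ k) ^ (2 * r') * W))"
    proof (rule card_lifted_solutions_le[OF _ N q0 r' W0, where d = d])
      fix j assume "j \<in> {1..k}"
      thus "degree (translate c \<Psi> j) \<le> j - d" by (intro degree_translate degree)
    next
      fix h \<Psi>' assume h: "h \<in> {1..n div q ^ k}" and 1: "\<And>j. j \<in> {1..k} \<Longrightarrow> degree (\<Psi>' j) \<le> j - (d + 1)"
        and 2: "\<And>j. j \<in> {1..k} \<Longrightarrow> coeff (\<Psi>' j) (j - (d + 1)) = int h * int q ^ (k - j) * int (j - d) * coeff (translate c \<Psi> j) (j - d)"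
      show "real (energy k (tuples r' ?X \<times> tuples u {a'<..a' + int n'}) (sysval \<Psi>' r' u)) \<le> W"
      proof (rule W[OF h 1 _ I(2)])
        fix j assume j: "j \<in> {1..k}"
        show "coeff (\<Psi>' j) (j - (d + 1)) = int h * int q ^ (k - j) * int (j - d) * coeff (\<Psi> j) (j - d)"
          using 2[OF j] cf[OF j] by (simp only: mult.assoc)
      qed
    qed simp
    also have "\<dots> \<le> ?b"
      using JL[OF I(2)] N by (intro mult_left_mono add_right_mono) auto
    finally show ?thesis by (simp add: I(1))
  qed
  define t where "t = nat \<lfloor>?b\<rfloor>"
  have b0: "?b \<ge> 0" using lift[of 0] by linarith
  have t: "real t \<le> ?b" using b0 by (simp add: t_def)
  have "energy k A (sysval \<Psi> r u) \<le> D * (q ^ u * (u * (q ^ (\<Sum>j=k-r+1..k. k - j) * t)))"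
  proof (rule energy_mixing_lifting[where X = ?X and Z = ?Z and \<Gamma> = \<Gamma> and A = A and \<Psi> = \<Psi> and D = D
        and t = t and q = q and r = r and u = u and k = k, OF _ _ q k A deg])
    fix \<xi> \<eta> m' assume "(\<xi>, \<eta>) \<in> \<Gamma>" "m' < u"
    thus "nonsingular_mod q r {k - r + 1..k} (translate (\<eta> m') \<Psi>) \<xi>" by (rule ns)
  next
    fix c
    show "card (lifted_solutions k q r u (translate c \<Psi>) ?X (fibre_interval q ?Z c)) \<le> t"
      using lift[of c] unfolding t_def by (simp add: le_nat_floor)
  qed auto
  hence "real (energy k A (sysval \<Psi> r u)) \<le> real (D * (q ^ u * (u * (q ^ (\<Sum>j=k-r+1..k. k - j) * t))))"
    by (simp only: of_nat_le_iff)
  also have "\<dots> = real D * (real q ^ u * (real u * (real q ^ (\<Sum>j=k-r+1..k. k - j) * real t)))"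
    by simp
  also have "\<dots> \<le> real D * (real q ^ u * (real u * (real q ^ (\<Sum>j=k-r+1..k. k - j) * ?b)))"
    by (intro mult_left_mono t) auto
  finally show ?thesis .
qed

section \<open>Choosing a prime for each pair of solutions\<close>

lemma energy_inj_le:
  assumes "finite B" "inj_on f A" "f ` A \<subseteq> B" "\<And>x j. x \<in> A \<Longrightarrow> j \<in> {1..k} \<Longrightarrow> V x j = V' (f x) j"
  shows "energy k A V \<le> energy k B V'"
  unfolding energy_def
proof (rule card_inj_on_le[where f = "map_prod f f"])
  show "inj_on (map_prod f f) {(x, y) \<in> A \<times> A. \<forall>j\<in>{1..k}. V x j = V y j}"
    using assms(2) by (auto simp: inj_on_def)
  show "map_prod f f ` {(x, y) \<in> A \<times> A. \<forall>j\<in>{1..k}. V x j = V y j} \<subseteq> {(x, y) \<in> B \<times> B. \<forall>j\<in>{1..k}. V' x j = V' y j}"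
    using assms(3,4) by auto
  show "finite {(x, y) \<in> B \<times> B. \<forall>j\<in>{1..k}. V' x j = V' y j}"
    by (rule finite_subset[of _ "B \<times> B"]) (use assms(1) in auto)
qed

text \<open>Both sides of a solution must be good for the same q, because the energy of
  \<open>A' q\<close> counts only pairs inside \<open>A' q\<close>. Hence the integers to be avoided
  come from x and y together.\<close>

lemma energy_cover:
  assumes "finite S" "\<And>q. q \<in> S \<Longrightarrow> finite (A' q)"
    and "\<And>x y. x \<in> A \<Longrightarrow> y \<in> A \<Longrightarrow> \<exists>q\<in>S. x \<in> A' q \<and> y \<in> A' q"
  shows "energy k A V \<le> (\<Sum>q\<in>S. energy k (A' q) V)"
proof -
  have "{(x, y) \<in> A \<times> A. \<forall>j\<in>{1..k}. V x j = V y j} \<subseteq> (\<Union>q\<in>S. {(x, y) \<in> A' q \<times> A' q. \<forall>j\<in>{1..k}. V x j = V y j})"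
    using assms(3) by blast
  moreover have "finite (\<Union>q\<in>S. {(x, y) \<in> A' q \<times> A' q. \<forall>j\<in>{1..k}. V x j = V y j})"
    using assms(1,2) by (auto intro: finite_subset[of _ "A' q \<times> A' q" for q])
  ultimately have "energy k A V \<le> card (\<Union>q\<in>S. {(x, y) \<in> A' q \<times> A' q. \<forall>j\<in>{1..k}. V x j = V y j})"
    unfolding energy_def by (intro card_mono) auto
  also have "\<dots> \<le> (\<Sum>q\<in>S. energy k (A' q) V)" unfolding energy_def by (rule card_UN_le[OF assms(1)])
  finally show ?thesis .
qed

text \<open>If all primes of S divided D, so would their product, which is at least Y^(card S). When
  |D| is at most a power of P and Y is a positive power of P times a constant above 1, the required
  size of S can be fixed independently of P.\<close>

lemma exists_prime_not_dvd:
  fixes D :: int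
  assumes "finite S" "\<And>q. q \<in> S \<Longrightarrow> prime q \<and> Y < real q" "Y \<ge> 0" "D \<noteq> 0" "of_int \<bar>D\<bar> < Y ^ card S"
  shows "\<exists>q\<in>S. \<not> int q dvd D"
proof (rule ccontr)
  assume "\<not> (\<exists>q\<in>S. \<not> int q dvd D)"
  hence dv: "int q dvd D" if "q \<in> S" for q using that by blast
  have "\<Prod>S dvd nat \<bar>D\<bar>"
  proof (rule prod_primes_dvd[OF assms(1)])
    fix p assume "p \<in> S"
    show "prime p" using assms(2)[OF \<open>p \<in> S\<close>] by blast
    show "p dvd nat \<bar>D\<bar>" using dv[OF \<open>p \<in> S\<close>] by (simp add: int_dvd_int_iff[symmetric] del: int_dvd_int_iff)
  qed
  hence "\<Prod>S \<le> nat \<bar>D\<bar>" using assms(4) by (intro dvd_imp_le) auto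
  hence "real (\<Prod>S) \<le> of_int \<bar>D\<bar>" by linarith
  moreover have "(\<Prod>q\<in>S. Y) \<le> (\<Prod>q\<in>S. real q)"
    using assms(2,3) by (intro prod_mono) (auto simp: less_imp_le)
  hence "Y ^ card S \<le> real (\<Prod>S)" by simp
  ultimately show False using assms(5) by linarith
qed

definition pair_differences :: "nat \<Rightarrow> (nat \<Rightarrow> int) \<Rightarrow> int" where
  "pair_differences n x = (\<Prod>(i, l)\<in>{(i, l). i < n \<and> l < n \<and> i \<noteq> l}. x i - x l)"

lemma finite_index_pairs: "finite {(i, l). i < n \<and> l < n \<and> i \<noteq> (l::nat)}"
  by (rule finite_subset[of _ "{..<n} \<times> {..<n}"]) auto

lemma pair_differences_nonzero: "inj_on x {..<n} \<Longrightarrow> pair_differences n x \<noteq> 0"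
  unfolding pair_differences_def using finite_index_pairs by (auto simp: inj_on_def)

lemma incongruent_if_not_dvd: "\<not> int q dvd pair_differences n x \<Longrightarrow> incongruent q n x"
  unfolding incongruent_def
proof (intro allI impI notI)
  fix i l assume nd: "\<not> int q dvd pair_differences n x" and il: "i < n" "l < n" "i \<noteq> l" "int q dvd x i - x l"
  have "x i - x l dvd pair_differences n x"
    unfolding pair_differences_def
    using dvd_prodI[OF finite_index_pairs, of "(i, l)" n "\<lambda>(i, l). x i - x l"] il by simp
  thus False using il nd dvd_trans by blast
qed

lemma pair_differences_le:
  assumes "x \<in> tuples n {1..int N}" "real N \<le> P" "P \<ge> 1"
  shows "of_int \<bar>pair_differences n x\<bar> \<le> P ^ (n ^ 2)"
proof -
  let ?I = "{(i, l). i < n \<and> l < n \<and> i \<noteq> l}"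
  have "of_int \<bar>pair_differences n x\<bar> = (\<Prod>p\<in>?I. of_int \<bar>x (fst p) - x (snd p)\<bar> :: real)"
    by (simp add: pair_differences_def abs_prod case_prod_unfold)
  also have "\<dots> \<le> (\<Prod>p\<in>?I. P)"
  proof (rule prod_mono, clarify, goal_cases)
    case (1 i l)
    hence "x i \<in> {1..int N}" "x l \<in> {1..int N}" using assms(1) by (auto simp: PiE_iff)
    hence "\<bar>x i - x l\<bar> \<le> int N" by auto
    hence "of_int \<bar>x i - x l\<bar> \<le> real N" by linarith
    thus ?case using assms(2) by simp
  qed
  also have "\<dots> = P ^ card ?I" by simp
  also have "\<dots> \<le> P ^ (n ^ 2)"
  proof (rule power_increasing)
    have "card ?I \<le> card ({..<n} \<times> {..<n})" by (intro card_mono) auto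
    thus "card ?I \<le> n ^ 2" by (simp add: power2_eq_square)
  qed (use assms in auto)
  finally show ?thesis .
qed

lemma incongruent_residues_of:
  assumes "q > 0"
  shows "incongruent q n (residues_of q n x) \<longleftrightarrow> incongruent q n x"
proof -
  have "[residues_of q n x i = x i] (mod int q)" if "i < n" for i
    using that by (simp add: residues_of_def cong_def)
  thus ?thesis using incongruent_cong[of q n x "residues_of q n x"]
    incongruent_cong[of q n "residues_of q n x" x] by (auto intro: cong_sym)
qed

lemma triangular_exponent:
  assumes "r \<le> k"
  shows "real (\<Sum>j=k-r+1..k. k - j) = real r * (real r - 1) / 2"
proof -
  have "(\<Sum>j=k-r+1..k. k - j) = (\<Sum>i<r. i)"
    using assms by (intro sum.reindex_bij_witness[of _ "\<lambda>i. k - i" "\<lambda>j. k - j"]) auto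
  moreover have "real (\<Sum>i<r. i) = real r * (real r - 1) / 2"
    by (induction r) (auto simp: field_simps)
  ultimately show ?thesis by simp
qed

section \<open>One stage of differencing\<close>

text \<open>Exponents of both signs occur, so the constant has to cover the increasing and the
  decreasing case.\<close>

lemma powr_le_max:
  fixes x y c p :: real
  assumes "0 < y" "y \<le> x" "x \<le> c * y"
  shows "x powr p \<le> max 1 (c powr p) * y powr p"
proof (cases "p \<ge> 0")
  case True
  have c: "c > 0" using assms by (metis dual_order.strict_trans1 zero_less_mult_pos2)
  have "x powr p \<le> (c * y) powr p" using assms True by (intro powr_mono2) auto
  also have "\<dots> = c powr p * y powr p" using c assms by (simp add: powr_mult)
  also have "\<dots> \<le> max 1 (c powr p) * y powr p" by (intro mult_right_mono) auto
  finally show ?thesis .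
next
  case False
  have "x powr p \<le> 1 * y powr p" using assms False by (simp add: powr_mono2')
  also have "\<dots> \<le> max 1 (c powr p) * y powr p" by (intro mult_right_mono) auto
  finally show ?thesis .
qed

text \<open>Replaces q by P^\<phi> and Q/q + 1 by Q/q up to constants. The rounding term 1 is
  harmless because Q/q is bounded below by 1/c.\<close>

lemma scale_bound:
  fixes P Q c C \<phi> lam :: real
  assumes "P \<ge> 1" "Q > 0" "P powr \<phi> \<le> real q" "real q \<le> C * P powr \<phi>" "1 \<le> c * (Q / real q)" "q > 0"
  shows "real q ^ M * (Q / real q + 1) powr lam
    \<le> max 1 ((1 + c) powr lam) * max 1 (C powr (real M - lam)) * (P powr (\<phi> * (real M - lam)) * Q powr lam)"
proof -
  have "(Q / real q + 1) powr lam \<le> max 1 ((1 + c) powr lam) * (Q / real q) powr lam"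
  proof (rule powr_le_max)
    have "(1 + c) * (Q / real q) = Q / real q + c * (Q / real q)" by (simp only: distrib_right mult_1)
    thus "Q / real q + 1 \<le> (1 + c) * (Q / real q)" using assms(5) by linarith
  qed (use assms in auto)
  hence "real q ^ M * (Q / real q + 1) powr lam \<le> real q ^ M * (max 1 ((1 + c) powr lam) * (Q / real q) powr lam)"
    by (intro mult_left_mono) auto
  also have "\<dots> = max 1 ((1 + c) powr lam) * (real q powr (real M - lam) * Q powr lam)"
    using assms by (simp add: powr_divide powr_diff powr_realpow)
  also have "real q powr (real M - lam) \<le> max 1 (C powr (real M - lam)) * (P powr \<phi>) powr (real M - lam)"
    using assms by (intro powr_le_max) auto
  also have "(P powr \<phi>) powr (real M - lam) = P powr (\<phi> * (real M - lam))" by (simp add: powr_powr)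
  finally show ?thesis by (simp add: mult_ac mult_left_mono mult_right_mono)
qed

section \<open>The stages under a given mean value bound\<close>

text \<open>The bound is assumed for intervals in any position, because passing to a residue class
  moves them; translation invariance will supply it.\<close>

locale mean_value_bound =
  fixes k u :: nat and lam CJ :: real
  assumes k2: "2 \<le> k" and ku: "k \<le> u" and CJ: "CJ > 0"
    and J: "\<And>a n L. L \<ge> 1 \<Longrightarrow> real n \<le> L \<Longrightarrow>
      real (energy k (tuples u {a<..a + int n}) (\<lambda>z j. \<Sum>m<u. z m ^ j)) \<le> CJ * L powr lam"
begin

text \<open>The exponent of q after one stage: u - d from the residues, u from the choice of \<eta>,
  r(r-1)/2 with r = k - d from the lifting, and -lam because the mean value is taken at length about
  Q/q. It may be negative.\<close>

definition expo :: "nat \<Rightarrow> real" where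
  "expo d = 2 * real u - real d + real (k - d) * (real (k - d) - 1) / 2 - lam"

text \<open>The bound that one stage of the differencing process is expected to yield when its prime is
  of size \<open>P\<^sup>\<phi>\<close>. At stage \<open>d\<close> the polynomial of index \<open>j\<close> has degree \<open>j - d\<close>, and for \<open>j \<le> d\<close> it is
  constant and drops out of the equations.\<close>

definition stage_bound :: "nat \<Rightarrow> real \<Rightarrow> bool" where
  "stage_bound d \<phi> \<longleftrightarrow> (\<forall>A B b. 0 \<le> A \<longrightarrow> 1 \<le> B \<longrightarrow> 0 < b \<longrightarrow> (\<exists>C>0. \<forall>P Q a m \<Psi>.
     1 \<le> P \<longrightarrow> b * P powr (real (k - d) / real k) \<le> Q \<longrightarrow> real m \<le> Q \<longrightarrow>
     (\<forall>j\<in>{1..k}. degree (\<Psi> j) \<le> j - d) \<longrightarrow>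
     (\<forall>j\<in>{d + 1..k}. coeff (\<Psi> j) (j - d) \<noteq> 0 \<and> of_int \<bar>coeff (\<Psi> j) (j - d)\<bar> \<le> B * P powr A) \<longrightarrow>
     real (energy k (tuples (k - d) {1..int (nat \<lfloor>P\<rfloor>)} \<times> tuples u {a<..a + int m}) (sysval \<Psi> (k - d) u))
       \<le> C * (P powr (real (k - d) + \<phi> * expo d) * Q powr lam)))"

text \<open>For \<phi> = 1/k the prime satisfies q^k > P and no h \<ge> 1 exists. Otherwise there
  are about P^(1 - k \<phi>) values of h, and the inequality says that with r' = k - (d+1) the next
  stage bounds their contribution by P^(2r') L^lam, the size that makes it comparable with the
  diagonal.\<close>

definition stage_ready :: "nat \<Rightarrow> real \<Rightarrow> bool" where
  "stage_ready d \<phi> \<longleftrightarrow> \<phi> = 1 / real k \<or> (\<exists>\<phi>'. d + 1 < k \<and> stage_bound (d + 1) \<phi>' \<and>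
     real (k - (d + 1)) + \<phi>' * expo (d + 1) \<le> 2 * real k * real (k - (d + 1)) * \<phi>)"

text \<open>The last inequality says that the terms with h \<ge> 1 add at most a constant times the
  diagonal ones; V stands for the size of the mean value at length L.\<close>

definition difference_bound :: "nat \<Rightarrow> real \<Rightarrow> nat \<Rightarrow> real \<Rightarrow> real \<Rightarrow> real \<Rightarrow> nat \<Rightarrow> (nat \<Rightarrow> int) \<Rightarrow> bool" where
  "difference_bound d C' r' P L V q lead \<longleftrightarrow> (\<exists>W\<ge>0. (\<forall>h \<Psi> a m. h \<in> {1..nat \<lfloor>P\<rfloor> div q ^ k} \<longrightarrow>
      (\<forall>j\<in>{1..k}. degree (\<Psi> j) \<le> j - (d + 1)) \<longrightarrow>
      (\<forall>j\<in>{1..k}. coeff (\<Psi> j) (j - (d + 1)) = int h * int q ^ (k - j) * int (j - d) * lead j) \<longrightarrow>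
      real m \<le> L \<longrightarrow>
      real (energy k (tuples r' {1..int (nat \<lfloor>P\<rfloor>)} \<times> tuples u {a<..a + int m}) (sysval \<Psi> r' u)) \<le> W) \<and>
     real (nat \<lfloor>P\<rfloor> div q ^ k) ^ (2 * r') * W \<le> C' * (P ^ (2 * r') * V))"

lemma differencing_key:
  assumes "d < k" "0 < \<phi>" "\<phi> \<le> 1 / real k" "stage_ready d \<phi>"
  shows "\<exists>r'>0. k - d \<le> 2 * r' \<and> (\<forall>A B b C. 0 \<le> A \<longrightarrow> 1 \<le> B \<longrightarrow> 0 < b \<longrightarrow> 1 \<le> C \<longrightarrow> (\<exists>C'\<ge>0. \<forall>P L q lead.
     1 \<le> P \<longrightarrow> b * P powr (real (k - (d + 1)) / real k) \<le> L \<longrightarrow> P powr \<phi> < real q \<longrightarrow> real q \<le> C * P powr \<phi> \<longrightarrow>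
     (\<forall>j\<in>{d + 1..k}. lead j \<noteq> 0 \<and> of_int \<bar>lead j\<bar> \<le> B * P powr A) \<longrightarrow>
     difference_bound d C' r' P L (L powr lam) q lead))"
  using assms(4) unfolding stage_ready_def
proof (elim disjE)
  assume \<phi>: "\<phi> = 1 / real k"
  \<comment> \<open>The range of h is empty here, so W = 0 serves, and r' = k satisfies k - d \<le>
    2r'.\<close>
  show ?thesis
  proof (intro exI[of _ k] conjI allI impI exI[of _ "0::real"], goal_cases)
    case (4 A B b C P L q lead)
    have "P = (P powr \<phi>) ^ k" using 4 k2 \<phi> by (simp add: powr_realpow[symmetric] powr_powr)
    also have "\<dots> < real q ^ k" using 4 k2 by (intro power_strict_mono) auto
    finally have "P < real (q ^ k)" by simp
    hence "nat \<lfloor>P\<rfloor> < q ^ k" using 4 by linarith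
    hence "nat \<lfloor>P\<rfloor> div q ^ k = 0" by simp
    thus ?case unfolding difference_bound_def by (intro exI[of _ 0]) auto
  qed (use k2 in auto)
next
  assume "\<exists>\<phi>'. d + 1 < k \<and> stage_bound (d + 1) \<phi>' \<and>
     real (k - (d + 1)) + \<phi>' * expo (d + 1) \<le> 2 * real k * real (k - (d + 1)) * \<phi>"
  then obtain \<phi>' where d1: "d + 1 < k" and sb: "stage_bound (d + 1) \<phi>'"
    and ineq: "real (k - (d + 1)) + \<phi>' * expo (d + 1) \<le> 2 * real k * real (k - (d + 1)) * \<phi>" by blast
  let ?r = "k - (d + 1)"
  show ?thesis
  proof (intro exI[of _ ?r] conjI allI impI)
    show "?r > 0" "k - d \<le> 2 * ?r" using d1 by auto
    fix A B b C :: real assume AB: "0 \<le> A" "1 \<le> B" "0 < b" "1 \<le> C"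
    \<comment> \<open>The new leading coefficient h q^(k-j) (j-d) times the old one is at most P *
      C^k P * k * B P^A; hence B' and the exponent A + 2.\<close>
    define B' where "B' = C ^ k * real k * B"
    have "C ^ k \<ge> 1" using AB by simp
    hence "C ^ k * real k \<ge> 1 * 1" using k2 by (intro mult_mono) auto
    hence "B' \<ge> 1 * 1" unfolding B'_def using AB by (intro mult_mono) auto
    hence B': "B' \<ge> 1" by simp
    have A2: "0 \<le> A + 2" using AB by simp
    from sb[unfolded stage_bound_def, rule_format, OF A2 B' AB(3)]
    obtain C1 where C1: "C1 > 0" "\<forall>P Q a m \<Psi>.
     1 \<le> P \<longrightarrow> b * P powr (real ?r / real k) \<le> Q \<longrightarrow> real m \<le> Q \<longrightarrow>
     (\<forall>j\<in>{1..k}. degree (\<Psi> j) \<le> j - (d + 1)) \<longrightarrow>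
     (\<forall>j\<in>{(d + 1) + 1..k}. coeff (\<Psi> j) (j - (d + 1)) \<noteq> 0 \<and> of_int \<bar>coeff (\<Psi> j) (j - (d + 1))\<bar> \<le> B' * P powr (A + 2)) \<longrightarrow>
     real (energy k (tuples ?r {1..int (nat \<lfloor>P\<rfloor>)} \<times> tuples u {a<..a + int m}) (sysval \<Psi> ?r u))
       \<le> C1 * (P powr (real ?r + \<phi>' * expo (d + 1)) * Q powr lam)" by blast
    show "\<exists>C'\<ge>0. \<forall>P L q lead. 1 \<le> P \<longrightarrow> b * P powr (real ?r / real k) \<le> L \<longrightarrow> P powr \<phi> < real q \<longrightarrow> real q \<le> C * P powr \<phi> \<longrightarrow>
     (\<forall>j\<in>{d + 1..k}. lead j \<noteq> 0 \<and> of_int \<bar>lead j\<bar> \<le> B * P powr A) \<longrightarrow>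
     difference_bound d C' ?r P L (L powr lam) q lead"
    proof (intro exI[of _ C1] conjI allI impI)
      show "C1 \<ge> 0" using C1 by simp
      fix P L :: real and q :: nat and lead :: "nat \<Rightarrow> int"
      assume P: "1 \<le> P" and L: "b * P powr (real ?r / real k) \<le> L" and q: "P powr \<phi> < real q" "real q \<le> C * P powr \<phi>"
        and lead: "\<forall>j\<in>{d + 1..k}. lead j \<noteq> 0 \<and> of_int \<bar>lead j\<bar> \<le> B * P powr A"
      let ?n = "nat \<lfloor>P\<rfloor>"
      have q0: "q > 0" using q(1) P by (metis of_nat_0_less_iff order.strict_trans1 powr_ge_zero)
      have nP: "real ?n \<le> P" using P by linarith
      have Pk: "(P powr \<phi>) ^ k = P powr (real k * \<phi>)"
        using P by (simp add: powr_realpow[symmetric] powr_powr mult.commute)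
      have k\<phi>: "real k * \<phi> \<le> 1" using assms(3) k2 by (simp add: field_simps)
      have qk: "real q ^ k \<le> C ^ k * P"
      proof -
        have "real q ^ k \<le> (C * P powr \<phi>) ^ k" using q by (intro power_mono) auto
        also have "\<dots> = C ^ k * P powr (real k * \<phi>)" by (simp add: power_mult_distrib Pk)
        also have "\<dots> \<le> C ^ k * P powr 1" using P AB k\<phi> by (intro mult_left_mono powr_mono) auto
        finally show ?thesis using P by simp
      qed
      define W where "W = C1 * (P powr (real ?r + \<phi>' * expo (d + 1)) * L powr lam)"
      show "difference_bound d C1 ?r P L (L powr lam) q lead"
        unfolding difference_bound_def
      proof (intro exI[of _ W] conjI allI impI)
        show "W \<ge> 0" using C1 by (simp add: W_def)
      next
        fix h \<Psi> a m
        assume h: "h \<in> {1..?n div q ^ k}" and deg: "\<forall>j\<in>{1..k}. degree (\<Psi> j) \<le> j - (d + 1)"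
          and cf: "\<forall>j\<in>{1..k}. coeff (\<Psi> j) (j - (d + 1)) = int h * int q ^ (k - j) * int (j - d) * lead j"
          and m: "real m \<le> L"
        have "coeff (\<Psi> j) (j - (d + 1)) \<noteq> 0 \<and> of_int \<bar>coeff (\<Psi> j) (j - (d + 1))\<bar> \<le> B' * P powr (A + 2)"
          if j: "j \<in> {(d + 1) + 1..k}" for j
        proof
          have j1: "j \<in> {1..k}" "j \<in> {d + 1..k}" using j by auto
          have c: "coeff (\<Psi> j) (j - (d + 1)) = int h * int q ^ (k - j) * int (j - d) * lead j" using cf j1 by blast
          show "coeff (\<Psi> j) (j - (d + 1)) \<noteq> 0" unfolding c using h q0 j lead j1 by auto
          have hP: "real h \<le> P"
          proof -
            have "h \<le> ?n" using h le_trans[OF _ div_le_dividend[of ?n "q ^ k"]] by auto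
            thus ?thesis using nP by linarith
          qed
          have "real q ^ (k - j) \<le> real q ^ k" using q0 by (intro power_increasing) auto
          hence qj: "real q ^ (k - j) \<le> C ^ k * P" using qk by linarith
          have "of_int \<bar>coeff (\<Psi> j) (j - (d + 1))\<bar> = real h * real q ^ (k - j) * real (j - d) * of_int \<bar>lead j\<bar>"
            unfolding c by (simp add: abs_mult)
          also have "\<dots> \<le> P * (C ^ k * P) * real k * (B * P powr A)"
            using hP qj P AB lead j1 by (intro mult_mono) auto
          also have "\<dots> = B' * (P * P * P powr A)" by (simp add: B'_def mult_ac)
          also have "P * P * P powr A = P powr (A + 2)"
            using P by (simp add: powr_add power2_eq_square)
          finally show "of_int \<bar>coeff (\<Psi> j) (j - (d + 1))\<bar> \<le> B' * P powr (A + 2)" .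
        qed
        hence cc: "\<forall>j\<in>{(d + 1) + 1..k}. coeff (\<Psi> j) (j - (d + 1)) \<noteq> 0 \<and> of_int \<bar>coeff (\<Psi> j) (j - (d + 1))\<bar> \<le> B' * P powr (A + 2)" by blast
        show "real (energy k (tuples ?r {1..int ?n} \<times> tuples u {a<..a + int m}) (sysval \<Psi> ?r u)) \<le> W"
          unfolding W_def using C1(2)[rule_format, OF P L m, of \<Psi> a] deg cc by blast
      next
        have Ppos: "0 < P powr (real k * \<phi>)" using P by simp
        have "real (?n div q ^ k) \<le> real ?n / real (q ^ k)" by (rule of_nat_div_le_of_nat)
        also have "\<dots> \<le> P / P powr (real k * \<phi>)"
        proof (rule frac_le)
          have "(P powr \<phi>) ^ k \<le> real q ^ k" using q by (intro power_mono) auto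
          thus "P powr (real k * \<phi>) \<le> real (q ^ k)" by (simp add: Pk)
        qed (use P nP Ppos in auto)
        also have "\<dots> = P powr (1 - real k * \<phi>)" using P by (simp add: powr_diff)
        finally have "real (?n div q ^ k) ^ (2 * ?r) \<le> (P powr (1 - real k * \<phi>)) ^ (2 * ?r)"
          by (intro power_mono) auto
        also have "\<dots> = P powr (real (2 * ?r) * (1 - real k * \<phi>))"
          using P by (simp add: powr_realpow[symmetric] powr_powr mult.commute)
        finally have H: "real (?n div q ^ k) ^ (2 * ?r) \<le> P powr (real (2 * ?r) * (1 - real k * \<phi>))" .
        have "real (?n div q ^ k) ^ (2 * ?r) * W \<le> P powr (real (2 * ?r) * (1 - real k * \<phi>)) * W"
          using C1 by (intro mult_right_mono H) (simp add: W_def)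
        also have "\<dots> = C1 * (P powr (real (2 * ?r) * (1 - real k * \<phi>) + (real ?r + \<phi>' * expo (d + 1))) * L powr lam)"
          by (simp add: W_def powr_add)
        also have "\<dots> \<le> C1 * (P powr (real (2 * ?r)) * L powr lam)"
        proof (intro mult_left_mono mult_right_mono powr_mono)
          show "real (2 * ?r) * (1 - real k * \<phi>) + (real ?r + \<phi>' * expo (d + 1)) \<le> real (2 * ?r)"
          proof -
            define R where "R = real ?r"
            have "real (2 * ?r) = 2 * R" by (simp only: R_def of_nat_mult of_nat_numeral)
            moreover have "2 * R * (1 - real k * \<phi>) + (R + \<phi>' * expo (d + 1)) \<le> 2 * R"
              using ineq[folded R_def] by (simp add: algebra_simps)
            ultimately show ?thesis by (simp only: R_def[symmetric])
          qed
        qed (use P C1 in auto)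
        also have "P powr (real (2 * ?r)) = P ^ (2 * ?r)" using P by (intro powr_realpow) auto
        finally show "real (?n div q ^ k) ^ (2 * ?r) * W \<le> C1 * (P ^ (2 * ?r) * L powr lam)" .
      qed
    qed
  qed
qed

text \<open>This serves the coincidence terms. They carry the mean value at length Q, whereas the
  target is P^(\<phi> expo d) Q^lam with \<open>expo d\<close> possibly negative. Reducing at the
  prime without any x-variables (d = k) yields the factor q^(2u-k), and 2u - k does not exceed the
  exponent of q at any stage d < k.\<close>

lemma energy_reduce:
  assumes "prime q" "k < q" "real m / real q + 1 \<le> L"
  shows "real (energy k (tuples u {a<..a + int m}) (\<lambda>z j. \<Sum>m<u. z m ^ j))
     \<le> 2 * real k ^ k * real u * CJ * (real q ^ (2 * u - k) * L powr lam)"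
proof -
  let ?Z = "{a<..a + int m}" and ?A = "tuples 0 {1..int 0} \<times> tuples u {a<..a + int m}"
  let ?\<Psi> = "\<lambda>_::nat. 0 :: int poly"
  have "energy k (tuples u ?Z) (\<lambda>z j. \<Sum>m<u. z m ^ j) \<le> energy k ?A (sysval ?\<Psi> 0 u)"
    by (rule energy_inj_le[where f = "\<lambda>z. (\<lambda>_. undefined, z)"])
      (auto simp: inj_on_def sysval_Pair intro!: finite_PiE)
  hence "real (energy k (tuples u ?Z) (\<lambda>z j. \<Sum>m<u. z m ^ j)) \<le> real (energy k ?A (sysval ?\<Psi> 0 u))" by simp
  also have "\<dots> \<le> real (q ^ (u - k) * k ^ k) * (real q ^ u * (real u * (real q ^ (\<Sum>j=k-0+1..k. k - j) *
     (3 ^ 0 * (2 * 1 ^ 0 * (CJ * L powr lam) + 1 ^ 0 / 1 ^ (2 * 1) * (real (0 div q ^ k) ^ (2 * 1) * 0))))))"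
  proof (rule energy_at_prime[where \<Gamma> = UNIV and d = k and W = 0 and a = a and m = m])
    fix \<gamma> :: "(nat \<Rightarrow> int) \<times> (nat \<Rightarrow> int)"
    have "card {\<gamma>' \<in> tuples 0 {0..<int q} \<times> tuples u {0..<int q}. \<gamma>' \<in> UNIV \<and>
       (\<forall>j\<in>{1..k}. [sysval ?\<Psi> 0 u \<gamma> j = sysval ?\<Psi> 0 u \<gamma>' j] (mod int q))} \<le> q ^ (u - k) * k ^ k * (k - k) ^ (k - k)"
      using card_stage_residues_le[of q k k u ?\<Psi> \<gamma>] assms ku by simp
    thus "card {\<gamma>' \<in> tuples 0 {0..<int q} \<times> tuples u {0..<int q}. \<gamma>' \<in> UNIV \<and>
       (\<forall>j\<in>{1..k}. [sysval ?\<Psi> 0 u \<gamma> j = sysval ?\<Psi> 0 u \<gamma>' j] (mod int q))} \<le> q ^ (u - k) * k ^ k" by simp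
  next
    have "L \<ge> 1" using assms(3) by (smt (verit) divide_nonneg_nonneg of_nat_0_le_iff)
    fix a' n' assume "real n' \<le> real m / real q + 1"
    hence "real n' \<le> L" using assms(3) by linarith
    thus "real (energy k (tuples u {a'<..a' + int n'}) (\<lambda>z j. \<Sum>m<u. z m ^ j)) \<le> CJ * L powr lam"
      by (intro J \<open>L \<ge> 1\<close>)
  qed (use assms(1,2) k2 ku in \<open>auto simp: nonsingular_mod_def\<close>)
  also have "\<dots> = 2 * real k ^ k * real u * CJ * ((real q ^ (u - k) * real q ^ u) * L powr lam)"
    by simp
  also have "real q ^ (u - k) * real q ^ u = real q ^ (2 * u - k)"
    using ku by (simp add: power_add[symmetric] mult_2)
  finally show ?thesis .
qed

end

context mean_value_bound
begin

lemma stage_step: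
  assumes d: "1 \<le> d" "d < k" and \<phi>: "0 < \<phi>" "\<phi> \<le> 1 / real k" and ready: "stage_ready d \<phi>"
  shows "stage_bound d \<phi>"
  unfolding stage_bound_def
proof (intro allI impI)
  fix A B b :: real assume AB: "0 \<le> A" "1 \<le> B" "0 < b"
  define r where "r = k - d"
  define w where "w = (\<Sum>j=k-r+1..k. k - j)"
  have r: "r \<ge> 1" "r \<le> k" using d by (auto simp: r_def)
  obtain r' where r': "r' > 0" "r \<le> 2 * r'" and key: "\<And>A B b C. 0 \<le> A \<Longrightarrow> 1 \<le> B \<Longrightarrow> 0 < b \<Longrightarrow> 1 \<le> C \<Longrightarrow> (\<exists>C'\<ge>0. \<forall>P L q lead.
     1 \<le> P \<longrightarrow> b * P powr (real (k - (d + 1)) / real k) \<le> L \<longrightarrow> P powr \<phi> < real q \<longrightarrow> real q \<le> C * P powr \<phi> \<longrightarrow>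
     (\<forall>j\<in>{d + 1..k}. lead j \<noteq> 0 \<and> of_int \<bar>lead j\<bar> \<le> B * P powr A) \<longrightarrow>
     difference_bound d C' r' P L (L powr lam) q lead)"
    using differencing_key[OF d(2) \<phi> ready] unfolding r_def by blast
  \<comment> \<open>The integers to be avoided multiply to at most B^k P^(kA + 2r^2), the term 2r^2
    coming from the differences on both sides. N primes above K P^\<phi> have a larger product: K >
    B^k takes care of the constant, and K > k gives q > k, as Newton's identities require.\<close>
  define N where "N = nat \<lceil>(real k * A + 2 * real (r ^ 2)) / \<phi>\<rceil> + 1"
  define K where "K = B ^ k + real k + 1"
  have Bk: "B ^ k \<ge> 1" using AB by simp
  have K: "K \<ge> 1" "K > B ^ k" "K > real k" using Bk by (auto simp: K_def)
  obtain Cp where Cp: "Cp \<ge> 1" "\<And>y. y \<ge> 1 \<Longrightarrow> \<exists>S::nat set. finite S \<and> card S = N \<and> (\<forall>p\<in>S. prime p \<and> K * y < real p \<and> real p \<le> Cp * y)"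
    using many_primes_in_dyadic_range[OF K(1), of N] by blast
  have b': "0 < b / Cp" using AB Cp by simp
  obtain C' where C': "C' \<ge> 0" "\<And>P L q lead. 1 \<le> P \<Longrightarrow> b / Cp * P powr (real (k - (d + 1)) / real k) \<le> L \<Longrightarrow> P powr \<phi> < real q \<Longrightarrow> real q \<le> Cp * P powr \<phi> \<Longrightarrow>
     (\<forall>j\<in>{d + 1..k}. lead j \<noteq> 0 \<and> of_int \<bar>lead j\<bar> \<le> B * P powr A) \<Longrightarrow>
     difference_bound d C' r' P L (L powr lam) q lead"
    using key[OF AB(1,2) b' Cp(1)] by blast
  \<comment> \<open>The condition on Q and q \<le> Cp P^(1/k) give Q/q \<ge> b/Cp, which is
    1/c.\<close>
  define c where "c = Cp / b"
  define K2 where "K2 = real (d ^ d * r ^ r) * real u * 3 ^ r * (2 * CJ + C')"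
  define K3 where "K3 = 2 * real k ^ k * real u * CJ"
  define K4 where "K4 = (4 * real r ^ 2) ^ (r + 1)"
  define G where "G = max 1 ((1 + c) powr lam) * max 1 (Cp powr expo d)"
  define C where "C = (2 * (real N * K2) + K4 * K3) * G + 1"
  have nonneg: "K2 \<ge> 0" "K3 \<ge> 0" "K4 \<ge> 0" "G \<ge> 0"
    using CJ C' by (auto simp: K2_def K3_def K4_def G_def)
  have M: "real (u - d + u + w) - lam = expo d"
    using d ku triangular_exponent[OF r(2)] unfolding expo_def w_def r_def by (simp add: of_nat_diff)
  show "\<exists>C>0. \<forall>P Q a m \<Psi>. 1 \<le> P \<longrightarrow> b * P powr (real (k - d) / real k) \<le> Q \<longrightarrow> real m \<le> Q \<longrightarrow>
     (\<forall>j\<in>{1..k}. degree (\<Psi> j) \<le> j - d) \<longrightarrow>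
     (\<forall>j\<in>{d + 1..k}. coeff (\<Psi> j) (j - d) \<noteq> 0 \<and> of_int \<bar>coeff (\<Psi> j) (j - d)\<bar> \<le> B * P powr A) \<longrightarrow>
     real (energy k (tuples (k - d) {1..int (nat \<lfloor>P\<rfloor>)} \<times> tuples u {a<..a + int m}) (sysval \<Psi> (k - d) u))
       \<le> C * (P powr (real (k - d) + \<phi> * expo d) * Q powr lam)"
  proof (intro exI[of _ C] conjI allI impI)
    show "C > 0" unfolding C_def using nonneg by (intro add_nonneg_pos mult_nonneg_nonneg add_nonneg_nonneg) auto
  next
    fix P Q :: real and a :: int and m :: nat and \<Psi> :: "nat \<Rightarrow> int poly"
    assume P: "1 \<le> P" and Q: "b * P powr (real (k - d) / real k) \<le> Q" and m: "real m \<le> Q"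
      and deg: "\<forall>j\<in>{1..k}. degree (\<Psi> j) \<le> j - d"
      and lead: "\<forall>j\<in>{d + 1..k}. coeff (\<Psi> j) (j - d) \<noteq> 0 \<and> of_int \<bar>coeff (\<Psi> j) (j - d)\<bar> \<le> B * P powr A"
    define n where "n = nat \<lfloor>P\<rfloor>"
    have nP: "real n \<le> P" using P unfolding n_def by linarith
    define y where "y = P powr \<phi>"
    have y: "y \<ge> 1" using P \<phi> by (simp add: y_def ge_one_powr_ge_zero)
    obtain S :: "nat set" where S: "finite S" "card S = N" "\<And>q. q \<in> S \<Longrightarrow> prime q \<and> K * y < real q \<and> real q \<le> Cp * y"
      using Cp(2)[OF y] by blast
    have Q0: "Q > 0" using Q AB P by (smt (verit) mult_pos_pos powr_gt_zero)
    let ?X = "{1..int n}" and ?Z = "{a<..a + int m}"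
    let ?V = "sysval \<Psi> r u"
    define X where "X = P ^ r * (P powr (\<phi> * expo d) * Q powr lam)"
    have X0: "X \<ge> 0" using P by (simp add: X_def)
    have qfacts: "prime q" "k < q" "P powr \<phi> < real q" "real q \<le> Cp * P powr \<phi>" "q > 0"
        "b / Cp * P powr (real (k - (d + 1)) / real k) \<le> Q / real q + 1"
        "real q ^ (u - d + u + w) * (Q / real q + 1) powr lam \<le> G * (P powr (\<phi> * expo d) * Q powr lam)" if "q \<in> S" for q
    proof -
      have q: "prime q" "K * y < real q" "real q \<le> Cp * y" using S(3)[OF that] by auto
      show "prime q" by (rule q)
      show q0: "q > 0" using q(1) by (rule prime_gt_0_nat)
      have Ky: "K * y \<ge> K" "K * y \<ge> y" using K(1) y mult_left_mono[OF y, of K] mult_right_mono[OF K(1), of y] by auto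
      show "k < q" using Ky K q(2) by linarith
      show qy: "P powr \<phi> < real q" "real q \<le> Cp * P powr \<phi>" using Ky q by (auto simp: y_def)
      have Pk: "P powr \<phi> \<le> P powr (1 / real k)" using P \<phi> by (intro powr_mono) auto
      \<comment> \<open>Dividing Q by q costs at most P^(1/k) up to a constant, exactly the drop
        from (k-d)/k to (k-(d+1))/k in the conditions of consecutive stages.\<close>
      have split: "P powr (real (k - d) / real k) = P powr (real (k - (d + 1)) / real k) * P powr (1 / real k)"
      proof -
        have "real (k - d) / real k = real (k - (d + 1)) / real k + 1 / real k"
          using d by (simp add: add_divide_distrib[symmetric] of_nat_diff)
        thus ?thesis by (simp only: powr_add)
      qed
      have "b / Cp * P powr (real (k - (d + 1)) / real k) * real q
          \<le> b / Cp * P powr (real (k - (d + 1)) / real k) * (Cp * P powr (1 / real k))"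
        using qy Pk Cp AB by (intro mult_left_mono) (auto intro: order.trans mult_left_mono)
      also have "\<dots> = b * P powr (real (k - d) / real k)" using Cp by (simp add: split)
      also have "\<dots> \<le> Q" by (rule Q)
      finally have "b / Cp * P powr (real (k - (d + 1)) / real k) \<le> Q / real q"
        using q0 by (simp add: pos_le_divide_eq)
      thus "b / Cp * P powr (real (k - (d + 1)) / real k) \<le> Q / real q + 1" by simp
      have "1 \<le> P powr (real (k - (d + 1)) / real k)" using P by (simp add: ge_one_powr_ge_zero)
      hence "b / Cp * 1 \<le> b / Cp * P powr (real (k - (d + 1)) / real k)" using b' by (intro mult_left_mono) auto
      hence "b / Cp \<le> Q / real q" using \<open>b / Cp * P powr (real (k - (d + 1)) / real k) \<le> Q / real q\<close> by simp
      hence "c * (b / Cp) \<le> c * (Q / real q)" using AB Cp by (intro mult_left_mono) (auto simp: c_def)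
      hence c1: "1 \<le> c * (Q / real q)" using AB Cp by (simp add: c_def)
      show "real q ^ (u - d + u + w) * (Q / real q + 1) powr lam \<le> G * (P powr (\<phi> * expo d) * Q powr lam)"
        using scale_bound[OF P Q0 less_imp_le[OF qy(1)] qy(2) c1 q0, of "u - d + u + w" lam]
        unfolding M G_def .
    qed
    define A' where "A' = (\<lambda>q. {x \<in> tuples r ?X. incongruent q r x} \<times> tuples u ?Z)"
    define S' where "S' = {q \<in> S. \<forall>j\<in>{d + 1..k}. \<not> int q dvd coeff (\<Psi> j) (j - d)}"
    have at_prime: "real (energy k (A' q) ?V) \<le> K2 * (G * X)" if "q \<in> S'" for q
    proof -
      have qS: "q \<in> S" and ql: "\<And>j. j \<in> {d + 1..k} \<Longrightarrow> \<not> int q dvd coeff (\<Psi> j) (j - d)" using that by (auto simp: S'_def)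
      note q = qfacts[OF qS]
      let ?L = "Q / real q + 1"
      have L1: "?L \<ge> 1" using Q0 by simp
      have mL: "real m / real q + 1 \<le> ?L" using m q(5) by (simp add: divide_right_mono)
      have "difference_bound d C' r' P ?L (?L powr lam) q (\<lambda>j. coeff (\<Psi> j) (j - d))"
        by (rule C'(2)[OF P q(6,3,4) lead])
      then obtain W where W: "W \<ge> 0" "\<forall>h \<Psi>' a m. h \<in> {1..n div q ^ k} \<longrightarrow>
          (\<forall>j\<in>{1..k}. degree (\<Psi>' j) \<le> j - (d + 1)) \<longrightarrow>
          (\<forall>j\<in>{1..k}. coeff (\<Psi>' j) (j - (d + 1)) = int h * int q ^ (k - j) * int (j - d) * coeff (\<Psi> j) (j - d)) \<longrightarrow>
          real m \<le> ?L \<longrightarrow>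
          real (energy k (tuples r' ?X \<times> tuples u {a<..a + int m}) (sysval \<Psi>' r' u)) \<le> W"
        "real (n div q ^ k) ^ (2 * r') * W \<le> C' * (P ^ (2 * r') * ?L powr lam)"
        unfolding difference_bound_def n_def by blast
      have "real (energy k (A' q) ?V) \<le> real (q ^ (u - d) * d ^ d * r ^ r) * (real q ^ u * (real u * (real q ^ (\<Sum>j=k-r+1..k. k - j) *
        (3 ^ r * (2 * P ^ r * (CJ * ?L powr lam) + P ^ r / P ^ (2 * r') * (real (n div q ^ k) ^ (2 * r') * W))))))"
      proof (rule energy_at_prime[where \<Gamma> = "{(\<xi>, \<eta>). incongruent q r \<xi>}" and d = d and a = a and m = m])
        show "prime q" "1 \<le> k" "r \<le> k" "0 < u" "real n \<le> P" "0 < P" "0 < r'" "r \<le> 2 * r'" "0 \<le> W"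
          using q k2 r ku nP P r' W by auto
      next
        fix x z assume "(x, z) \<in> A' q"
        thus "x \<in> tuples r ?X \<and> z \<in> tuples u ?Z \<and> (residues_of q r x, residues_of q u z) \<in> {(\<xi>, \<eta>). incongruent q r \<xi>}"
          using q(5) by (simp add: A'_def incongruent_residues_of)
      next
        fix \<gamma> :: "(nat \<Rightarrow> int) \<times> (nat \<Rightarrow> int)"
        have "card {\<gamma>' \<in> tuples r {0..<int q} \<times> tuples u {0..<int q}. \<gamma>' \<in> {(\<xi>, \<eta>). incongruent q r \<xi>} \<and>
          (\<forall>j\<in>{1..k}. [sysval \<Psi> r u \<gamma> j = sysval \<Psi> r u \<gamma>' j] (mod int q))}
          \<le> card {\<gamma>' \<in> tuples r {0..<int q} \<times> tuples u {0..<int q}.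
          (\<forall>j\<in>{1..k}. [sysval \<Psi> r u \<gamma> j = sysval \<Psi> r u \<gamma>' j] (mod int q))}"
          by (intro card_mono finite_Collect_mem finite_cartesian_product finite_tuples) auto
        also have "\<dots> \<le> q ^ (u - d) * d ^ d * r ^ r"
          unfolding r_def using q(1,2) d ku deg ql by (intro card_stage_residues_le) auto
        finally show "card {\<gamma>' \<in> tuples r {0..<int q} \<times> tuples u {0..<int q}. \<gamma>' \<in> {(\<xi>, \<eta>). incongruent q r \<xi>} \<and>
          (\<forall>j\<in>{1..k}. [sysval \<Psi> r u \<gamma> j = sysval \<Psi> r u \<gamma>' j] (mod int q))} \<le> q ^ (u - d) * d ^ d * r ^ r" .
      next
        fix \<xi> \<eta> :: "nat \<Rightarrow> int" and m' assume "(\<xi>, \<eta>) \<in> {(\<xi>, \<eta>). incongruent q r \<xi>}" "m' < u"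
        hence inc: "incongruent q (k - d) \<xi>" by (simp add: r_def)
        show "nonsingular_mod q r {k - r + 1..k} (translate (\<eta> m') \<Psi>) \<xi>"
          unfolding r_def
        proof (rule nonsingular_stage[OF q(1,2) _ _ _ inc])
          fix j assume "j \<in> {1..k}"
          thus "degree (translate (\<eta> m') \<Psi> j) \<le> j - d" using deg by (intro degree_translate[of k]) auto
        next
          fix j assume j: "j \<in> {d + 1..k}"
          hence "coeff (translate (\<eta> m') \<Psi> j) (j - d) = coeff (\<Psi> j) (j - d)"
            using deg by (intro coeff_translate[of k]) auto
          thus "\<not> int q dvd coeff (translate (\<eta> m') \<Psi> j) (j - d)" using ql[OF j] by simp
        qed (use d in auto)
      next
        fix j assume "j \<in> {1..k}"
        thus "degree (\<Psi> j) \<le> j - d" using deg by blast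
      next
        fix a' n' assume "real n' \<le> real m / real q + 1"
        thus "real (energy k (tuples u {a'<..a' + int n'}) (\<lambda>z j. \<Sum>m<u. z m ^ j)) \<le> CJ * ?L powr lam"
          using mL by (intro J[OF L1]) linarith
      next
        fix h \<Psi>' a' n' assume h: "h \<in> {1..n div q ^ k}" "\<And>j. j \<in> {1..k} \<Longrightarrow> degree (\<Psi>' j) \<le> j - (d + 1)"
          "\<And>j. j \<in> {1..k} \<Longrightarrow> coeff (\<Psi>' j) (j - (d + 1)) = int h * int q ^ (k - j) * int (j - d) * coeff (\<Psi> j) (j - d)"
          and n': "real n' \<le> real m / real q + 1"
        have "real n' \<le> ?L" using n' mL by linarith
        thus "real (energy k (tuples r' ?X \<times> tuples u {a'<..a' + int n'}) (sysval \<Psi>' r' u)) \<le> W"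
          using W(2)[rule_format, OF h(1), of \<Psi>' n' a'] h(2,3) by blast
      qed
      also have "\<dots> \<le> real (q ^ (u - d) * d ^ d * r ^ r) * (real q ^ u * (real u * (real q ^ (\<Sum>j=k-r+1..k. k - j) *
        (3 ^ r * (2 * P ^ r * (CJ * ?L powr lam) + P ^ r / P ^ (2 * r') * (C' * (P ^ (2 * r') * ?L powr lam)))))))"
        using P by (intro mult_left_mono add_left_mono W(3)) auto
      also have "\<dots> = K2 * (P ^ r * (real q ^ (u - d + u + w) * ?L powr lam))"
        using P by (simp add: K2_def w_def power_add field_simps)
      also have "\<dots> \<le> K2 * (P ^ r * (G * (P powr (\<phi> * expo d) * Q powr lam)))"
        using nonneg P by (intro mult_left_mono q(7)) auto
      also have "\<dots> = K2 * (G * X)" by (simp add: X_def mult_ac)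
      finally show ?thesis .
    qed
    have coinc: "real (energy k (tuples u ?Z) (\<lambda>z j. \<Sum>m<u. z m ^ j)) \<le> K3 * (G * (P powr (\<phi> * expo d) * Q powr lam))"
    proof -
      have "S \<noteq> {}" using S(2) by (auto simp: N_def)
      then obtain q where qS: "q \<in> S" by blast
      note q = qfacts[OF qS]
      have mL: "real m / real q + 1 \<le> Q / real q + 1" using m q(5) by (simp add: divide_right_mono)
      have "real (energy k (tuples u ?Z) (\<lambda>z j. \<Sum>m<u. z m ^ j))
        \<le> K3 * (real q ^ (2 * u - k) * (Q / real q + 1) powr lam)"
        unfolding K3_def using energy_reduce[OF q(1,2) mL, of a] .
      also have "\<dots> \<le> K3 * (real q ^ (u - d + u + w) * (Q / real q + 1) powr lam)"
        using nonneg q(5) d ku by (intro mult_left_mono mult_right_mono power_increasing) auto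
      also have "\<dots> \<le> K3 * (G * (P powr (\<phi> * expo d) * Q powr lam))"
        using nonneg by (intro mult_left_mono q(7))
      finally show ?thesis .
    qed
    have dist: "energy k ({x \<in> tuples r ?X. inj_on x {..<r}} \<times> tuples u ?Z) ?V \<le> (\<Sum>q\<in>S'. energy k (A' q) ?V)"
    proof (rule energy_cover)
      show "finite S'" using S(1) by (simp add: S'_def)
      show "finite (A' q)" for q
        unfolding A'_def by (intro finite_cartesian_product finite_Collect_mem finite_tuples) auto
    next
      fix p p' assume p: "p \<in> {x \<in> tuples r ?X. inj_on x {..<r}} \<times> tuples u ?Z" "p' \<in> {x \<in> tuples r ?X. inj_on x {..<r}} \<times> tuples u ?Z"
      obtain x z x' z' where pp: "p = (x, z)" "p' = (x', z')" by (metis surj_pair)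
      have x: "x \<in> tuples r ?X" "inj_on x {..<r}" "x' \<in> tuples r ?X" "inj_on x' {..<r}" "z \<in> tuples u ?Z" "z' \<in> tuples u ?Z"
        using p by (simp_all add: pp)
      \<comment> \<open>A single prime has to preserve the degrees of the system and keep the
        variables of both sides incongruent.\<close>
      define D where "D = (\<Prod>j\<in>{d + 1..k}. coeff (\<Psi> j) (j - d)) * pair_differences r x * pair_differences r x'"
      have D0: "D \<noteq> 0" using lead pair_differences_nonzero[OF x(2)] pair_differences_nonzero[OF x(4)] by (simp add: D_def)
      have "real_of_int \<bar>\<Prod>j\<in>{d + 1..k}. coeff (\<Psi> j) (j - d)\<bar> = (\<Prod>j\<in>{d + 1..k}. of_int \<bar>coeff (\<Psi> j) (j - d)\<bar>)"
        by (simp add: abs_prod)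
      also have "\<dots> \<le> (\<Prod>j\<in>{d + 1..k}. B * P powr A)" using lead by (intro prod_mono) auto
      also have "\<dots> = (B * P powr A) ^ (k - d)" by simp
      also have "\<dots> \<le> (B * P powr A) ^ k"
      proof (rule power_increasing)
        have "1 * 1 \<le> B * P powr A" using AB P by (intro mult_mono) (auto simp: ge_one_powr_ge_zero)
        thus "1 \<le> B * P powr A" by simp
      qed simp
      also have "\<dots> = B ^ k * P powr (real k * A)"
        using P by (simp add: power_mult_distrib powr_realpow[symmetric] powr_powr mult.commute)
      finally have l: "real_of_int \<bar>\<Prod>j\<in>{d + 1..k}. coeff (\<Psi> j) (j - d)\<bar> \<le> B ^ k * P powr (real k * A)" .
      have "real_of_int \<bar>D\<bar> = real_of_int \<bar>\<Prod>j\<in>{d + 1..k}. coeff (\<Psi> j) (j - d)\<bar> * of_int \<bar>pair_differences r x\<bar> * of_int \<bar>pair_differences r x'\<bar>"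
        by (simp add: D_def abs_mult)
      also have "\<dots> \<le> (B ^ k * P powr (real k * A)) * P ^ (r ^ 2) * P ^ (r ^ 2)"
        using P AB by (intro mult_mono l pair_differences_le[OF x(1) nP P] pair_differences_le[OF x(3) nP P]) auto
      also have "\<dots> = B ^ k * P powr (real k * A + 2 * real (r ^ 2))"
      proof -
        have "P ^ (r ^ 2) = P powr real (r ^ 2)" using P by (intro powr_realpow[symmetric]) simp
        thus ?thesis by (simp only: powr_add mult_2 mult.assoc)
      qed
      also have "\<dots> \<le> B ^ k * P powr (\<phi> * real N)"
      proof (intro mult_left_mono powr_mono)
        have "(real k * A + 2 * real (r ^ 2)) / \<phi> \<le> real N" unfolding N_def by linarith
        thus "real k * A + 2 * real (r ^ 2) \<le> \<phi> * real N" using \<phi> by (simp add: field_simps)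
      qed (use P Bk in auto)
      also have "\<dots> < K ^ N * P powr (\<phi> * real N)"
      proof (rule mult_strict_right_mono)
        have "K ^ 1 \<le> K ^ N" using K by (intro power_increasing) (auto simp: N_def)
        thus "B ^ k < K ^ N" using K by simp
      qed (use P in simp)
      also have "\<dots> = (K * y) ^ card S"
        using P by (simp add: S(2) y_def power_mult_distrib powr_realpow[symmetric] powr_powr)
      finally have "real_of_int \<bar>D\<bar> < (K * y) ^ card S" .
      moreover have "K * y \<ge> 0" using K y by simp
      ultimately obtain q where q: "q \<in> S" "\<not> int q dvd D"
        using exists_prime_not_dvd[OF S(1), of "K * y" D] S(3) D0 by blast
      have "\<not> int q dvd coeff (\<Psi> j) (j - d)" if "j \<in> {d + 1..k}" for j
      proof
        assume "int q dvd coeff (\<Psi> j) (j - d)"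
        also have "\<dots> dvd (\<Prod>j\<in>{d + 1..k}. coeff (\<Psi> j) (j - d))" using that by (intro dvd_prodI) auto
        finally show False using q(2) by (simp add: D_def)
      qed
      hence "q \<in> S'" using q(1) by (simp add: S'_def)
      moreover have "\<not> int q dvd pair_differences r x" "\<not> int q dvd pair_differences r x'" using q(2) by (auto simp: D_def)
      hence "incongruent q r x" "incongruent q r x'" by (auto intro: incongruent_if_not_dvd)
      ultimately show "\<exists>q\<in>S'. p \<in> A' q \<and> p' \<in> A' q" using x by (auto simp: A'_def pp)
    qed
    have "card S' \<le> N" unfolding S(2)[symmetric] S'_def using S(1) by (intro card_mono) auto
    have "real (energy k ({x \<in> tuples r ?X. inj_on x {..<r}} \<times> tuples u ?Z) ?V) \<le> real (\<Sum>q\<in>S'. energy k (A' q) ?V)"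
      using dist by (simp only: of_nat_le_iff)
    also have "\<dots> = (\<Sum>q\<in>S'. real (energy k (A' q) ?V))" by simp
    also have "\<dots> \<le> real (card S') * (K2 * (G * X))" using sum_bounded_above[of S' _ "K2 * (G * X)", OF at_prime] by simp
    also have "\<dots> \<le> real N * (K2 * (G * X))"
      using \<open>card S' \<le> N\<close> nonneg X0 by (intro mult_right_mono) auto
    finally have main: "real (energy k ({x \<in> tuples r ?X. inj_on x {..<r}} \<times> tuples u ?Z) ?V) \<le> real N * (K2 * (G * X))" .
    have "real (energy k (tuples r ?X \<times> tuples u ?Z) ?V)
       \<le> 2 * real (energy k ({x \<in> tuples r ?X. inj_on x {..<r}} \<times> tuples u ?Z) ?V)
         + K4 * real (card ?X) ^ r * real (energy k (tuples u ?Z) (\<lambda>z j. \<Sum>m<u. z m ^ j))"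
      unfolding K4_def sysval_def
      by (rule energy_coincidence[where X = ?X and B = "tuples u ?Z" and r = r and v = "\<lambda>x j. poly (\<Psi> j) x"
          and U = "\<lambda>z j. \<Sum>m<u. z m ^ j"])
        (auto intro: finite_tuples)
    also have "\<dots> \<le> 2 * (real N * (K2 * (G * X))) + K4 * P ^ r * (K3 * (G * (P powr (\<phi> * expo d) * Q powr lam)))"
      using main coinc nP nonneg P by (intro add_mono mult_left_mono mult_mono power_mono) auto
    also have "\<dots> = ((2 * (real N * K2) + K4 * K3) * G) * X" by (simp add: X_def algebra_simps)
    also have "\<dots> \<le> C * X" unfolding C_def using X0 by (intro mult_right_mono) auto
    also have "X = P powr (real r + \<phi> * expo d) * Q powr lam"
      using P by (simp add: X_def powr_add powr_realpow)
    finally show "real (energy k (tuples (k - d) {1..int (nat \<lfloor>P\<rfloor>)} \<times> tuples u ?Z) (sysval \<Psi> (k - d) u))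
       \<le> C * (P powr (real (k - d) + \<phi> * expo d) * Q powr lam)" by (simp only: r_def n_def)
  qed
qed

end

section \<open>The initial stage\<close>

text \<open>Before any differencing x and z enter in the same way, so incongruence and power sums
  are best stated for the concatenated tuple.\<close>

definition glue :: "nat \<Rightarrow> (nat \<Rightarrow> int) \<Rightarrow> (nat \<Rightarrow> int) \<Rightarrow> nat \<Rightarrow> int" where
  "glue r x z = (\<lambda>i. if i < r then x i else z (i - r))"

lemma sum_glue: "(\<Sum>i<r + u. glue r x z i ^ j) = (\<Sum>i<r. x i ^ j) + (\<Sum>m<u. z m ^ j)"
proof -
  have "(\<Sum>i<r + u. glue r x z i ^ j) = (\<Sum>i<r. glue r x z i ^ j) + (\<Sum>i\<in>{r..<r + u}. glue r x z i ^ j)"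
    using sum.atLeastLessThan_concat[of 0 r "r + u" "\<lambda>i. glue r x z i ^ j"] by (simp add: lessThan_atLeast0)
  also have "(\<Sum>i\<in>{r..<r + u}. glue r x z i ^ j) = (\<Sum>m<u. z m ^ j)"
    by (rule sum.reindex_bij_witness[of _ "\<lambda>m. r + m" "\<lambda>i. i - r"]) (auto simp: glue_def)
  also have "(\<Sum>i<r. glue r x z i ^ j) = (\<Sum>i<r. x i ^ j)" by (intro sum.cong) (auto simp: glue_def)
  finally show ?thesis .
qed

lemma incongruent_glueD:
  assumes "incongruent q (r + u) (glue r x z)"
  shows "incongruent q r x" "i < r \<Longrightarrow> m < u \<Longrightarrow> \<not> int q dvd x i - z m"
proof -
  show "incongruent q r x" unfolding incongruent_def
  proof (intro allI impI)
    fix i l assume il: "i < r" "l < r" "i \<noteq> l"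
    hence "\<not> int q dvd glue r x z i - glue r x z l" using assms unfolding incongruent_def by auto
    thus "\<not> int q dvd x i - x l" using il by (simp add: glue_def)
  qed
  assume im: "i < r" "m < u"
  hence "i < r + u" "r + m < r + u" "i \<noteq> r + m" by auto
  hence "\<not> int q dvd glue r x z i - glue r x z (r + m)" using assms unfolding incongruent_def by blast
  thus "\<not> int q dvd x i - z m" using im by (simp add: glue_def)
qed

lemma incongruent_glue_residues:
  assumes "q > 0" "incongruent q (r + u) (glue r x z)"
  shows "incongruent q (r + u) (glue r (residues_of q r x) (residues_of q u z))"
  by (rule incongruent_cong[OF assms(2)]) (auto simp: glue_def residues_of_def cong_def)

text \<open>All k power sums of r + u variables save q^k together. For r = k - 1 this leaves
  q^(u-1), one factor less than for free \<eta>.\<close>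

lemma card_initial_residues_le:
  assumes "prime q" "k < q" "k \<le> r + u"
  shows "card {\<gamma>' \<in> tuples r {0..<int q} \<times> tuples u {0..<int q}.
        \<forall>j\<in>{1..k}. [sysval (monom 1) r u \<gamma> j = sysval (monom 1) r u \<gamma>' j] (mod int q)}
      \<le> q ^ (r + u - k) * k ^ k"
    (is "card ?S \<le> _")
proof -
  let ?T = "{x \<in> tuples (r + u) {0..<int q}. \<forall>j\<in>{1..k}. [(\<Sum>i<r + u. x i ^ j) = sysval (monom 1) r u \<gamma> j] (mod int q)}"
  let ?f = "\<lambda>(x, z). restrict (glue r x z) {..<r + u}"
  have "card ?S \<le> card ?T"
  proof (rule card_inj_on_le[where f = ?f])
    show "inj_on ?f ?S"
    proof (rule inj_onI)
      fix p p' assume p: "p \<in> ?S" "p' \<in> ?S" "?f p = ?f p'"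
      obtain x z x' z' where pp: "p = (x, z)" "p' = (x', z')" by (metis surj_pair)
      have mem: "x \<in> tuples r {0..<int q}" "x' \<in> tuples r {0..<int q}" "z \<in> tuples u {0..<int q}" "z' \<in> tuples u {0..<int q}"
        using p(1,2) by (simp_all add: pp)
      have eq: "glue r x z i = glue r x' z' i" if "i < r + u" for i
        using fun_cong[OF p(3), of i] that by (simp add: pp)
      have "x = x'"
      proof (rule PiE_ext[OF mem(1,2)])
        fix i assume "i \<in> {..<r}"
        thus "x i = x' i" using eq[of i] by (simp add: glue_def)
      qed
      moreover have "z = z'"
      proof (rule PiE_ext[OF mem(3,4)])
        fix i assume "i \<in> {..<u}"
        thus "z i = z' i" using eq[of "r + i"] by (simp add: glue_def)
      qed
      ultimately show "p = p'" by (simp add: pp)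
    qed
    show "finite ?T" by (intro finite_Collect_mem finite_tuples) auto
    show "?f ` ?S \<subseteq> ?T"
    proof (rule image_subsetI)
      fix p assume p: "p \<in> ?S"
      obtain x z where pp: "p = (x, z)" by (metis surj_pair)
      have mem: "x \<in> tuples r {0..<int q}" "z \<in> tuples u {0..<int q}"
        and cg: "\<And>j. j \<in> {1..k} \<Longrightarrow> [sysval (monom 1) r u \<gamma> j = sysval (monom 1) r u (x, z) j] (mod int q)"
        using p by (simp_all add: pp)
      have "restrict (glue r x z) {..<r + u} \<in> tuples (r + u) {0..<int q}"
      proof (rule PiE_I)
        fix i assume "i \<in> {..<r + u}"
        thus "restrict (glue r x z) {..<r + u} i \<in> {0..<int q}"
          using PiE_mem[OF mem(1), of i] PiE_mem[OF mem(2), of "i - r"] by (auto simp: glue_def)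
      qed simp
      moreover have "(\<Sum>i<r + u. restrict (glue r x z) {..<r + u} i ^ j) = sysval (monom 1) r u (x, z) j" for j
        using sum_glue[of r x z j u] by (simp add: sysval_Pair poly_monom)
      ultimately show "?f p \<in> ?T" using cg by (simp add: pp cong_sym)
    qed
  qed
  also have "\<dots> \<le> q ^ (r + u - k) * k ^ k" using assms by (intro card_power_sums_le) auto
  finally show ?thesis .
qed

context mean_value_bound
begin

text \<open>Incongruence is imposed on all k - 1 + u variables, since
  \<open>nonsingular_initial\<close> compares the x_i with the residue of any z_m. The factor of
  \<phi> in the exponent equals \<open>expo 1\<close>, although the polynomials still have degree j:
  again there are k - 1 variables to lift and the residues save one factor q.\<close>

lemma initial_step:
  assumes \<phi>: "0 < \<phi>" "\<phi> \<le> 1 / real k" and ready: "stage_ready 0 \<phi>"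
  shows "\<exists>C>0. \<forall>P\<ge>1. real (energy k (tuples (k - 1 + u) {1..int (nat \<lfloor>P\<rfloor>)}) (\<lambda>x j. \<Sum>i<k - 1 + u. x i ^ j))
    \<le> C * P powr (real (k - 1) + \<phi> * (2 * real u - 1 + (real k - 1) * (real k - 2) / 2 - lam) + lam)"
proof -
  define r where "r = k - 1"
  define s where "s = r + u"
  define w where "w = (\<Sum>j=k-r+1..k. k - j)"
  define E where "E = 2 * real u - 1 + (real k - 1) * (real k - 2) / 2 - lam"
  have r: "r \<ge> 1" "r \<le> k" "k = r + 1" using k2 by (auto simp: r_def)
  have u1: "u \<ge> 1" using ku k2 by simp
  obtain r' where r': "r' > 0" "r \<le> 2 * r'" and key: "\<And>A B b C. 0 \<le> A \<Longrightarrow> 1 \<le> B \<Longrightarrow> 0 < b \<Longrightarrow> 1 \<le> C \<Longrightarrow> (\<exists>C'\<ge>0. \<forall>P L q lead.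
     1 \<le> P \<longrightarrow> b * P powr (real (k - (0 + 1)) / real k) \<le> L \<longrightarrow> P powr \<phi> < real q \<longrightarrow> real q \<le> C * P powr \<phi> \<longrightarrow>
     (\<forall>j\<in>{0 + 1..k}. lead j \<noteq> 0 \<and> of_int \<bar>lead j\<bar> \<le> B * P powr A) \<longrightarrow>
     difference_bound 0 C' r' P L (L powr lam) q lead)"
  proof -
    have "0 < k" using k2 by simp
    from differencing_key[OF this \<phi> ready] obtain r' where *: "r' > 0" "k - 0 \<le> 2 * r'" "\<forall>A B b C. 0 \<le> A \<longrightarrow> 1 \<le> B \<longrightarrow> 0 < b \<longrightarrow> 1 \<le> C \<longrightarrow> (\<exists>C'\<ge>0. \<forall>P L q lead.
     1 \<le> P \<longrightarrow> b * P powr (real (k - (0 + 1)) / real k) \<le> L \<longrightarrow> P powr \<phi> < real q \<longrightarrow> real q \<le> C * P powr \<phi> \<longrightarrow>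
     (\<forall>j\<in>{0 + 1..k}. lead j \<noteq> 0 \<and> of_int \<bar>lead j\<bar> \<le> B * P powr A) \<longrightarrow>
     difference_bound 0 C' r' P L (L powr lam) q lead)" by blast
    show ?thesis by (rule that[of r']) (use * r in auto)
  qed
  \<comment> \<open>The leading coefficients are 1, so only the differences of the s variables on
    the two sides have to be avoided, whence 2 s^2.\<close>
  define N where "N = nat \<lceil>(2 * real (s ^ 2)) / \<phi>\<rceil> + 1"
  define K where "K = real k + 2"
  have K: "K \<ge> 1" "K > 1" "K > real k" by (auto simp: K_def)
  obtain Cp where Cp: "Cp \<ge> 1" "\<And>y. y \<ge> 1 \<Longrightarrow> \<exists>S::nat set. finite S \<and> card S = N \<and> (\<forall>p\<in>S. prime p \<and> K * y < real p \<and> real p \<le> Cp * y)"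
    using many_primes_in_dyadic_range[OF K(1), of N] by blast
  have b': "0 < 1 / Cp" using Cp by simp
  obtain C' where C': "C' \<ge> 0" "\<And>P L q lead. 1 \<le> P \<Longrightarrow> 1 / Cp * P powr (real (k - (0 + 1)) / real k) \<le> L \<Longrightarrow> P powr \<phi> < real q \<Longrightarrow> real q \<le> Cp * P powr \<phi> \<Longrightarrow>
     (\<forall>j\<in>{0 + 1..k}. lead j \<noteq> 0 \<and> of_int \<bar>lead j\<bar> \<le> 1 * P powr 0) \<Longrightarrow>
     difference_bound 0 C' r' P L (L powr lam) q lead"
    using key[of 0 1 "1 / Cp" Cp] b' Cp(1) by auto
  define K2 where "K2 = real (k ^ k) * real u * 3 ^ r * (2 * CJ + C')"
  define K4 where "K4 = (4 * real s ^ 2) ^ (s + 1)"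
  define G where "G = max 1 ((1 + Cp) powr lam) * max 1 (Cp powr E)"
  define C where "C = (2 * (real N * K2) + K4 * CJ) * G + 1"
  have nonneg: "K2 \<ge> 0" "K4 \<ge> 0" "G \<ge> 0"
    using CJ C' by (auto simp: K2_def K4_def G_def)
  have M: "real (u - 1 + u + w) - lam = E"
    using u1 triangular_exponent[OF r(2)] unfolding E_def w_def by (simp add: r(3) of_nat_diff)
  have "\<forall>P\<ge>1. real (energy k (tuples s {1..int (nat \<lfloor>P\<rfloor>)}) (\<lambda>x j. \<Sum>i<s. x i ^ j)) \<le> C * P powr (real r + \<phi> * E + lam)"
  proof (intro allI impI)
    fix P :: real assume P: "1 \<le> P"
    define n where "n = nat \<lfloor>P\<rfloor>"
    have nP: "real n \<le> P" using P unfolding n_def by linarith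
    define y where "y = P powr \<phi>"
    have y: "y \<ge> 1" using P \<phi> by (simp add: y_def ge_one_powr_ge_zero)
    obtain S :: "nat set" where S: "finite S" "card S = N" "\<And>q. q \<in> S \<Longrightarrow> prime q \<and> K * y < real q \<and> real q \<le> Cp * y"
      using Cp(2)[OF y] by blast
    let ?X = "{1..int n}" and ?Z = "{0<..0 + int n}"
    let ?U = "\<lambda>x j. \<Sum>i<s. (x i :: int) ^ j"
    define X where "X = P ^ r * (P powr (\<phi> * E) * P powr lam)"
    have X0: "X \<ge> 0" using P by (simp add: X_def)
    have P0: "P > 0" using P by simp
    have qfacts: "prime q" "k < q" "P powr \<phi> < real q" "real q \<le> Cp * P powr \<phi>" "q > 0"
        "1 / Cp * P powr (real (k - (0 + 1)) / real k) \<le> P / real q + 1"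
        "real q ^ (u - 1 + u + w) * (P / real q + 1) powr lam \<le> G * (P powr (\<phi> * E) * P powr lam)" if "q \<in> S" for q
    proof -
      have q: "prime q" "K * y < real q" "real q \<le> Cp * y" using S(3)[OF that] by auto
      show "prime q" by (rule q)
      show q0: "q > 0" using q(1) by (rule prime_gt_0_nat)
      have Ky: "K * y \<ge> K" "K * y \<ge> y" using K(1) y mult_left_mono[OF y, of K] mult_right_mono[OF K(1), of y] by auto
      show "k < q" using Ky K q(2) by linarith
      show qy: "P powr \<phi> < real q" "real q \<le> Cp * P powr \<phi>" using Ky q by (auto simp: y_def)
      have Pk: "P powr \<phi> \<le> P powr (1 / real k)" using P \<phi> by (intro powr_mono) auto
      have split: "P powr (real (k - (0 + 1)) / real k) * P powr (1 / real k) = P"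
      proof -
        have "real (k - (0 + 1)) / real k + 1 / real k = 1"
          using k2 by (simp add: add_divide_distrib[symmetric] of_nat_diff)
        thus ?thesis using P by (simp only: powr_add[symmetric] powr_one)
      qed
      have "1 / Cp * P powr (real (k - (0 + 1)) / real k) * real q
          \<le> 1 / Cp * P powr (real (k - (0 + 1)) / real k) * (Cp * P powr (1 / real k))"
        using qy Pk Cp by (intro mult_left_mono) (auto intro: order.trans mult_left_mono)
      also have "\<dots> = P powr (real (k - (0 + 1)) / real k) * P powr (1 / real k)" using Cp by simp
      also have "\<dots> = P" by (rule split)
      finally have le: "1 / Cp * P powr (real (k - (0 + 1)) / real k) \<le> P / real q"
        using q0 by (simp add: pos_le_divide_eq)
      thus "1 / Cp * P powr (real (k - (0 + 1)) / real k) \<le> P / real q + 1" by simp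
      have "1 \<le> P powr (real (k - (0 + 1)) / real k)" using P by (simp add: ge_one_powr_ge_zero)
      hence "1 / Cp * 1 \<le> 1 / Cp * P powr (real (k - (0 + 1)) / real k)" using b' by (intro mult_left_mono) auto
      hence "1 / Cp \<le> P / real q" using le by simp
      hence "Cp * (1 / Cp) \<le> Cp * (P / real q)" using Cp by (intro mult_left_mono) auto
      hence c1: "1 \<le> Cp * (P / real q)" using Cp by simp
      show "real q ^ (u - 1 + u + w) * (P / real q + 1) powr lam \<le> G * (P powr (\<phi> * E) * P powr lam)"
        using scale_bound[OF P P0 less_imp_le[OF qy(1)] qy(2) c1 q0, of "u - 1 + u + w" lam]
        unfolding M G_def .
    qed
    define A' where "A' = (\<lambda>q. {x \<in> tuples s ?X. incongruent q s x})"
    define A2 where "A2 = (\<lambda>q. {(x, z) \<in> tuples r ?X \<times> tuples u ?Z. incongruent q s (glue r x z)})"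
    have finA2: "finite (A2 q)" for q
      by (rule finite_subset[of _ "tuples r ?X \<times> tuples u ?Z"]) (auto simp: A2_def intro!: finite_tuples finite_cartesian_product)
    have XZ: "?X = ?Z" by auto
    have to_pairs: "energy k (A' q) ?U \<le> energy k (A2 q) (sysval (monom 1) r u)" for q
    proof (rule energy_inj_le[OF finA2, where f = "\<lambda>x. (restrict x {..<r}, \<lambda>m\<in>{..<u}. x (r + m))"])
      have glued: "glue r (restrict x {..<r}) (\<lambda>m\<in>{..<u}. x (r + m)) i = x i" if "i < s" for x :: "nat \<Rightarrow> int" and i
        using that by (auto simp: glue_def s_def)
      show "inj_on (\<lambda>x. (restrict x {..<r}, \<lambda>m\<in>{..<u}. x (r + m))) (A' q)"
      proof (rule inj_onI)
        fix x x' assume x: "x \<in> A' q" "x' \<in> A' q" and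
          eq: "(restrict x {..<r}, \<lambda>m\<in>{..<u}. x (r + m)) = (restrict x' {..<r}, \<lambda>m\<in>{..<u}. x' (r + m))"
        have mem: "x \<in> tuples s ?X" "x' \<in> tuples s ?X" using x by (auto simp: A'_def)
        show "x = x'"
        proof (rule PiE_ext[OF mem])
          fix i assume "i \<in> {..<s}"
          hence "i < s" by simp
          have "x i = glue r (restrict x {..<r}) (\<lambda>m\<in>{..<u}. x (r + m)) i" using glued[OF \<open>i < s\<close>] by simp
          also have "\<dots> = glue r (restrict x' {..<r}) (\<lambda>m\<in>{..<u}. x' (r + m)) i"
            using eq by (simp only: prod.inject)
          also have "\<dots> = x' i" by (rule glued[OF \<open>i < s\<close>])
          finally show "x i = x' i" .
        qed
      qed
      show "(\<lambda>x. (restrict x {..<r}, \<lambda>m\<in>{..<u}. x (r + m))) ` A' q \<subseteq> A2 q"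
      proof (rule image_subsetI)
        fix x assume "x \<in> A' q"
        hence x: "x \<in> tuples s ?X" "incongruent q s x" by (auto simp: A'_def)
        have "x i \<in> ?X" if "i < s" for i using PiE_mem[OF x(1)] that by blast
        hence "restrict x {..<r} \<in> tuples r ?X" "(\<lambda>m\<in>{..<u}. x (r + m)) \<in> tuples u ?Z"
          unfolding XZ[symmetric] by (auto simp: s_def)
        moreover have "incongruent q s (glue r (restrict x {..<r}) (\<lambda>m\<in>{..<u}. x (r + m)))"
          by (rule incongruent_cong[OF x(2)]) (simp add: glued)
        ultimately show "(restrict x {..<r}, \<lambda>m\<in>{..<u}. x (r + m)) \<in> A2 q" by (simp add: A2_def)
      qed
      fix x j assume "x \<in> A' q"
      have "?U x j = (\<Sum>i<r + u. glue r (restrict x {..<r}) (\<lambda>m\<in>{..<u}. x (r + m)) i ^ j)"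
        using glued by (intro sum.cong) (auto simp: s_def)
      thus "?U x j = sysval (monom 1) r u (restrict x {..<r}, \<lambda>m\<in>{..<u}. x (r + m)) j"
        by (simp only: sum_glue sysval_Pair poly_monom mult_1)
    qed
    have at_prime: "real (energy k (A' q) ?U) \<le> K2 * (G * X)" if qS: "q \<in> S" for q
    proof -
      note q = qfacts[OF qS]
      let ?L = "P / real q + 1"
      have L1: "?L \<ge> 1" using P0 by simp
      have mL: "real n / real q + 1 \<le> ?L" using nP q(5) by (simp add: divide_right_mono)
      have "difference_bound 0 C' r' P ?L (?L powr lam) q (\<lambda>j. 1)"
        using P by (intro C'(2)[OF P q(6,3,4)]) auto
      then obtain W where W: "W \<ge> 0" "\<forall>h \<Psi>' a m. h \<in> {1..n div q ^ k} \<longrightarrow>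
          (\<forall>j\<in>{1..k}. degree (\<Psi>' j) \<le> j - (0 + 1)) \<longrightarrow>
          (\<forall>j\<in>{1..k}. coeff (\<Psi>' j) (j - (0 + 1)) = int h * int q ^ (k - j) * int (j - 0) * 1) \<longrightarrow>
          real m \<le> ?L \<longrightarrow>
          real (energy k (tuples r' ?X \<times> tuples u {a<..a + int m}) (sysval \<Psi>' r' u)) \<le> W"
        "real (n div q ^ k) ^ (2 * r') * W \<le> C' * (P ^ (2 * r') * ?L powr lam)"
        unfolding difference_bound_def n_def by blast
      have "real (energy k (A' q) ?U) \<le> real (energy k (A2 q) (sysval (monom 1) r u))"
        using to_pairs[of q] by simp
      also have "\<dots> \<le> real (q ^ (u - 1) * k ^ k) * (real q ^ u * (real u * (real q ^ (\<Sum>j=k-r+1..k. k - j) *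
        (3 ^ r * (2 * P ^ r * (CJ * ?L powr lam) + P ^ r / P ^ (2 * r') * (real (n div q ^ k) ^ (2 * r') * W))))))"
      proof (rule energy_at_prime[where \<Gamma> = "{(\<xi>, \<eta>). incongruent q (r + u) (glue r \<xi> \<eta>)}" and d = 0 and a = 0 and m = n])
        show "prime q" "1 \<le> k" "r \<le> k" "0 < u" "real n \<le> P" "0 < P" "0 < r'" "r \<le> 2 * r'" "0 \<le> W"
          using q k2 r u1 nP P r' W by auto
      next
        fix x z assume "(x, z) \<in> A2 q"
        thus "x \<in> tuples r ?X \<and> z \<in> tuples u ?Z \<and> (residues_of q r x, residues_of q u z) \<in> {(\<xi>, \<eta>). incongruent q (r + u) (glue r \<xi> \<eta>)}"
          using incongruent_glue_residues[OF q(5)] by (simp add: A2_def s_def)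
      next
        fix \<gamma> :: "(nat \<Rightarrow> int) \<times> (nat \<Rightarrow> int)"
        have "card {\<gamma>' \<in> tuples r {0..<int q} \<times> tuples u {0..<int q}. \<gamma>' \<in> {(\<xi>, \<eta>). incongruent q (r + u) (glue r \<xi> \<eta>)} \<and>
          (\<forall>j\<in>{1..k}. [sysval (monom 1) r u \<gamma> j = sysval (monom 1) r u \<gamma>' j] (mod int q))}
          \<le> card {\<gamma>' \<in> tuples r {0..<int q} \<times> tuples u {0..<int q}.
          (\<forall>j\<in>{1..k}. [sysval (monom 1) r u \<gamma> j = sysval (monom 1) r u \<gamma>' j] (mod int q))}"
          by (intro card_mono finite_Collect_mem finite_cartesian_product finite_tuples) auto
        also have "\<dots> \<le> q ^ (r + u - k) * k ^ k"
          using q(1,2) ku by (intro card_initial_residues_le) auto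
        also have "r + u - k = u - 1" using r by simp
        finally show "card {\<gamma>' \<in> tuples r {0..<int q} \<times> tuples u {0..<int q}. \<gamma>' \<in> {(\<xi>, \<eta>). incongruent q (r + u) (glue r \<xi> \<eta>)} \<and>
          (\<forall>j\<in>{1..k}. [sysval (monom 1) r u \<gamma> j = sysval (monom 1) r u \<gamma>' j] (mod int q))} \<le> q ^ (u - 1) * k ^ k" .
      next
        fix \<xi> \<eta> :: "nat \<Rightarrow> int" and m' assume *: "(\<xi>, \<eta>) \<in> {(\<xi>, \<eta>). incongruent q (r + u) (glue r \<xi> \<eta>)}" "m' < u"
        hence inc: "incongruent q (r + u) (glue r \<xi> \<eta>)" by simp
        show "nonsingular_mod q r {k - r + 1..k} (translate (\<eta> m') (monom 1)) \<xi>"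
          unfolding r_def using incongruent_glueD[OF inc] q(1,2) k2 *(2)
          by (intro nonsingular_initial) (auto simp: r_def)
      next
        fix j assume "j \<in> {1..k}"
        show "degree (monom (1::int) j) \<le> j - 0" by (simp add: degree_monom_le)
      next
        fix a' n' assume "real n' \<le> real n / real q + 1"
        thus "real (energy k (tuples u {a'<..a' + int n'}) (\<lambda>z j. \<Sum>m<u. z m ^ j)) \<le> CJ * ?L powr lam"
          using mL by (intro J[OF L1]) linarith
      next
        fix h \<Psi>' a' n' assume h: "h \<in> {1..n div q ^ k}" "\<And>j. j \<in> {1..k} \<Longrightarrow> degree (\<Psi>' j) \<le> j - (0 + 1)"
          "\<And>j. j \<in> {1..k} \<Longrightarrow> coeff (\<Psi>' j) (j - (0 + 1)) = int h * int q ^ (k - j) * int (j - 0) * coeff (monom 1 j) (j - 0)"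
          and n': "real n' \<le> real n / real q + 1"
        have "real n' \<le> ?L" using n' mL by linarith
        moreover have "\<forall>j\<in>{1..k}. coeff (\<Psi>' j) (j - (0 + 1)) = int h * int q ^ (k - j) * int (j - 0) * 1"
          using h(3) by simp
        ultimately show "real (energy k (tuples r' ?X \<times> tuples u {a'<..a' + int n'}) (sysval \<Psi>' r' u)) \<le> W"
          using W(2)[rule_format, OF h(1), of \<Psi>' n' a'] h(2) by blast
      qed
      also have "\<dots> \<le> real (q ^ (u - 1) * k ^ k) * (real q ^ u * (real u * (real q ^ (\<Sum>j=k-r+1..k. k - j) *
        (3 ^ r * (2 * P ^ r * (CJ * ?L powr lam) + P ^ r / P ^ (2 * r') * (C' * (P ^ (2 * r') * ?L powr lam)))))))"
        using P by (intro mult_left_mono add_left_mono W(3)) auto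
      also have "\<dots> = K2 * (P ^ r * (real q ^ (u - 1 + u + w) * ?L powr lam))"
        using P by (simp add: K2_def w_def power_add field_simps)
      also have "\<dots> \<le> K2 * (P ^ r * (G * (P powr (\<phi> * E) * P powr lam)))"
        using nonneg P by (intro mult_left_mono q(7)) auto
      also have "\<dots> = K2 * (G * X)" by (simp add: X_def mult_ac)
      finally show ?thesis .
    qed
    \<comment> \<open>Diagonal solutions bound the mean value from below, so (P/q)^u \<le> CJ (P/q +
      1)^lam. Hence the coincidence term, a constant times P^s, is within the target.\<close>
    have coinc: "P ^ s \<le> CJ * (G * X)"
    proof -
      have "S \<noteq> {}" using S(2) by (auto simp: N_def)
      then obtain q where qS: "q \<in> S" by blast
      note q = qfacts[OF qS]
      let ?L = "P / real q + 1"
      define n' where "n' = nat \<lceil>P / real q\<rceil>"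
      have pos: "P / real q > 0" using P0 q(5) by simp
      have n'1: "P / real q \<le> real n'" unfolding n'_def by (rule real_nat_ceiling_ge)
      have n'2: "real n' \<le> ?L" unfolding n'_def using pos by linarith
      have n'3: "?L \<ge> 1" using pos by linarith
      note n' = n'1 n'2 n'3
      have "card (tuples u {0<..0 + int n'}) \<le> energy k (tuples u {0<..0 + int n'}) (\<lambda>z j. \<Sum>m<u. z m ^ j)"
        unfolding energy_def
        by (rule card_inj_on_le[where f = "\<lambda>x. (x, x)"])
          (auto simp: inj_on_def intro!: finite_subset[of _ "tuples u {0<..0 + int n'} \<times> tuples u {0<..0 + int n'}"] finite_cartesian_product finite_PiE)
      hence "real (card (tuples u {0<..0 + int n'})) \<le> real (energy k (tuples u {0<..0 + int n'}) (\<lambda>z j. \<Sum>m<u. z m ^ j))" by simp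
      also have "\<dots> \<le> CJ * ?L powr lam" using n' by (intro J)
      finally have "real n' ^ u \<le> CJ * ?L powr lam" by (simp add: card_PiE)
      moreover have "(P / real q) ^ u \<le> real n' ^ u" using n' P0 by (intro power_mono) auto
      ultimately have J1: "(P / real q) ^ u \<le> CJ * ?L powr lam" by linarith
      have "P ^ s = P ^ r * (real q ^ u * (P / real q) ^ u)"
        using q(5) by (simp add: s_def power_add power_divide)
      also have "\<dots> \<le> P ^ r * (real q ^ u * (CJ * ?L powr lam))"
        using P0 by (intro mult_left_mono J1) auto
      also have "\<dots> \<le> P ^ r * (real q ^ (u - 1 + u + w) * (CJ * ?L powr lam))"
        using P0 CJ q(5) u1 by (intro mult_left_mono mult_right_mono power_increasing) auto
      also have "\<dots> = CJ * (P ^ r * (real q ^ (u - 1 + u + w) * ?L powr lam))" by (simp add: mult_ac)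
      also have "\<dots> \<le> CJ * (P ^ r * (G * (P powr (\<phi> * E) * P powr lam)))"
        using CJ P0 by (intro mult_left_mono q(7)) auto
      finally show ?thesis by (simp add: X_def mult_ac)
    qed
    have dist: "energy k {x \<in> tuples s ?X. inj_on x {..<s}} ?U \<le> (\<Sum>q\<in>S. energy k (A' q) ?U)"
    proof (rule energy_cover[OF S(1)])
      show "finite (A' q)" for q
        unfolding A'_def by (intro finite_Collect_mem finite_tuples) auto
    next
      fix x x' assume "x \<in> {x \<in> tuples s ?X. inj_on x {..<s}}" "x' \<in> {x \<in> tuples s ?X. inj_on x {..<s}}"
      hence x: "x \<in> tuples s ?X" "inj_on x {..<s}" "x' \<in> tuples s ?X" "inj_on x' {..<s}" by simp_all
      define D where "D = pair_differences s x * pair_differences s x'"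
      have D0: "D \<noteq> 0" using pair_differences_nonzero[OF x(2)] pair_differences_nonzero[OF x(4)] by (simp add: D_def)
      have "real_of_int \<bar>D\<bar> = of_int \<bar>pair_differences s x\<bar> * of_int \<bar>pair_differences s x'\<bar>"
        by (simp add: D_def abs_mult)
      also have "\<dots> \<le> P ^ (s ^ 2) * P ^ (s ^ 2)"
        using P by (intro mult_mono pair_differences_le[OF x(1) nP P] pair_differences_le[OF x(3) nP P]) auto
      also have "\<dots> = 1 * P powr (2 * real (s ^ 2))"
      proof -
        have "P ^ (s ^ 2) = P powr real (s ^ 2)" using P by (intro powr_realpow[symmetric]) simp
        thus ?thesis by (simp only: powr_add mult_2 mult_1)
      qed
      also have "\<dots> \<le> 1 * P powr (\<phi> * real N)"
      proof (intro mult_left_mono powr_mono)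
        have "2 * real (s ^ 2) / \<phi> \<le> real N" unfolding N_def by linarith
        thus "2 * real (s ^ 2) \<le> \<phi> * real N" using \<phi> by (simp add: field_simps)
      qed (use P in auto)
      also have "\<dots> < K ^ N * P powr (\<phi> * real N)"
      proof (rule mult_strict_right_mono)
        have "K ^ 1 \<le> K ^ N" using K by (intro power_increasing) (auto simp: N_def)
        thus "1 < K ^ N" using K by simp
      qed (use P in simp)
      also have "\<dots> = (K * y) ^ card S"
        using P by (simp add: S(2) y_def power_mult_distrib powr_realpow[symmetric] powr_powr)
      finally have "real_of_int \<bar>D\<bar> < (K * y) ^ card S" .
      moreover have "K * y \<ge> 0" using K y by simp
      ultimately obtain q where q: "q \<in> S" "\<not> int q dvd D"
        using exists_prime_not_dvd[OF S(1), of "K * y" D] S(3) D0 by blast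
      have "\<not> int q dvd pair_differences s x" "\<not> int q dvd pair_differences s x'" using q(2) by (auto simp: D_def)
      hence "incongruent q s x" "incongruent q s x'" by (auto intro: incongruent_if_not_dvd)
      thus "\<exists>q\<in>S. x \<in> A' q \<and> x' \<in> A' q" using x q(1) by (auto simp: A'_def)
    qed
    have "real (energy k {x \<in> tuples s ?X. inj_on x {..<s}} ?U) \<le> real (\<Sum>q\<in>S. energy k (A' q) ?U)"
      using dist by (simp only: of_nat_le_iff)
    also have "\<dots> = (\<Sum>q\<in>S. real (energy k (A' q) ?U))" by simp
    also have "\<dots> \<le> real N * (K2 * (G * X))" using sum_bounded_above[of S _ "K2 * (G * X)", OF at_prime] by (simp add: S(2))
    finally have main: "real (energy k {x \<in> tuples s ?X. inj_on x {..<s}} ?U) \<le> real N * (K2 * (G * X))" .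
    \<comment> \<open>A trivial second component brings the system into the shape of
      \<open>energy_coincidence\<close>.\<close>
    let ?VV = "\<lambda>(x, z :: unit) j. (\<Sum>i<s. x i ^ j) + (0::int)"
    have "energy k (tuples s ?X) ?U \<le> energy k (tuples s ?X \<times> {()}) ?VV"
      by (rule energy_inj_le[where f = "\<lambda>x. (x, ())"]) (auto simp: inj_on_def intro: finite_tuples)
    hence "real (energy k (tuples s ?X) ?U) \<le> real (energy k (tuples s ?X \<times> {()}) ?VV)" by simp
    also have "\<dots> \<le> 2 * real (energy k ({x \<in> tuples s ?X. inj_on x {..<s}} \<times> {()}) ?VV)
         + K4 * real (card ?X) ^ s * real (energy k {()} (\<lambda>z j. 0))"
      unfolding K4_def
      by (rule energy_coincidence[where X = ?X and B = "{()}" and r = s and v = "\<lambda>x j. x ^ j" and U = "\<lambda>z j. 0"]) auto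
    also have "energy k ({x \<in> tuples s ?X. inj_on x {..<s}} \<times> {()}) ?VV \<le> energy k {x \<in> tuples s ?X. inj_on x {..<s}} ?U"
      by (rule energy_inj_le[where f = fst]) (auto simp: inj_on_def intro!: finite_Collect_mem finite_tuples)
    also have "energy k {()} (\<lambda>z j. 0) = 1"
    proof -
      have "{(x, y) \<in> {()} \<times> {()}. \<forall>j\<in>{1..k}. (0::int) = 0} = {((), ())}" by auto
      thus ?thesis by (simp add: energy_def)
    qed
    also have "2 * real (energy k {x \<in> tuples s ?X. inj_on x {..<s}} ?U) + K4 * real (card ?X) ^ s * real 1
      \<le> 2 * (real N * (K2 * (G * X))) + K4 * P ^ s * 1"
      using main nP nonneg P by (intro add_mono mult_left_mono mult_mono power_mono) auto
    also have "\<dots> \<le> 2 * (real N * (K2 * (G * X))) + K4 * (CJ * (G * X)) * 1"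
      using coinc nonneg by (intro add_left_mono mult_right_mono mult_left_mono) auto
    also have "\<dots> = ((2 * (real N * K2) + K4 * CJ) * G) * X" by (simp add: algebra_simps)
    also have "\<dots> \<le> C * X" unfolding C_def using X0 by (intro mult_right_mono) auto
    also have "X = P powr (real r + \<phi> * E + lam)"
      using P by (simp add: X_def powr_add powr_realpow)
    finally show "real (energy k (tuples s {1..int (nat \<lfloor>P\<rfloor>)}) ?U) \<le> C * P powr (real r + \<phi> * E + lam)"
      by (simp add: n_def)
  qed
  moreover have "C > 0" unfolding C_def using nonneg CJ by (intro add_nonneg_pos mult_nonneg_nonneg add_nonneg_nonneg) auto
  ultimately show ?thesis unfolding s_def r_def E_def by blast
qed

end

section \<open>The mean value as a solution count\<close>

lemma e_eq_cis: "e z = cis (2 * pi * z)"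
  by (simp add: e_def cis_conv_exp mult_ac)

lemma e_add: "e (a + b) = e a * e b"
  by (simp add: e_eq_cis cis_mult distrib_left)

lemma e_sum: "e (\<Sum>i\<in>I. f i) = (\<Prod>i\<in>I. e (f i))"
  by (induction I rule: infinite_finite_induct) (simp_all add: e_add, simp_all add: e_eq_cis)

lemma cnj_e: "cnj (e a) = e (- a)"
  by (simp add: e_eq_cis cis_cnj)

lemma continuous_e: "continuous_on S (\<lambda>a. e (a * c))"
  unfolding e_eq_cis cis_conv_exp by (intro continuous_intros)

lemma integrable_e: "integrable lborel (\<lambda>a. indicator {0..<1::real} a *\<^sub>R e (a * c))"
proof -
  have "set_integrable lborel {0..1::real} (\<lambda>a. e (a * c))"
    by (intro borel_integrable_atLeastAtMost' continuous_e)
  hence "set_integrable lborel {0..<1::real} (\<lambda>a. e (a * c))"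
    by (rule set_integrable_subset) auto
  thus ?thesis by (simp add: set_integrable_def)
qed

lemma integral_e: "(\<integral>a. indicator {0..<1::real} a *\<^sub>R e (a * of_int n) \<partial>lborel) = (if n = 0 then 1 else 0)"
proof (cases "n = 0")
  case True
  have "(\<integral>a. indicator {0..<1::real} a *\<^sub>R e (a * of_int n) \<partial>lborel) = (\<integral>a. indicator {0..<1::real} a *\<^sub>R (1::complex) \<partial>lborel)"
    using True by (simp add: e_def)
  also have "\<dots> = measure lborel {0..<1::real} *\<^sub>R 1"
    by (subst Bochner_Integration.integral_scaleR_left) auto
  finally show ?thesis using True by simp
next
  case False
  define c where "c = 2 * complex_of_real pi * \<i> * of_int n"
  have c: "c \<noteq> 0" using False by (simp add: c_def)
  have e: "e (a * of_int n) = exp (c * of_real a)" for a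
    by (simp add: e_def c_def mult_ac)
  have "(\<integral>a. indicator {0..<1::real} a *\<^sub>R e (a * of_int n) \<partial>lborel) = (\<integral>a. indicator {0..1::real} a *\<^sub>R e (a * of_int n) \<partial>lborel)"
  proof (rule integral_cong_AE)
    show "AE a in lborel. indicator {0..<1::real} a *\<^sub>R e (a * of_int n) = indicator {0..1::real} a *\<^sub>R e (a * of_int n)"
      using AE_lborel_singleton[of 1] by eventually_elim (auto simp: indicator_def)
    show "(\<lambda>a. indicator {0..<1::real} a *\<^sub>R e (a * of_int n)) \<in> borel_measurable lborel"
      using integrable_e[of "of_int n"] by (rule borel_measurable_integrable)
    have "set_integrable lborel {0..1::real} (\<lambda>a. e (a * of_int n))"
      by (intro borel_integrable_atLeastAtMost' continuous_e)
    thus "(\<lambda>a. indicator {0..1::real} a *\<^sub>R e (a * of_int n)) \<in> borel_measurable lborel"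
      unfolding set_integrable_def by (rule borel_measurable_integrable)
  qed
  also have "\<dots> = exp (c * of_real 1) / c - exp (c * of_real 0) / c"
  proof (rule integral_FTC_Icc)
    fix x :: real
    show "((\<lambda>a. exp (c * of_real a) / c) has_vector_derivative e (x * of_int n)) (at x within {0..1})"
      unfolding e using c
      by (auto intro!: derivative_eq_intros has_vector_derivative_real_field simp: field_simps)
  qed (auto intro: continuous_e)
  also have "exp (c * of_real 1) = 1"
    using e[of 1] cis_multiple_2pi[of "of_int n"] by (simp add: e_eq_cis)
  finally show ?thesis using False by simp
qed

text \<open>The 2s-th power is the square of the modulus of the s-th power. Expanded over pairs of
  s-tuples it factors over the coordinates, and each coordinate integral is 0 or 1.\<close>

lemma vinogradov_J_eq_energy:
  "vinogradov_J s k P = real (energy k (tuples s {1..\<lfloor>P\<rfloor>}) (\<lambda>x j. \<Sum>i<s. x i ^ j))"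
proof -
  let ?N = "{x::nat. 1 \<le> x \<and> real x \<le> P}" and ?X = "{1..\<lfloor>P\<rfloor>}"
  let ?M = "Pi\<^sub>M {1..k} (\<lambda>_. lborel :: real measure)"
  let ?T = "tuples s ?X"
  define V where "V = (\<lambda>(x :: nat \<Rightarrow> int) j. \<Sum>i<s. x i ^ j)"
  have finT: "finite ?T" by (intro finite_PiE) auto
  interpret product_sigma_finite "\<lambda>_::nat. lborel :: real measure" by standard
  have img: "int ` ?N = ?X"
  proof
    show "int ` ?N \<subseteq> ?X" by (auto simp: le_floor_iff)
    show "?X \<subseteq> int ` ?N"
    proof
      fix x assume "x \<in> ?X"
      hence "x = int (nat x)" "nat x \<in> ?N" by (auto simp: le_floor_iff)
      thus "x \<in> int ` ?N" by blast
    qed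
  qed
  define S where "S = (\<lambda>\<alpha>. \<Sum>x\<in>?N. e (\<Sum>i=1..k. \<alpha> i * real x ^ i))"
  have S: "S \<alpha> = (\<Sum>x\<in>?X. e (\<Sum>i=1..k. \<alpha> i * real_of_int x ^ i))" for \<alpha>
    unfolding S_def img[symmetric] by (subst sum.reindex) (auto simp: inj_on_def)
  have pow: "S \<alpha> ^ s = (\<Sum>x\<in>?T. e (\<Sum>i=1..k. \<alpha> i * of_int (V x i)))" for \<alpha>
  proof -
    have "S \<alpha> ^ s = (\<Prod>m<s. \<Sum>x\<in>?X. e (\<Sum>i=1..k. \<alpha> i * real_of_int x ^ i))" by (simp add: S)
    also have "\<dots> = (\<Sum>x\<in>?T. \<Prod>m<s. e (\<Sum>i=1..k. \<alpha> i * real_of_int (x m) ^ i))"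
      by (rule prod_sum_PiE) auto
    also have "\<dots> = (\<Sum>x\<in>?T. e (\<Sum>m<s. \<Sum>i=1..k. \<alpha> i * real_of_int (x m) ^ i))" by (simp add: e_sum)
    also have "\<dots> = (\<Sum>x\<in>?T. e (\<Sum>i=1..k. \<alpha> i * of_int (V x i)))"
    proof (intro sum.cong refl)
      fix x
      have "(\<Sum>m<s. \<Sum>i=1..k. \<alpha> i * real_of_int (x m) ^ i) = (\<Sum>i=1..k. \<alpha> i * of_int (V x i))"
        by (subst sum.swap) (simp add: V_def sum_distrib_left)
      thus "e (\<Sum>m<s. \<Sum>i=1..k. \<alpha> i * real_of_int (x m) ^ i) = e (\<Sum>i=1..k. \<alpha> i * of_int (V x i))" by simp
    qed
    finally show ?thesis .
  qed
  have main: "complex_of_real (cmod (S \<alpha>) ^ (2 * s)) = (\<Sum>p\<in>?T \<times> ?T. \<Prod>i\<in>{1..k}. e (\<alpha> i * of_int (V (fst p) i - V (snd p) i)))" for \<alpha>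
  proof -
    have "complex_of_real (cmod (S \<alpha>) ^ (2 * s)) = S \<alpha> ^ s * cnj (S \<alpha> ^ s)"
      by (simp only: complex_norm_square[symmetric] norm_power power_mult[symmetric] mult.commute of_real_power)
    also have "\<dots> = (\<Sum>x\<in>?T. \<Sum>y\<in>?T. e (\<Sum>i=1..k. \<alpha> i * of_int (V x i)) * e (- (\<Sum>i=1..k. \<alpha> i * of_int (V y i))))"
      unfolding pow cnj_sum cnj_e by (rule sum_product)
    also have "\<dots> = (\<Sum>x\<in>?T. \<Sum>y\<in>?T. \<Prod>i\<in>{1..k}. e (\<alpha> i * of_int (V x i - V y i)))"
      by (intro sum.cong refl)
        (simp add: e_add[symmetric] e_sum[symmetric] sum_subtractf[symmetric] right_diff_distrib)
    finally show ?thesis by (simp add: sum.cartesian_product case_prod_unfold)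
  qed
  have "complex_of_real (vinogradov_J s k P)
      = (\<integral>\<alpha>. complex_of_real (indicator (PiE {1..k} (\<lambda>_. {0..<1})) \<alpha> *\<^sub>R cmod (S \<alpha>) ^ (2 * s)) \<partial>?M)"
    unfolding vinogradov_J_def set_lebesgue_integral_def S_def by (rule integral_complex_of_real[symmetric])
  also have "\<dots> = (\<integral>\<alpha>. (\<Sum>p\<in>?T \<times> ?T. \<Prod>i\<in>{1..k}. indicator {0..<1::real} (\<alpha> i) *\<^sub>R e (\<alpha> i * of_int (V (fst p) i - V (snd p) i))) \<partial>?M)"
  proof (rule Bochner_Integration.integral_cong[OF refl])
    fix \<alpha> assume \<alpha>: "\<alpha> \<in> space ?M"
    \<comment> \<open>Points of the product space are extensional, so outside the box some
      coordinate leaves [0,1), and the product of indicators vanishes.\<close>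
    have ext: "\<alpha> \<in> extensional {1..k}" using \<alpha> by (auto simp: space_PiM PiE_def)
    show "complex_of_real (indicator (PiE {1..k} (\<lambda>_. {0..<1})) \<alpha> *\<^sub>R cmod (S \<alpha>) ^ (2 * s))
        = (\<Sum>p\<in>?T \<times> ?T. \<Prod>i\<in>{1..k}. indicator {0..<1::real} (\<alpha> i) *\<^sub>R e (\<alpha> i * of_int (V (fst p) i - V (snd p) i)))"
    proof (cases "\<alpha> \<in> PiE {1..k} (\<lambda>_. {0..<1})")
      case True
      hence "indicator {0..<1::real} (\<alpha> i) = (1::real)" if "i \<in> {1..k}" for i
        using that by (auto simp: PiE_iff)
      thus ?thesis using True main[of \<alpha>] by simp
    next
      case False
      then obtain i where i: "i \<in> {1..k}" "\<alpha> i \<notin> {0..<1}" using ext by (auto simp: PiE_iff)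
      have z: "(\<Prod>i\<in>{1..k}. indicator {0..<1::real} (\<alpha> i) *\<^sub>R e (\<alpha> i * of_int (V (fst p) i - V (snd p) i))) = 0" for p
        using i by (intro prod_zero) (auto intro!: bexI[of _ i])
      show ?thesis unfolding z using False by simp
    qed
  qed
  also have "\<dots> = (\<Sum>p\<in>?T \<times> ?T. \<integral>\<alpha>. (\<Prod>i\<in>{1..k}. indicator {0..<1::real} (\<alpha> i) *\<^sub>R e (\<alpha> i * of_int (V (fst p) i - V (snd p) i))) \<partial>?M)"
    by (intro Bochner_Integration.integral_sum product_integrable_prod integrable_e) auto
  also have "\<dots> = (\<Sum>p\<in>?T \<times> ?T. \<Prod>i\<in>{1..k}. (\<integral>a. indicator {0..<1::real} a *\<^sub>R e (a * of_int (V (fst p) i - V (snd p) i)) \<partial>lborel))"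
    by (intro sum.cong refl product_integral_prod integrable_e) auto
  also have "\<dots> = (\<Sum>p\<in>?T \<times> ?T. if \<forall>i\<in>{1..k}. V (fst p) i = V (snd p) i then 1 else 0)"
    unfolding integral_e by (intro sum.cong refl) (auto intro!: prod_zero)
  also have "\<dots> = of_nat (card {p \<in> ?T \<times> ?T. \<forall>i\<in>{1..k}. V (fst p) i = V (snd p) i})"
    using finT by (simp add: sum.If_cases Int_def)
  also have "{p \<in> ?T \<times> ?T. \<forall>i\<in>{1..k}. V (fst p) i = V (snd p) i} = {(x, y) \<in> ?T \<times> ?T. \<forall>i\<in>{1..k}. V x i = V y i}"
    by auto
  finally have "complex_of_real (vinogradov_J s k P) = of_real (real (energy k ?T V))"
    by (simp add: energy_def)
  thus ?thesis unfolding V_def by (simp only: of_real_eq_iff)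
qed

section \<open>The recursion for the exponents\<close>

text \<open>Translation invariance of the power-sum system, as the case r = 0, q = 1 of
  \<open>translate_equations\<close>.\<close>

lemma energy_translate_le:
  "energy k (tuples u {a<..a + int n}) (\<lambda>z j. \<Sum>m<u. z m ^ j) \<le> energy k (tuples u {1..int n}) (\<lambda>z j. \<Sum>m<u. z m ^ j)"
  unfolding energy_def
proof (rule card_inj_on_le)
  let ?A = "tuples u {a<..a + int n}" and ?B = "tuples u {1..int n}" and ?U = "\<lambda>z j. \<Sum>m<u. (z m :: int) ^ j"
  let ?d = "\<lambda>z. (\<lambda>m\<in>{..<u}. z m - a)"
  let ?f = "\<lambda>(z, w). (?d z, ?d w)"
  have shift: "a + 1 * ?d z m = z m" if "m < u" for z m using that by simp
  have inj: "z = w" if "z \<in> ?A" "w \<in> ?A" "?d z = ?d w" for z w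
  proof (rule PiE_ext[OF that(1,2)])
    fix m assume "m \<in> {..<u}"
    thus "z m = w m" using fun_cong[OF that(3), of m] by simp
  qed
  show "inj_on ?f {(z, w) \<in> ?A \<times> ?A. \<forall>j\<in>{1..k}. ?U z j = ?U w j}"
    using inj by (auto simp: inj_on_def)
  show "?f ` {(z, w) \<in> ?A \<times> ?A. \<forall>j\<in>{1..k}. ?U z j = ?U w j} \<subseteq> {(z, w) \<in> ?B \<times> ?B. \<forall>j\<in>{1..k}. ?U z j = ?U w j}"
  proof (rule image_subsetI)
    fix s assume s: "s \<in> {(z, w) \<in> ?A \<times> ?A. \<forall>j\<in>{1..k}. ?U z j = ?U w j}"
    obtain z w where ss: "s = (z, w)" by (metis surj_pair)
    have mem: "z \<in> ?A" "w \<in> ?A" and eq: "\<forall>j\<in>{1..k}. ?U z j = ?U w j" using s by (simp_all add: ss)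
    have "\<forall>j\<in>{1..k}. (\<Sum>i<0. poly ((\<lambda>_. 0) j) ((\<lambda>_. 0) i)) + (\<Sum>m<u. (a + 1 * ?d z m) ^ j)
        = (\<Sum>i<0. poly ((\<lambda>_. 0) j) ((\<lambda>_. 0) i)) + (\<Sum>m<u. (a + 1 * ?d w m) ^ j)"
      using eq by simp
    hence tr: "\<forall>j\<in>{1..k}. ?U (?d z) j = ?U (?d w) j"
      using translate_equations[where r = 0 and u = u and c = a and q = 1 and z = "?d z" and w = "?d w" and k = k
          and \<Psi> = "\<lambda>_. 0" and x = "\<lambda>_. 0" and y = "\<lambda>_. 0"] by simp
    have B: "?d z \<in> ?B" if "z \<in> ?A" for z
    proof (rule PiE_I)
      fix m assume "m \<in> {..<u}"
      thus "?d z m \<in> {1..int n}" using PiE_mem[OF that, of m] by auto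
    qed simp
    show "?f s \<in> {(z, w) \<in> ?B \<times> ?B. \<forall>j\<in>{1..k}. ?U z j = ?U w j}"
      using B[OF mem(1)] B[OF mem(2)] tr by (simp only: ss prod.case mem_Collect_eq mem_Sigma_iff simp_thms)
  qed
  show "finite {(z, w) \<in> ?B \<times> ?B. \<forall>j\<in>{1..k}. ?U z j = ?U w j}"
    by (rule finite_subset[of _ "?B \<times> ?B"]) (auto intro!: finite_cartesian_product finite_PiE)
qed

section \<open>Positivity of \<phi> and the descent through the stages\<close>

lemma phi_terminal: "j \<le> J \<Longrightarrow> phi k D j J = 1 / real k"
  by (subst phi.simps) simp

text \<open>For D \<le> k(k+1)/2 the coefficient of x exceeds -1/2, so with x \<le> 1/k the second
  summand cannot outweigh 1/(2k). Positivity matters because the number of primes used grows like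
  1/\<phi>.\<close>

lemma phi_step_pos:
  assumes "2 \<le> k" "D \<le> real k * (real k + 1) / 2" "1 \<le> J" "J < k" "0 < x" "x \<le> 1 / real k"
  shows "0 < phi_step k D (J + 1) x"
proof -
  define m where "m = real k - real J"
  have m: "m \<ge> 1" using assms(4) unfolding m_def by linarith
  have k: "real k > 0" using assms(1) by simp
  define N where "N = real J * (real J - 1) / 2 - D"
  define c where "c = 1 / 2 + N / (2 * real k * m)"
  have ps: "phi_step k D (J + 1) x = 1 / (2 * real k) + c * x"
    unfolding phi_step_def c_def N_def m_def by simp
  have "real J = real k - m" by (simp add: m_def)
  have "2 * real k * m + (real k - m) * (real k - m - 1) / 2 - real k * (real k + 1) / 2
      = real k * (m - 1) + (m * m + m) / 2"
    by (simp add: field_simps)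
  also have "\<dots> > 0" using m by (intro add_nonneg_pos) (auto intro!: add_pos_pos)
  finally have "2 * real k * m + (real k - m) * (real k - m - 1) / 2 - real k * (real k + 1) / 2 > 0" .
  moreover have "- a < b - D'" if "a + b - c > 0" "D' \<le> c" for a b c D' :: real
    using that by linarith
  ultimately have "N > - (2 * real k * m)"
    using assms(2) unfolding N_def \<open>real J = real k - m\<close> by blast
  hence "N / (2 * real k * m) > - 1" using m k by (simp add: field_simps)
  hence c: "c > - (1 / 2)" by (simp add: c_def)
  show ?thesis
  proof (cases "c \<ge> 0")
    case True
    thus ?thesis unfolding ps using k assms(5) by (intro add_pos_nonneg) auto
  next
    case False
    hence "c * (1 / real k) \<le> c * x" using assms(6) by (intro mult_left_mono_neg) auto
    moreover have "- (1 / 2) * (1 / real k) < c * (1 / real k)" using c k by (intro mult_strict_right_mono) auto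
    ultimately show ?thesis unfolding ps by simp
  qed
qed

lemma phi_bounds:
  assumes "2 \<le> k" "D \<le> real k * (real k + 1) / 2" "j \<le> k"
  shows "1 \<le> J \<Longrightarrow> 0 < phi k D j J \<and> phi k D j J \<le> 1 / real k"
proof (induction "j - J" arbitrary: J)
  case 0
  thus ?case using assms(1) by (simp add: phi_terminal)
next
  case (Suc n)
  have J: "J < j" using Suc.hyps(2) by simp
  have IH: "0 < phi k D j (J + 1) \<and> phi k D j (J + 1) \<le> 1 / real k"
    using Suc.hyps(1)[of "J + 1"] Suc.hyps(2) by simp
  have "0 < phi_step k D (J + 1) (phi k D j (J + 1))"
    using IH J assms Suc.prems by (intro phi_step_pos) auto
  moreover have "phi k D j J = min (1 / real k) (phi_step k D (J + 1) (phi k D j (J + 1)))"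
    by (subst phi.simps) (use J in simp)
  ultimately show ?case using assms(1) by simp
qed

lemma theta_attained:
  assumes "1 \<le> k"
  shows "\<exists>j\<in>{1..k}. theta k D = phi k D j 1"
proof -
  have "theta k D \<in> (\<lambda>j. phi k D j 1) ` {1..k}"
    unfolding theta_def using assms by (intro Min_in) auto
  thus ?thesis by blast
qed

context mean_value_bound
begin

text \<open>The value of \<open>phi_step\<close> is the \<phi> for which the inequality in
  \<open>stage_ready\<close> becomes an equality, since \<open>expo J\<close> equals k(k-J) +
  J(J-1)/2 - D. The index J belongs to stage J - 1. If the minimum is 1/k, the first alternative
  applies.\<close>

lemma stage_ready_phi:
  assumes lam: "lam = 2 * real u - real k * (real k + 1) / 2 + D"
    and J: "1 \<le> J" "J \<le> j" "j \<le> k" and next_stage: "J < j \<Longrightarrow> stage_bound J (phi k D j (J + 1))"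
  shows "stage_ready (J - 1) (phi k D j J)"
proof (cases "J = j")
  case True
  thus ?thesis by (simp add: stage_ready_def phi_terminal)
next
  case False
  hence Jj: "J < j" using J by simp
  let ?x = "phi k D j (J + 1)"
  have eq: "phi k D j J = min (1 / real k) (phi_step k D (J + 1) ?x)"
    by (subst phi.simps) (use Jj in simp)
  show ?thesis
  proof (cases "phi_step k D (J + 1) ?x < 1 / real k")
    case False
    thus ?thesis by (simp add: stage_ready_def eq)
  next
    case True
    hence eq2: "phi k D j J = phi_step k D (J + 1) ?x" by (simp add: eq)
    have m: "real (k - J) = real k - real J" "real k - real J > 0" using Jj J by auto
    have k: "real k > 0" using k2 by simp
    have "expo J = real k * (real k - real J) + real J * (real J - 1) / 2 - D"
    proof -
      have "expo J = 2 * real u - real J + (real k - real J) * (real k - real J - 1) / 2 - lam"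
        unfolding expo_def m(1) by simp
      also have "\<dots> = real k * (real k - real J) + real J * (real J - 1) / 2 - D"
        unfolding lam by (simp add: field_simps)
      finally show ?thesis .
    qed
    moreover have "2 * real k * (real k - real J) * phi_step k D (J + 1) ?x
        = (real k - real J) + (real k * (real k - real J) + real J * (real J - 1) / 2 - D) * ?x"
    proof -
      define m where "m = real k - real J"
      have m0: "m \<noteq> 0" using m unfolding m_def by simp
      define N where "N = real J * (real J - 1) / 2 - D"
      have "phi_step k D (J + 1) ?x = 1 / (2 * real k) + (1 / 2 + N / (2 * real k * m)) * ?x"
        unfolding phi_step_def N_def m_def by simp
      hence "2 * real k * m * phi_step k D (J + 1) ?x = m + (real k * m + N) * ?x"
        using m0 k by (simp add: field_simps)
      thus ?thesis unfolding N_def m_def by simp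
    qed
    ultimately have "real (k - J) + ?x * expo J \<le> 2 * real k * real (k - J) * phi k D j J"
      unfolding eq2 m(1) by (simp add: mult.commute)
    moreover have "J - 1 + 1 = J" "J < k" using J Jj by auto
    ultimately show ?thesis unfolding stage_ready_def using next_stage[OF Jj] by metis
  qed
qed

text \<open>The descent starts at J = j, where \<phi> = 1/k calls for no further stage, and stops at
  J = 2, because stage 0 is the separate initial step.\<close>

lemma stage_bound_phi:
  assumes lam: "lam = 2 * real u - real k * (real k + 1) / 2 + D" and D: "D \<le> real k * (real k + 1) / 2"
    and j: "j \<le> k"
  shows "2 \<le> J \<Longrightarrow> J \<le> j \<Longrightarrow> stage_bound (J - 1) (phi k D j J)"
proof (induction "j - J" arbitrary: J)
  case 0
  hence "stage_ready (J - 1) (phi k D j J)" using j by (intro stage_ready_phi[OF lam]) auto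
  thus ?case using 0 j phi_bounds[OF k2 D j, of J] by (intro stage_step) auto
next
  case (Suc n)
  have "stage_bound J (phi k D j (J + 1))" using Suc.hyps(1)[of "J + 1"] Suc.hyps(2) Suc.prems by simp
  hence "stage_ready (J - 1) (phi k D j J)" using Suc.prems j by (intro stage_ready_phi[OF lam]) auto
  thus ?case using Suc.prems j phi_bounds[OF k2 D j, of J] by (intro stage_step) auto
qed

lemma mean_value_step:
  assumes lam: "lam = 2 * real u - real k * (real k + 1) / 2 + D" and D: "D \<le> real k * (real k + 1) / 2"
  shows "\<exists>C>0. \<forall>P\<ge>1. vinogradov_J (u + (k - 1)) k P \<le> C * P powr
     (2 * real (u + (k - 1)) - real k * (real k + 1) / 2 + (D * (1 - theta k D) + (real k - 1) * (real k * theta k D - 1)))"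
proof -
  obtain j where j: "j \<in> {1..k}" "theta k D = phi k D j 1" using theta_attained[of k D] k2 by auto
  let ?\<phi> = "phi k D j 1"
  have jk: "j \<le> k" using j by simp
  have "stage_ready (1 - 1) ?\<phi>"
  proof (rule stage_ready_phi[OF lam])
    assume "1 < j"
    thus "stage_bound 1 (phi k D j (1 + 1))" using stage_bound_phi[OF lam D jk, of 2] by (simp add: numeral_2_eq_2)
  qed (use j in auto)
  hence "stage_ready 0 ?\<phi>" by simp
  moreover have "0 < ?\<phi>" "?\<phi> \<le> 1 / real k" using phi_bounds[OF k2 D jk, of 1] by auto
  ultimately obtain C where C: "C > 0" "\<forall>P\<ge>1. real (energy k (tuples (k - 1 + u) {1..int (nat \<lfloor>P\<rfloor>)}) (\<lambda>x j. \<Sum>i<k - 1 + u. x i ^ j))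
    \<le> C * P powr (real (k - 1) + ?\<phi> * (2 * real u - 1 + (real k - 1) * (real k - 2) / 2 - lam) + lam)"
    using initial_step[of ?\<phi>] by blast
  \<comment> \<open>For this lam the bracket multiplied by \<phi> equals k(k-1) - D, which produces
    the recursion for \<Delta>.\<close>
  have e: "real (k - 1) + ?\<phi> * (2 * real u - 1 + (real k - 1) * (real k - 2) / 2 - lam) + lam
    = 2 * real (u + (k - 1)) - real k * (real k + 1) / 2 + (D * (1 - theta k D) + (real k - 1) * (real k * theta k D - 1))"
    unfolding lam j(2) using k2 by (simp add: of_nat_diff field_simps)
  show ?thesis
  proof (intro exI[of _ C] conjI allI impI C(1))
    fix P :: real assume P: "1 \<le> P"
    have "int (nat \<lfloor>P\<rfloor>) = \<lfloor>P\<rfloor>" using P by simp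
    thus "vinogradov_J (u + (k - 1)) k P \<le> C * P powr (2 * real (u + (k - 1)) - real k * (real k + 1) / 2
        + (D * (1 - theta k D) + (real k - 1) * (real k * theta k D - 1)))"
      using C(2)[rule_format, OF P] unfolding e vinogradov_J_eq_energy by (simp add: add.commute)
  qed
qed

end

section \<open>The induction on l\<close>

text \<open>Preserves the invariant on which the positivity of \<theta> depends: for k x \<le> 1 the
  second summand is nonpositive, and 1 - x lies between 0 and 1.\<close>

lemma Delta_Suc_le:
  assumes "2 \<le> k" "D \<le> real k * (real k + 1) / 2" "0 < x" "x \<le> 1 / real k"
  shows "D * (1 - x) + (real k - 1) * (real k * x - 1) \<le> real k * (real k + 1) / 2"
proof -
  have "1 / real k \<le> 1" using assms(1) by simp
  hence x: "x \<le> 1" using assms(4) by linarith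
  have "real k * x \<le> 1" using assms(1,4) by (simp add: field_simps)
  hence "(real k - 1) * (real k * x - 1) \<le> 0" using assms(1) by (intro mult_nonneg_nonpos) auto
  moreover have "D * (1 - x) \<le> real k * (real k + 1) / 2 * (1 - x)"
    using assms(2) x by (intro mult_right_mono) auto
  moreover have "real k * (real k + 1) / 2 * (1 - x) \<le> real k * (real k + 1) / 2 * 1"
    using assms(3) by (intro mult_left_mono) auto
  ultimately show ?thesis by linarith
qed

theorem theorem3p1:
  fixes t k :: nat and \<mu> :: real
  assumes "2 \<le> k" and "k \<le> t"
    and "2 * real t - real k * (real k + 1) / 2 < \<mu>" and "\<mu> \<le> 2 * real t"
    and "\<exists>C>0. \<forall>P\<ge>1. vinogradov_J t k P \<le> C * P powr \<mu>"
  shows "\<forall>l\<ge>1. \<exists>C>0. \<forall>P\<ge>1. vinogradov_J (t + l * (k - 1)) k P \<le> C * P powr lam t k \<mu> l"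
proof -
  \<comment> \<open>The bound on \<Delta> is carried along so that the next \<theta> is positive; at
    l = 0 it is the condition \<mu> \<le> 2t.\<close>
  have "Delta t k \<mu> l \<le> real k * (real k + 1) / 2 \<and>
      (\<exists>C>0. \<forall>P\<ge>1. vinogradov_J (t + l * (k - 1)) k P \<le> C * P powr lam t k \<mu> l)" for l
  proof (induction l)
    case 0
    show ?case using assms(4,5) by (simp add: lam_def)
  next
    case (Suc l)
    define D where "D = Delta t k \<mu> l"
    define u where "u = t + l * (k - 1)"
    have D: "D \<le> real k * (real k + 1) / 2" using Suc by (simp add: D_def)
    obtain C where C: "C > 0" "\<forall>P\<ge>1. vinogradov_J u k P \<le> C * P powr lam t k \<mu> l"
      using Suc unfolding u_def by blast
    interpret mean_value_bound k u "lam t k \<mu> l" C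
    proof
      fix a n and L :: real assume L: "L \<ge> 1" "real n \<le> L"
      have "real (energy k (tuples u {a<..a + int n}) (\<lambda>z j. \<Sum>m<u. z m ^ j))
          \<le> real (energy k (tuples u {1..int n}) (\<lambda>z j. \<Sum>m<u. z m ^ j))"
        using energy_translate_le by (simp only: of_nat_le_iff)
      also have "\<dots> \<le> real (energy k (tuples u {1..\<lfloor>L\<rfloor>}) (\<lambda>z j. \<Sum>m<u. z m ^ j))"
      proof -
        have "int n \<le> \<lfloor>L\<rfloor>" using L by (simp add: le_floor_iff)
        thus ?thesis unfolding of_nat_le_iff
          by (intro energy_mono finite_PiE PiE_mono) auto
      qed
      also have "\<dots> = vinogradov_J u k L" by (rule vinogradov_J_eq_energy[symmetric])
      also have "\<dots> \<le> C * L powr lam t k \<mu> l" using C(2) L(1) by blast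
      finally show "real (energy k (tuples u {a<..a + int n}) (\<lambda>z j. \<Sum>m<u. z m ^ j)) \<le> C * L powr lam t k \<mu> l" .
    qed (use assms C in \<open>auto simp: u_def\<close>)
    have lam: "lam t k \<mu> l = 2 * real u - real k * (real k + 1) / 2 + D"
      by (simp add: lam_def u_def D_def)
    obtain j where j: "j \<in> {1..k}" "theta k D = phi k D j 1" using theta_attained[of k D] assms(1) by auto
    have jk: "j \<le> k" using j by simp
    have th: "0 < theta k D" "theta k D \<le> 1 / real k"
      using phi_bounds[OF assms(1) D jk, of 1] by (auto simp: j(2))
    have "Delta t k \<mu> (Suc l) = D * (1 - theta k D) + (real k - 1) * (real k * theta k D - 1)"
      by (simp add: D_def)
    moreover have "u + (k - 1) = t + Suc l * (k - 1)" by (simp add: u_def)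
    ultimately show ?case
      using Delta_Suc_le[OF assms(1) D th] mean_value_step[OF lam D] by (simp only: lam_def)
  qed
  thus ?thesis by blast
qed

end
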